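(* Let $(Q,g)$ be a complete connected Riemannian manifold, $T>0$, $(q_0,v_0),(q_T,v_T)\in TQ$, $p\in Q$, and $h>0$. If obstacle avoidance (for the point-obstacle $p$) is feasible for the tolerance $0<R\le h$, then for all $0<r<R$ there exist $\tau^\ast\in\mathbb{R}^+$ and $k^\ast\in\mathbb{N}$ such that for all $\tau>\tau^\ast$ and all $k\in\mathbb{N}$ with $k>k^\ast$, every minimizer of $J$ on $\Omega$ with the potential $V=V^k_{R,\tau}$ avoids the obstacle $p$ with tolerance $r$, where $$V^k_{R,\tau}(q)=\begin{cases} e\,\tau\exp\left(-\dfrac{1}{1-(d(p,q)/R)^{2k}}\right) & d(p,q)<R,\\ 0 & \text{otherwise.}\end{cases}$$
   Context: $Q$ is finite-dimensional, $d$ is the Riemannian distance, and $B_s(p)$ is the open ball of radius $s$ about $p$. The constant $h$ is a given sensing radius (potentials are required to vanish where the distance to the obstacle exceeds $h$). $\frac{D^2q}{dt^2}=\frac{D}{dt}\dot q$ is the covariant derivative of $\dot q$ along $q$ (Levi-Civita connection), and $\|\cdot\|$ is the norm induced by $g$. $H^2([0,T];Q)$ is the set of curves $q:[0,T]\to Q$ whose local chart expressions (on closed subintervals mapped into a chart domain) are of Sobolev class $H^2=W^{2,2}$. $\Omega$ is the set of $q\in H^2([0,T];Q)$ with $q(0)=q_0$, $q(T)=q_T$, $\dot q(0)=v_0$, $\dot q(T)=v_T$. For a potential $V:Q\to\mathbb{R}$, the functional $J:\Omega\to\mathbb{R}$ is $$J(q)=\frac12\int_0^T\left(\left\|\frac{D^2q}{dt^2}(t)\right\|^2+V(q(t))\right)dt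 .$$ A minimizer of $J$ is a curve $q^\ast\in\Omega$ with $J(q^\ast)\le J(\tilde q)$ for all $\tilde q\in\Omega$. A curve $q\in\Omega$ avoids the obstacle $p$ with tolerance $s$ if $q(t)\notin B_s(p)$ for all $t\in[0,T]$; obstacle avoidance with tolerance $s$ is feasible if there exists a curve in $\Omega$ avoiding $p$ with tolerance $s$. *)

theory Defs
  imports "HOL-Analysis.Analysis"
begin

section \<open>Smooth manifolds\<close>

text \<open>A manifold is a Hausdorff, second countable type \<open>'m\<close> together with an atlas of charts
  \<open>(U, \<phi>)\<close> taking values in a Euclidean space \<open>'e\<close>. Only the values of \<open>\<phi>\<close> on \<open>U\<close> matter.\<close>

type_synonym ('m, 'e) chart = "'m set \<times> ('m \<Rightarrow> 'e)"

abbreviation chart_dom :: "('m, 'e) chart \<Rightarrow> 'm set" where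
  "chart_dom c \<equiv> fst c"

abbreviation chart_map :: "('m, 'e) chart \<Rightarrow> 'm \<Rightarrow> 'e" where
  "chart_map c \<equiv> snd c"

abbreviation chart_inv :: "('m, 'e) chart \<Rightarrow> 'e \<Rightarrow> 'm" where
  "chart_inv c \<equiv> inv_into (chart_dom c) (chart_map c)"

definition is_chart :: "('m::topological_space, 'e::euclidean_space) chart \<Rightarrow> bool" where
  "is_chart c \<longleftrightarrow> open (chart_dom c) \<and> open (chart_map c ` chart_dom c) \<and>
     homeomorphism (chart_dom c) (chart_map c ` chart_dom c) (chart_map c) (chart_inv c)"

text \<open>\<open>C\<^sup>k\<close>-regularity of a map on an open subset of a Euclidean space.\<close>

primrec Ck_on :: "nat \<Rightarrow> 'a::euclidean_space set \<Rightarrow> ('a \<Rightarrow> 'b::real_normed_vector) \<Rightarrow> bool" where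
  "Ck_on 0 S f \<longleftrightarrow> continuous_on S f"
| "Ck_on (Suc k) S f \<longleftrightarrow> (\<forall>x\<in>S. f differentiable (at x)) \<and>
     (\<forall>v. Ck_on k S (\<lambda>x. frechet_derivative f (at x) v))"

definition smooth_on :: "'a::euclidean_space set \<Rightarrow> ('a \<Rightarrow> 'b::real_normed_vector) \<Rightarrow> bool" where
  "smooth_on S f \<longleftrightarrow> (\<forall>k. Ck_on k S f)"

definition smooth_atlas :: "('m::topological_space, 'e::euclidean_space) chart set \<Rightarrow> bool" where
  "smooth_atlas \<A> \<longleftrightarrow> (\<forall>c\<in>\<A>. is_chart c) \<and> (\<Union>c\<in>\<A>. chart_dom c) = UNIV \<and>
     (\<forall>c\<in>\<A>. \<forall>c'\<in>\<A>. smooth_on (chart_map c ` (chart_dom c \<inter> chart_dom c'))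
                          (chart_map c' \<circ> chart_inv c))"

section \<open>Tangent vectors and Riemannian metrics\<close>

text \<open>A tangent vector at \<open>q\<close> is the family of its components in all charts around \<open>q\<close>, related by
  the derivatives of the coordinate changes, and set to \<open>0\<close> at all other indices (so that equal
  tangent vectors are equal functions).\<close>

type_synonym ('m, 'e) tangent = "('m, 'e) chart \<Rightarrow> 'e"

definition coord_change_deriv ::
    "('m, 'e::euclidean_space) chart \<Rightarrow> ('m, 'e) chart \<Rightarrow> 'm \<Rightarrow> 'e \<Rightarrow> 'e" where
  "coord_change_deriv c c' q = frechet_derivative (chart_map c' \<circ> chart_inv c) (at (chart_map c q))"

definition tangent_space ::
    "('m, 'e::euclidean_space) chart set \<Rightarrow> 'm \<Rightarrow> ('m, 'e) tangent set" where
  "tangent_space \<A> q = {v.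
     (\<forall>c\<in>\<A>. \<forall>c'\<in>\<A>. q \<in> chart_dom c \<longrightarrow> q \<in> chart_dom c' \<longrightarrow> v c' = coord_change_deriv c c' q (v c)) \<and>
     (\<forall>c. \<not> (c \<in> \<A> \<and> q \<in> chart_dom c) \<longrightarrow> v c = 0)}"

text \<open>The tangent vector at \<open>q\<close> with components \<open>a\<close> in the chart \<open>c\<close>.\<close>

definition tangent_of_coords ::
    "('m, 'e::euclidean_space) chart set \<Rightarrow> ('m, 'e) chart \<Rightarrow> 'm \<Rightarrow> 'e \<Rightarrow> ('m, 'e) tangent" where
  "tangent_of_coords \<A> c q a =
     (\<lambda>c'. if c' \<in> \<A> \<and> q \<in> chart_dom c' then coord_change_deriv c c' q a else 0)"

type_synonym ('m, 'e) metric = "'m \<Rightarrow> ('m, 'e) tangent \<Rightarrow> ('m, 'e) tangent \<Rightarrow> real"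

text \<open>The local expression \<open>x \<mapsto> (a, b) \<mapsto> \<Sum>\<^sub>i\<^sub>j g\<^sub>i\<^sub>j(x) a\<^sub>i b\<^sub>j\<close> of the metric in the chart \<open>c\<close>.\<close>

definition metric_coords ::
    "('m, 'e::euclidean_space) chart set \<Rightarrow> ('m, 'e) metric \<Rightarrow> ('m, 'e) chart \<Rightarrow> 'e \<Rightarrow> 'e \<Rightarrow> 'e \<Rightarrow> real" where
  "metric_coords \<A> g c x a b =
     g (chart_inv c x) (tangent_of_coords \<A> c (chart_inv c x) a)
                       (tangent_of_coords \<A> c (chart_inv c x) b)"

definition riemannian_metric ::
    "('m, 'e::euclidean_space) chart set \<Rightarrow> ('m, 'e) metric \<Rightarrow> bool" where
  "riemannian_metric \<A> g \<longleftrightarrow>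
     (\<forall>q. \<forall>u\<in>tangent_space \<A> q. \<forall>v\<in>tangent_space \<A> q. g q u v = g q v u) \<and>
     (\<forall>q r. \<forall>u\<in>tangent_space \<A> q. \<forall>v\<in>tangent_space \<A> q. \<forall>w\<in>tangent_space \<A> q.
        g q (\<lambda>c. r *\<^sub>R u c + v c) w = r * g q u w + g q v w) \<and>
     (\<forall>q. \<forall>u\<in>tangent_space \<A> q. u \<noteq> (\<lambda>_. 0) \<longrightarrow> g q u u > 0) \<and>
     (\<forall>c\<in>\<A>. \<forall>a b. smooth_on (chart_map c ` chart_dom c) (\<lambda>x. metric_coords \<A> g c x a b))"

definition riemannian_manifold ::
    "('m::{t2_space, second_countable_topology}, 'e::euclidean_space) chart set \<Rightarrow> ('m, 'e) metric \<Rightarrow> bool" where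
  "riemannian_manifold \<A> g \<longleftrightarrow> smooth_atlas \<A> \<and> riemannian_metric \<A> g"

definition metric_norm :: "('m, 'e) metric \<Rightarrow> 'm \<Rightarrow> ('m, 'e) tangent \<Rightarrow> real" where
  "metric_norm g q v = sqrt (g q v v)"

text \<open>The Levi-Civita connection in the chart \<open>c\<close>: \<open>christoffel \<A> g c x a b\<close> is the component vector
  \<open>\<Gamma>\<^sup>k\<^sub>i\<^sub>j(x) a\<^sub>i b\<^sub>j\<close> of the covariant derivative, in direction \<open>a\<close>, of the vector field with constant
  components \<open>b\<close>. It is the unique bilinear map that is symmetric (no torsion) and compatible with
  the metric.\<close>

definition christoffel ::
    "('m, 'e::euclidean_space) chart set \<Rightarrow> ('m, 'e) metric \<Rightarrow> ('m, 'e) chart \<Rightarrow> 'e \<Rightarrow> 'e \<Rightarrow> 'e \<Rightarrow> 'e" where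
  "christoffel \<A> g c x = (THE \<Gamma>. bilinear \<Gamma> \<and> (\<forall>a b. \<Gamma> a b = \<Gamma> b a) \<and>
     (\<forall>z a b. frechet_derivative (\<lambda>y. metric_coords \<A> g c y a b) (at x) z =
        metric_coords \<A> g c x (\<Gamma> z a) b + metric_coords \<A> g c x a (\<Gamma> z b)))"

section \<open>Velocity, length and Riemannian distance\<close>

text \<open>The derivative at time \<open>t\<close> of a curve defined on \<open>[0,T]\<close>; one-sided at the end points.\<close>

definition velocity ::
    "('m, 'e::euclidean_space) chart set \<Rightarrow> real \<Rightarrow> (real \<Rightarrow> 'm) \<Rightarrow> real \<Rightarrow> ('m, 'e) tangent" where
  "velocity \<A> T q t = (\<lambda>c. if c \<in> \<A> \<and> q t \<in> chart_dom c
     then vector_derivative (chart_map c \<circ> q) (at t within {0..T}) else 0)"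

text \<open>\<open>C\<^sup>1\<close> on a closed interval, with one-sided derivatives at the end points (unlike the
  library's \<open>C1_differentiable_on\<close>, which uses two-sided derivatives).\<close>

definition C1_on_interval :: "real \<Rightarrow> real \<Rightarrow> (real \<Rightarrow> 'e::real_normed_vector) \<Rightarrow> bool" where
  "C1_on_interval s t f \<longleftrightarrow> (\<exists>f'. continuous_on {s..t} f' \<and>
     (\<forall>u\<in>{s..t}. (f has_vector_derivative f' u) (at u within {s..t})))"

text \<open>The finite set \<open>S\<close> contains the break points of the curve.\<close>

definition piecewise_C1_curve ::
    "('m::topological_space, 'e::euclidean_space) chart set \<Rightarrow> real \<Rightarrow> (real \<Rightarrow> 'm) \<Rightarrow> bool" where
  "piecewise_C1_curve \<A> T \<gamma> \<longleftrightarrow> continuous_on {0..T} \<gamma> \<and>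
     (\<exists>S. finite S \<and> (\<forall>c\<in>\<A>. \<forall>s t. 0 \<le> s \<and> s < t \<and> t \<le> T \<and> {s<..<t} \<inter> S = {} \<and>
        \<gamma> ` {s..t} \<subseteq> chart_dom c \<longrightarrow> C1_on_interval s t (chart_map c \<circ> \<gamma>)))"

definition curve_length ::
    "('m, 'e::euclidean_space) chart set \<Rightarrow> ('m, 'e) metric \<Rightarrow> real \<Rightarrow> (real \<Rightarrow> 'm) \<Rightarrow> real" where
  "curve_length \<A> g T \<gamma> = (LINT t:{0..T}|lebesgue. metric_norm g (\<gamma> t) (velocity \<A> T \<gamma> t))"

definition riemannian_dist ::
    "('m::topological_space, 'e::euclidean_space) chart set \<Rightarrow> ('m, 'e) metric \<Rightarrow> 'm \<Rightarrow> 'm \<Rightarrow> real" where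
  "riemannian_dist \<A> g p q =
     Inf {curve_length \<A> g 1 \<gamma> |\<gamma>. piecewise_C1_curve \<A> 1 \<gamma> \<and> \<gamma> 0 = p \<and> \<gamma> 1 = q}"

abbreviation riemannian_ball ::
    "('m::topological_space, 'e::euclidean_space) chart set \<Rightarrow> ('m, 'e) metric \<Rightarrow> 'm \<Rightarrow> real \<Rightarrow> 'm set" where
  "riemannian_ball \<A> g p s \<equiv> Metric_space.mball UNIV (riemannian_dist \<A> g) p s"

abbreviation riemannian_complete ::
    "('m::topological_space, 'e::euclidean_space) chart set \<Rightarrow> ('m, 'e) metric \<Rightarrow> bool" where
  "riemannian_complete \<A> g \<equiv> Metric_space.mcomplete UNIV (riemannian_dist \<A> g)"

section \<open>Sobolev curves\<close>

definition L2_on :: "real \<Rightarrow> real \<Rightarrow> (real \<Rightarrow> 'e::euclidean_space) \<Rightarrow> bool" where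
  "L2_on s t f \<longleftrightarrow> set_borel_measurable lebesgue {s..t} f \<and>
     set_integrable lebesgue {s..t} (\<lambda>u. (norm (f u))\<^sup>2)"

text \<open>\<open>f'\<close> is the weak derivative of \<open>f\<close> on \<open>(s,t)\<close>, with \<open>C\<^sup>1\<close> test functions of compact support.\<close>

definition weak_derivative_on ::
    "real \<Rightarrow> real \<Rightarrow> (real \<Rightarrow> 'e::euclidean_space) \<Rightarrow> (real \<Rightarrow> 'e) \<Rightarrow> bool" where
  "weak_derivative_on s t f f' \<longleftrightarrow>
     (\<forall>\<phi> :: real \<Rightarrow> real. \<forall>K. \<phi> C1_differentiable_on UNIV \<and> compact K \<and> K \<subseteq> {s<..<t} \<and>
        (\<forall>u. u \<notin> K \<longrightarrow> \<phi> u = 0) \<longrightarrow>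
        (LINT u:{s..t}|lebesgue. deriv \<phi> u *\<^sub>R f u) = - (LINT u:{s..t}|lebesgue. \<phi> u *\<^sub>R f' u))"

definition H2_on :: "real \<Rightarrow> real \<Rightarrow> (real \<Rightarrow> 'e::euclidean_space) \<Rightarrow> bool" where
  "H2_on s t f \<longleftrightarrow> L2_on s t f \<and>
     (\<exists>f' f''. L2_on s t f' \<and> weak_derivative_on s t f f' \<and>
               L2_on s t f'' \<and> weak_derivative_on s t f' f'')"

text \<open>Continuity is part of the notion of an \<open>H\<^sup>2\<close> curve (it makes its local expressions
  available); such a curve is then automatically continuously differentiable.\<close>

definition H2_curve ::
    "('m::topological_space, 'e::euclidean_space) chart set \<Rightarrow> real \<Rightarrow> (real \<Rightarrow> 'm) \<Rightarrow> bool" where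
  "H2_curve \<A> T q \<longleftrightarrow> continuous_on {0..T} q \<and>
     (\<forall>c\<in>\<A>. \<forall>s t. 0 \<le> s \<and> s < t \<and> t \<le> T \<and> q ` {s..t} \<subseteq> chart_dom c \<longrightarrow>
        H2_on s t (chart_map c \<circ> q))"

text \<open>\<open>Y\<close> is the covariant derivative \<open>D/dt X\<close> of the vector field \<open>X\<close> along \<open>q : [0,T] \<rightarrow> Q\<close>: in local
  coordinates \<open>Y = X' + \<Gamma>(q)(q', X)\<close>, where \<open>X'\<close> is the \<open>L\<^sup>2\<close> weak derivative. This determines \<open>Y\<close>
  up to null sets.\<close>

definition has_covariant_derivative ::
    "('m, 'e::euclidean_space) chart set \<Rightarrow> ('m, 'e) metric \<Rightarrow> real \<Rightarrow> (real \<Rightarrow> 'm) \<Rightarrow>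
     (real \<Rightarrow> ('m, 'e) tangent) \<Rightarrow> (real \<Rightarrow> ('m, 'e) tangent) \<Rightarrow> bool" where
  "has_covariant_derivative \<A> g T q X Y \<longleftrightarrow>
     (\<forall>t\<in>{0..T}. Y t \<in> tangent_space \<A> (q t)) \<and>
     (\<forall>c\<in>\<A>. \<forall>s t. 0 \<le> s \<and> s < t \<and> t \<le> T \<and> q ` {s..t} \<subseteq> chart_dom c \<longrightarrow>
        L2_on s t (\<lambda>u. Y u c) \<and>
        weak_derivative_on s t (\<lambda>u. X u c)
          (\<lambda>u. Y u c - christoffel \<A> g c (chart_map c (q u)) (velocity \<A> T q u c) (X u c)))"

text \<open>\<open>D\<^sup>2q/dt\<^sup>2\<close>, in an arbitrary representative of its almost-everywhere class.\<close>

definition covariant_acceleration ::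
    "('m, 'e::euclidean_space) chart set \<Rightarrow> ('m, 'e) metric \<Rightarrow> real \<Rightarrow> (real \<Rightarrow> 'm) \<Rightarrow> real \<Rightarrow> ('m, 'e) tangent" where
  "covariant_acceleration \<A> g T q = (SOME Y. has_covariant_derivative \<A> g T q (velocity \<A> T q) Y)"

section \<open>The variational obstacle avoidance problem\<close>

definition admissible_curves ::
    "('m::topological_space, 'e::euclidean_space) chart set \<Rightarrow> real \<Rightarrow> 'm \<Rightarrow> ('m, 'e) tangent \<Rightarrow>
     'm \<Rightarrow> ('m, 'e) tangent \<Rightarrow> (real \<Rightarrow> 'm) set" where
  "admissible_curves \<A> T q\<^sub>0 v\<^sub>0 q\<^sub>T v\<^sub>T =
     {q. H2_curve \<A> T q \<and> q 0 = q\<^sub>0 \<and> q T = q\<^sub>T \<and> velocity \<A> T q 0 = v\<^sub>0 \<and> velocity \<A> T q T = v\<^sub>T}"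

definition action ::
    "('m, 'e::euclidean_space) chart set \<Rightarrow> ('m, 'e) metric \<Rightarrow> real \<Rightarrow> ('m \<Rightarrow> real) \<Rightarrow> (real \<Rightarrow> 'm) \<Rightarrow> real" where
  "action \<A> g T V q = 1 / 2 * (LINT t:{0..T}|lebesgue.
     (metric_norm g (q t) (covariant_acceleration \<A> g T q t))\<^sup>2 + V (q t))"

definition is_minimizer :: "('a \<Rightarrow> real) \<Rightarrow> 'a set \<Rightarrow> 'a \<Rightarrow> bool" where
  "is_minimizer J \<Omega> q \<longleftrightarrow> q \<in> \<Omega> \<and> (\<forall>q'\<in>\<Omega>. J q \<le> J q')"

definition avoids_obstacle ::
    "('m::topological_space, 'e::euclidean_space) chart set \<Rightarrow> ('m, 'e) metric \<Rightarrow> real \<Rightarrow> 'm \<Rightarrow> real \<Rightarrow>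
     (real \<Rightarrow> 'm) \<Rightarrow> bool" where
  "avoids_obstacle \<A> g T p s q \<longleftrightarrow> (\<forall>t\<in>{0..T}. q t \<notin> riemannian_ball \<A> g p s)"

definition avoidance_potential :: "('m \<Rightarrow> 'm \<Rightarrow> real) \<Rightarrow> 'm \<Rightarrow> real \<Rightarrow> real \<Rightarrow> nat \<Rightarrow> 'm \<Rightarrow> real" where
  "avoidance_potential d p R \<tau> k q =
     (if d p q < R then exp 1 * \<tau> * exp (- (1 / (1 - (d p q / R) ^ (2 * k)))) else 0)"

end

theory Submission
  imports Defs
begin

text \<open>The potential costs too much. Let \<open>E\<close> be the integral of
  \<open>\<parallel>D\<^sup>2q/dt\<^sup>2\<parallel>\<^sup>2\<close> along a feasible curve; the potential
  vanishes on it, so \<open>E / 2\<close> is its action for all \<open>\<tau>\<close> and \<open>k\<close>.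
  Both terms of the action are nonnegative, hence along a minimizer the squared acceleration and the potential
  have integral at most \<open>E\<close>. The first bound limits the speed: since
  \<open>(\<parallel>q'\<parallel>\<^sup>2)' = 2 \<langle>D\<^sup>2q/dt\<^sup>2, q'\<rangle>\<close>, the
  speed is at most a constant \<open>M\<close> that depends on \<open>T\<close>, the initial velocity and
  \<open>E\<close> only (\<open>speed_bound\<close>), so that \<open>t \<mapsto> d(p, q(t))\<close> is
  \<open>M\<close>-Lipschitz (\<open>curve_Lipschitz\<close>). If the minimizer entered the ball of radius
  \<open>r\<close>, it would therefore stay for a time \<open>l\<close>, independent of \<open>\<tau>\<close>
  and \<open>k\<close>, in the concentric ball of radius \<open>\<rho> = (r + R) / 2\<close>. There the
  potential is at least \<open>b \<tau>\<close> with \<open>b > 0\<close> independent of \<open>k\<close>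
  (\<open>avoidance_potential_ge\<close>), so its integral is at least \<open>l b \<tau>\<close>, which
  exceeds \<open>E\<close> for large \<open>\<tau>\<close>.

  The work lies in justifying the calculus along curves of class \<open>H\<^sup>2\<close>.

  Weak derivatives are turned into integral identities: a continuous function has the integrable weak derivative
  \<open>f\<close> iff its increments are the integrals of \<open>f\<close>
  (\<open>weak_derivative_imp_primitive_on\<close>, the lemma of du Bois-Reymond). For such primitives the
  product rule holds (\<open>primitive_on_scaleR\<close>), and this is the main tool for differentiating along
  the curve.

  The covariant acceleration is a choice, so it has to be shown that there is something to choose
  (\<open>acceleration_exists\<close>): locally \<open>x'' + \<Gamma>(x', x')\<close> in one chart defines it,
  and the transformation law of the Christoffel symbols (\<open>christoffel_change\<close>) shows that it has
  the right components in every other chart.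

  Balls are those of a metric space, so the Riemannian distance has to be a metric
  (\<open>riemannian_dist_Metric_space\<close>). Connectedness makes the distance finite; it separates points
  because a curve that leaves a small coordinate ball has a length bounded below
  (\<open>curve_length_ge_leaving_ball\<close>).

  All passages from local to global on the time interval use the bisection principle \<open>Bolzano\<close>: a
  property of intervals that is additive and holds on all short intervals around each point holds on the whole
  interval.\<close>

section \<open>Primitives of integrable functions\<close>

text \<open>Absolute continuity in integrated form: \<open>F\<close> is a primitive of the integrable function
  \<open>f\<close>. Working with increments rather than with almost everywhere derivatives avoids the
  differentiation theorem of Lebesgue.\<close>

definition primitive_on :: "real \<Rightarrow> real \<Rightarrow> (real \<Rightarrow> 'e::euclidean_space) \<Rightarrow> (real \<Rightarrow> 'e) \<Rightarrow> bool" where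
  "primitive_on a b F f \<longleftrightarrow> f absolutely_integrable_on {a..b} \<and>
     (\<forall>u v. a \<le> u \<longrightarrow> u \<le> v \<longrightarrow> v \<le> b \<longrightarrow> (f has_integral (F v - F u)) {u..v})"

lemma primitive_onI:
  assumes "f absolutely_integrable_on {a..b}"
    and "\<And>u v. a \<le> u \<Longrightarrow> u \<le> v \<Longrightarrow> v \<le> b \<Longrightarrow> (f has_integral (F v - F u)) {u..v}"
  shows "primitive_on a b F f"
  using assms by (auto simp: primitive_on_def)

lemma primitive_onD:
  assumes "primitive_on a b F f" "a \<le> u" "u \<le> v" "v \<le> b"
  shows "f absolutely_integrable_on {u..v}" "(f has_integral (F v - F u)) {u..v}"
    "f integrable_on {u..v}" "integral {u..v} f = F v - F u"
proof -
  show 1: "(f has_integral (F v - F u)) {u..v}"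
    using assms by (auto simp: primitive_on_def)
  show "f absolutely_integrable_on {u..v}"
    using assms absolutely_integrable_on_subinterval[where f=f and S="{a..b}" and a=u and b=v]
    by (auto simp: primitive_on_def)
  show "f integrable_on {u..v}" "integral {u..v} f = F v - F u"
    using 1 by auto
qed

lemma primitive_on_subinterval:
  "primitive_on a b F f \<Longrightarrow> a \<le> u \<Longrightarrow> v \<le> b \<Longrightarrow> primitive_on u v F f"
  by (auto simp: primitive_on_def intro: absolutely_integrable_on_subinterval)

lemma primitive_on_cong:
  assumes "primitive_on a b F f" "\<And>t. t \<in> {a..b} \<Longrightarrow> F t = G t" "\<And>t. t \<in> {a..b} \<Longrightarrow> f t = g t"
  shows "primitive_on a b G g"
proof (rule primitive_onI)
  show "g absolutely_integrable_on {a..b}"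
    using absolutely_integrable_spike[where f=f and T="{a..b}" and S="{}" and g=g] assms
    by (auto simp: primitive_on_def)
  fix u v assume "a \<le> u" "u \<le> v" "v \<le> b"
  then show "(g has_integral (G v - G u)) {u..v}"
    using primitive_onD(2)[OF assms(1), of u v] has_integral_cong[of "{u..v}" f g] assms(2,3) by auto
qed

lemma primitive_on_continuous:
  assumes "primitive_on a b F f"
  shows "continuous_on {a..b} F"
proof (cases "a \<le> b")
  case True
  have "continuous_on {a..b} (\<lambda>v. F a + integral {a..v} f)"
    using primitive_onD(3)[OF assms, of a b] True
    by (intro continuous_intros indefinite_integral_continuous_1) auto
  then show ?thesis
    by (rule continuous_on_eq) (use primitive_onD(4)[OF assms, of a] in auto)
qed simp

lemma primitive_on_join:
  assumes ab: "primitive_on a b F f" and bc: "primitive_on b c F f" and le: "a \<le> b" "b \<le> c"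
  shows "primitive_on a c F f"
proof (rule primitive_onI)
  have "f absolutely_integrable_on {a..b} \<union> {b..c}"
    using ab bc by (intro absolutely_integrable_Un) (auto simp: primitive_on_def)
  moreover have "{a..b} \<union> {b..c} = {a..c}"
    using le by auto
  ultimately show "f absolutely_integrable_on {a..c}"
    by simp
  fix u v assume uv: "a \<le> u" "u \<le> v" "v \<le> c"
  consider "v \<le> b" | "b \<le> u" | "u \<le> b" "b \<le> v"
    by linarith
  then show "(f has_integral (F v - F u)) {u..v}"
  proof cases
    case 3
    have "(f has_integral ((F b - F u) + (F v - F b))) {u..v}"
      using 3 uv primitive_onD(2)[OF ab, of u b] primitive_onD(2)[OF bc, of b v]
      by (intro has_integral_combine[of u b v]) auto
    then show ?thesis by simp
  qed (use uv primitive_onD(2)[OF ab, of u v] primitive_onD(2)[OF bc, of u v] in auto)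
qed

text \<open>Pieces of an acceleration are glued at a common end point, where their values may disagree.\<close>

lemma primitive_on_spike:
  assumes F: "primitive_on a b F f" and fg: "\<And>t. t \<noteq> z \<Longrightarrow> g t = f t"
  shows "primitive_on a b F g"
proof (rule primitive_onI)
  have "f absolutely_integrable_on {a..b}" using F unfolding primitive_on_def by (rule conjunct1)
  then show "g absolutely_integrable_on {a..b}"
    by (rule absolutely_integrable_spike[where S = "{z}"]) (use fg in auto)
  fix u v assume uv: "a \<le> u" "u \<le> v" "v \<le> b"
  show "(g has_integral (F v - F u)) {u..v}"
    by (rule has_integral_spike_finite[OF _ _ primitive_onD(2)[OF F uv], of "{z}"]) (use fg in auto)
qed

lemma primitive_on_C1:
  assumes "\<And>t. t \<in> {a..b} \<Longrightarrow> (F has_vector_derivative f t) (at t within {a..b})"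
    and "continuous_on {a..b} f"
  shows "primitive_on a b F f"
proof (rule primitive_onI)
  show "f absolutely_integrable_on {a..b}"
    using assms(2) by (rule absolutely_integrable_continuous_real)
  fix u v assume uv: "a \<le> u" "u \<le> v" "v \<le> b"
  show "(f has_integral (F v - F u)) {u..v}"
    using uv by (intro fundamental_theorem_of_calculus has_vector_derivative_within_subset[OF assms(1)]) auto
qed

lemma primitive_on_derivative:
  assumes "primitive_on a b F f" "continuous_on {a..b} f" "t \<in> {a..b}"
  shows "(F has_vector_derivative f t) (at t within {a..b})"
proof -
  have "((\<lambda>v. F a + integral {a..v} f) has_vector_derivative 0 + f t) (at t within {a..b})"
    using assms by (intro has_vector_derivative_add integral_has_vector_derivative) auto
  then have "((\<lambda>v. F a + integral {a..v} f) has_vector_derivative f t) (at t within {a..b})"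
    by simp
  then show ?thesis
    using primitive_onD(4)[OF assms(1), of a] assms(3)
    by (elim has_vector_derivative_transform[rotated 2]) auto
qed

lemma primitive_on_add:
  assumes "primitive_on a b F f" "primitive_on a b G g"
  shows "primitive_on a b (\<lambda>t. F t + G t) (\<lambda>t. f t + g t)"
proof (rule primitive_onI)
  show "(\<lambda>t. f t + g t) absolutely_integrable_on {a..b}"
    using assms by (auto simp: primitive_on_def intro: set_integral_add)
  fix u v assume "a \<le> u" "u \<le> v" "v \<le> b"
  then show "((\<lambda>t. f t + g t) has_integral (F v + G v - (F u + G u))) {u..v}"
    using has_integral_add[OF primitive_onD(2)[OF assms(1)] primitive_onD(2)[OF assms(2)], of u v]
    by (simp add: algebra_simps)
qed

lemma primitive_on_linear:
  assumes "primitive_on a b F f" "bounded_linear h"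
  shows "primitive_on a b (\<lambda>t. h (F t)) (\<lambda>t. h (f t))"
proof (rule primitive_onI)
  show "(\<lambda>t. h (f t)) absolutely_integrable_on {a..b}"
    using absolutely_integrable_linear[OF _ assms(2)] assms(1)
    unfolding primitive_on_def o_def by blast
  fix u v assume "a \<le> u" "u \<le> v" "v \<le> b"
  then show "((\<lambda>t. h (f t)) has_integral (h (F v) - h (F u))) {u..v}"
    using has_integral_linear[OF primitive_onD(2)[OF assms(1), of u v] assms(2)]
    by (simp add: o_def linear_diff[OF bounded_linear.linear[OF assms(2)]])
qed

lemma primitive_on_const: "primitive_on a b (\<lambda>t. C) (\<lambda>t. 0)"
  by (rule primitive_on_C1) auto

lemma primitive_on_sum:
  assumes "finite I" "\<And>i. i \<in> I \<Longrightarrow> primitive_on a b (F i) (f i)"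
  shows "primitive_on a b (\<lambda>t. \<Sum>i\<in>I. F i t) (\<lambda>t. \<Sum>i\<in>I. f i t)"
  using assms by (induction I rule: finite_induct) (auto intro: primitive_on_add primitive_on_const)

lemma absolutely_integrable_continuous_scaleR:
  fixes f :: "real \<Rightarrow> 'e::euclidean_space"
  assumes "continuous_on {a..b} \<phi>" "f absolutely_integrable_on {a..b}"
  shows "(\<lambda>t. \<phi> t *\<^sub>R f t) absolutely_integrable_on {a..b}"
proof (rule absolutely_integrable_bounded_measurable_product[of "(*\<^sub>R)"])
  show "bilinear ((*\<^sub>R) :: real \<Rightarrow> 'e \<Rightarrow> 'e)"
    using bilinear_conv_bounded_bilinear bounded_bilinear_scaleR by blast
  show "\<phi> \<in> borel_measurable (lebesgue_on {a..b})"
    by (rule continuous_imp_measurable_on_sets_lebesgue) (use assms in auto)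
  show "bounded (\<phi> ` {a..b})"
    using assms(1) by (intro compact_imp_bounded compact_continuous_image) auto
qed (use assms in auto)

lemma absolutely_integrable_scaleR_continuous:
  fixes G :: "real \<Rightarrow> 'e::euclidean_space"
  assumes "continuous_on {a..b} G" "\<phi> absolutely_integrable_on {a..b}"
  shows "(\<lambda>t. \<phi> t *\<^sub>R G t) absolutely_integrable_on {a..b}"
proof (rule absolutely_integrable_bounded_measurable_product[of "\<lambda>x c. c *\<^sub>R x"])
  have "bounded_bilinear (\<lambda>(x::'e) c. c *\<^sub>R x)"
    using bounded_bilinear.flip[OF bounded_bilinear_scaleR] .
  then show "bilinear (\<lambda>(x::'e) c. c *\<^sub>R x)"
    using bilinear_conv_bounded_bilinear by blast
  show "G \<in> borel_measurable (lebesgue_on {a..b})"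
    by (rule continuous_imp_measurable_on_sets_lebesgue) (use assms in auto)
  show "bounded (G ` {a..b})"
    using assms(1) by (intro compact_imp_bounded compact_continuous_image) auto
qed (use assms in auto)

text \<open>The product rule. The defect \<open>D u v\<close> of the asserted identity on \<open>[u,v]\<close> is additive
  in the interval. On a short interval it is the integral of \<open>f (G v - G) + (F u - F) g\<close>, and
  continuity of the primitives makes this at most \<open>e\<close> times the integral of \<open>\<bar>f\<bar>
  + \<parallel>g\<parallel>\<close>. Hence this estimate holds on every interval, for every \<open>e\<close>.\<close>

lemma primitive_on_scaleR:
  fixes F :: "real \<Rightarrow> real" and G :: "real \<Rightarrow> 'e::euclidean_space"
  assumes F: "primitive_on a b F f" and G: "primitive_on a b G g"
  shows "primitive_on a b (\<lambda>t. F t *\<^sub>R G t) (\<lambda>t. f t *\<^sub>R G t + F t *\<^sub>R g t)"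
proof (rule primitive_onI)
  let ?p = "\<lambda>t. f t *\<^sub>R G t + F t *\<^sub>R g t" and ?m = "\<lambda>t. \<bar>f t\<bar> + norm (g t)"
  have contF: "continuous_on {a..b} F" and contG: "continuous_on {a..b} G"
    using F G by (auto intro: primitive_on_continuous)
  have fi: "f absolutely_integrable_on {a..b}" and gi: "g absolutely_integrable_on {a..b}"
    using F G by (auto simp: primitive_on_def)
  show pi: "?p absolutely_integrable_on {a..b}"
    using absolutely_integrable_scaleR_continuous[OF contG fi]
      absolutely_integrable_continuous_scaleR[OF contF gi]
    by (rule set_integral_add)
  have mi: "?m absolutely_integrable_on {a..b}"
    using absolutely_integrable_norm[OF fi] absolutely_integrable_norm[OF gi]
    by (intro set_integral_add) (auto simp: o_def)
  fix u0 v0 assume uv0: "a \<le> u0" "u0 \<le> v0" "v0 \<le> b"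
  have int: "?p integrable_on {u..v}" "?m integrable_on {u..v}" if "u0 \<le> u" "v \<le> v0" for u v
    using that uv0
    by (auto intro!: set_lebesgue_integral_eq_integral(1) absolutely_integrable_on_subinterval[OF pi]
        absolutely_integrable_on_subinterval[OF mi])
  define D where "D u v = F v *\<^sub>R G v - F u *\<^sub>R G u - integral {u..v} ?p" for u v
  have small: "norm (D u0 v0) \<le> e * integral {u0..v0} ?m" if e: "e > 0" for e
  proof -
    define P where "P u v \<longleftrightarrow> u0 \<le> u \<longrightarrow> u \<le> v \<longrightarrow> v \<le> v0 \<longrightarrow> norm (D u v) \<le> e * integral {u..v} ?m" for u v
    have "P u0 v0"
    proof (rule Bolzano[where P = P])
      show "u0 \<le> v0" by fact
    next
      fix x y z assume P: "P x y" "P y z" "x \<le> y" "y \<le> z"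
      show "P x z"
        unfolding P_def
      proof (intro impI)
        assume le: "u0 \<le> x" "x \<le> z" "z \<le> v0"
        have "integral {x..y} ?p + integral {y..z} ?p = integral {x..z} ?p"
          "integral {x..y} ?m + integral {y..z} ?m = integral {x..z} ?m"
          by (intro Henstock_Kurzweil_Integration.integral_combine int P le)+
        then have eq: "D x z = D x y + D y z" "e * integral {x..z} ?m = e * integral {x..y} ?m + e * integral {y..z} ?m"
          by (auto simp: D_def algebra_simps simp flip: distrib_left)
        show "norm (D x z) \<le> e * integral {x..z} ?m"
          using P le unfolding eq P_def by (intro order_trans[OF norm_triangle_ineq] add_mono) auto
      qed
    next
      fix x assume x: "u0 \<le> x" "x \<le> v0"
      \<comment> \<open>Clamping the argument extends the primitives continuously beyond the ends of the interval.\<close>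
    have "isCont (\<lambda>t. F (clamp u0 v0 t)) x" "isCont (\<lambda>t. G (clamp u0 v0 t)) x"
        using clamp_continuous_on[of u0 v0 F UNIV] clamp_continuous_on[of u0 v0 G UNIV] contF contG uv0
          continuous_on_subset[of "{a..b}" _ "{u0..v0}"]
        by (auto simp: continuous_on_eq_continuous_at)
      then obtain d1 d2 where d: "d1 > 0" "d2 > 0"
        "\<And>t. \<bar>t - x\<bar> < d1 \<Longrightarrow> \<bar>F (clamp u0 v0 t) - F (clamp u0 v0 x)\<bar> < e/2"
        "\<And>t. \<bar>t - x\<bar> < d2 \<Longrightarrow> norm (G (clamp u0 v0 t) - G (clamp u0 v0 x)) < e/2"
        using e unfolding continuous_at_eps_delta by (metis half_gt_zero dist_norm dist_real_def)
      have clampid: "clamp u0 v0 t = t" if "t \<in> {u0..v0}" for t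
        using that clamp_cancel_cbox[of t u0 v0] by auto
      have "P u v" if uv: "u \<le> x" "x \<le> v" "v - u < min d1 d2" for u v
        unfolding P_def
      proof (intro impI)
        assume le: "u0 \<le> u" "u \<le> v" "v \<le> v0"
        have F': "\<bar>F s - F t\<bar> \<le> e" if "s \<in> {u..v}" "t \<in> {u..v}" for s t
        proof -
          have "\<bar>F s - F x\<bar> < e/2" "\<bar>F t - F x\<bar> < e/2"
            using d(3)[of s] d(3)[of t] that uv le x by (auto simp: clampid)
          then show ?thesis by linarith
        qed
        have G': "norm (G s - G t) \<le> e" if "s \<in> {u..v}" "t \<in> {u..v}" for s t
        proof -
          have "norm (G s - G x) < e/2" "norm (G t - G x) < e/2"
            using d(4)[of s] d(4)[of t] that uv le x by (auto simp: clampid)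
          moreover have "norm (G s - G t) \<le> norm (G s - G x) + norm (G t - G x)"
            using norm_triangle_ineq4[of "G s - G x" "G t - G x"] by simp
          ultimately show ?thesis by linarith
        qed
        let ?r = "\<lambda>t. f t *\<^sub>R (G v - G t) + (F u - F t) *\<^sub>R g t"
        have "((\<lambda>t. f t *\<^sub>R G v + F u *\<^sub>R g t - ?p t) has_integral
            ((F v - F u) *\<^sub>R G v + F u *\<^sub>R (G v - G u) - integral {u..v} ?p)) {u..v}"
        proof -
          have fu: "(f has_integral (F v - F u)) {u..v}" "(g has_integral (G v - G u)) {u..v}"
            using uv0 le primitive_onD(2)[OF F, of u v] primitive_onD(2)[OF G, of u v] by auto
          show ?thesis
            using has_integral_diff[OF has_integral_add[OF has_integral_scaleR_left[OF fu(1), of "G v"]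
                has_integral_cmul[OF fu(2), of "F u"]] integrable_integral[OF int(1)]] le by simp
        qed
        then have r: "(?r has_integral D u v) {u..v}"
          by (simp add: D_def algebra_simps)
        have "norm (integral {u..v} ?r) \<le> integral {u..v} (\<lambda>t. e * ?m t)"
        proof (rule integral_norm_bound_integral)
          show "?r integrable_on {u..v}" using r by auto
          show "(\<lambda>t. e * ?m t) integrable_on {u..v}"
            using integrable_cmul[OF int(2)[of u v], of e] le by simp
          fix t assume t: "t \<in> {u..v}"
          have "norm (?r t) \<le> \<bar>f t\<bar> * norm (G v - G t) + \<bar>F u - F t\<bar> * norm (g t)"
            by (rule order_trans[OF norm_triangle_ineq]) simp
          also have "\<dots> \<le> \<bar>f t\<bar> * e + e * norm (g t)"
            using F'[of u t] G'[of v t] t le by (intro add_mono mult_left_mono mult_right_mono) auto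
          finally show "norm (?r t) \<le> e * ?m t" by (simp add: algebra_simps)
        qed
        then show "norm (D u v) \<le> e * integral {u..v} ?m"
          using r by (simp add: integral_unique)
      qed
      then show "\<exists>d>0. \<forall>u v. u \<le> x \<and> x \<le> v \<and> v - u < d \<longrightarrow> P u v"
        using d(1,2) by (intro exI[of _ "min d1 d2"]) auto
    qed
    then show ?thesis
      using uv0 by (auto simp: P_def)
  qed
  have "norm (D u0 v0) \<le> 0"
  proof (rule field_le_epsilon)
    fix e :: real assume e: "e > 0"
    let ?I = "integral {u0..v0} ?m"
    have I: "?I \<ge> 0" using int(2) by (intro integral_nonneg) auto
    have "norm (D u0 v0) \<le> e / (?I + 1) * ?I"
      using small[of "e / (?I + 1)"] e I by simp
    also have "\<dots> \<le> e"
      using e I by (simp add: field_simps)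
    finally show "norm (D u0 v0) \<le> 0 + e" by simp
  qed
  then have "integral {u0..v0} ?p = F v0 *\<^sub>R G v0 - F u0 *\<^sub>R G u0"
    by (simp add: D_def)
  then show "(?p has_integral (F v0 *\<^sub>R G v0 - F u0 *\<^sub>R G u0)) {u0..v0}"
    using integrable_integral[OF int(1)[of u0 v0]] by simp
qed

text \<open>Integration by parts: the product of \<open>F\<close> with a test function is a primitive that vanishes at
  both ends.\<close>

lemma primitive_on_imp_weak_derivative:
  fixes F :: "real \<Rightarrow> 'e::euclidean_space"
  assumes F: "primitive_on s t F f" and st: "s < t"
  shows "weak_derivative_on s t F f"
  unfolding weak_derivative_on_def
proof (intro allI impI, elim conjE)
  fix \<phi> :: "real \<Rightarrow> real" and K
  assume C1: "\<phi> C1_differentiable_on UNIV" and K: "K \<subseteq> {s<..<t}" and zero: "\<forall>u. u \<notin> K \<longrightarrow> \<phi> u = 0"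
  obtain D where D: "\<And>x. (\<phi> has_vector_derivative D x) (at x)" "continuous_on UNIV D"
    using C1 by (auto simp: C1_differentiable_on_def)
  have "deriv \<phi> = D"
    using D(1) by (auto intro!: DERIV_imp_deriv simp: has_real_derivative_iff_has_vector_derivative)
  then have cont: "continuous_on {s..t} (deriv \<phi>)"
    using continuous_on_subset[OF D(2)] by simp
  with D(1) \<open>deriv \<phi> = D\<close> have p: "primitive_on s t \<phi> (deriv \<phi>)"
    by (intro primitive_on_C1) (auto intro: has_vector_derivative_at_within)
  note cont = cont primitive_on_continuous[OF p]
  have prod: "primitive_on s t (\<lambda>u. \<phi> u *\<^sub>R F u) (\<lambda>u. deriv \<phi> u *\<^sub>R F u + \<phi> u *\<^sub>R f u)"
    by (rule primitive_on_scaleR[OF p F])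
  have ai: "(\<lambda>u. deriv \<phi> u *\<^sub>R F u) absolutely_integrable_on {s..t}"
    "(\<lambda>u. \<phi> u *\<^sub>R f u) absolutely_integrable_on {s..t}"
    using cont primitive_on_continuous[OF F] primitive_onD(1)[OF F, of s t] st
    by (auto intro: absolutely_integrable_continuous_scaleR absolutely_integrable_continuous_real
        continuous_on_scaleR)
  have "\<phi> s = 0" "\<phi> t = 0"
    using K zero by auto
  then have "integral {s..t} (\<lambda>u. deriv \<phi> u *\<^sub>R F u + \<phi> u *\<^sub>R f u) = 0"
    using primitive_onD(4)[OF prod, of s t] st by auto
  moreover have "integral {s..t} (\<lambda>u. deriv \<phi> u *\<^sub>R F u + \<phi> u *\<^sub>R f u) =
     integral {s..t} (\<lambda>u. deriv \<phi> u *\<^sub>R F u) + integral {s..t} (\<lambda>u. \<phi> u *\<^sub>R f u)"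
    using ai by (intro Henstock_Kurzweil_Integration.integral_add) (auto dest: set_lebesgue_integral_eq_integral(1))
  ultimately show "(LINT u:{s..t}|lebesgue. deriv \<phi> u *\<^sub>R F u) = - (LINT u:{s..t}|lebesgue. \<phi> u *\<^sub>R f u)"
    using ai by (simp add: set_lebesgue_integral_eq_integral(2) eq_neg_iff_add_eq_0)
qed

section \<open>Weak derivatives\<close>

text \<open>A continuous function \<open>\<theta>\<close> with compact support is the derivative of a test function as
  soon as its integral vanishes.\<close>

lemma weak_derivative_zero_test:
  fixes h :: "real \<Rightarrow> 'e::euclidean_space" and \<theta> :: "real \<Rightarrow> real"
  assumes h: "h absolutely_integrable_on {s..t}" and weak: "weak_derivative_on s t h (\<lambda>_. 0)"
    and cont: "continuous_on UNIV \<theta>" and ab: "s < a" "a < b" "b < t"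
    and supp: "\<And>u. u \<le> a \<or> b \<le> u \<Longrightarrow> \<theta> u = 0" and mean: "integral {s..t} \<theta> = 0"
  shows "integral {s..t} (\<lambda>u. \<theta> u *\<^sub>R h u) = 0"
proof -
  define \<phi> where "\<phi> u = integral {s..u} \<theta>" for u
  have cont': "continuous_on S \<theta>" for S
    using cont continuous_on_subset by blast
  have int: "\<theta> integrable_on {u..v}" for u v
    by (rule integrable_continuous_real) (rule cont')
  have low: "\<phi> u = 0" if "u \<le> a" for u
    unfolding \<phi>_def using that supp integral_cong[of "{s..u}" \<theta> "\<lambda>_. 0"] by auto
  have tail: "integral {b..u} \<theta> = 0" for u
    using supp integral_cong[of "{b..u}" \<theta> "\<lambda>_. 0"] by auto
  have comb: "\<phi> b + integral {b..u} \<theta> = \<phi> u" if "b \<le> u" for u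
    unfolding \<phi>_def using that ab int by (intro Henstock_Kurzweil_Integration.integral_combine) auto
  have high: "\<phi> u = 0" if "b \<le> u" for u
    using comb[OF that] comb[of t] tail[of u] tail[of t] mean ab by (auto simp: \<phi>_def)
  have der: "(\<phi> has_vector_derivative \<theta> u) (at u)" for u
  proof -
    consider "u < a" | "b < u" | "a \<le> u" "u \<le> b" by linarith
    then show ?thesis
    proof cases
      case 1
      then have "((\<lambda>_. 0) has_vector_derivative \<theta> u) (at u)"
        using supp[of u] by simp
      then show ?thesis
        by (rule has_vector_derivative_transform_within_open[where S = "{..<a}"]) (use 1 low in auto)
    next
      case 2
      then have "((\<lambda>_. 0) has_vector_derivative \<theta> u) (at u)"
        using supp[of u] by simp
      then show ?thesis
        by (rule has_vector_derivative_transform_within_open[where S = "{b<..}"]) (use 2 high in auto)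
    next
      case 3
      have "(\<phi> has_vector_derivative \<theta> u) (at u within {s..t})"
        unfolding \<phi>_def using 3 ab by (intro integral_has_vector_derivative cont') auto
      then show ?thesis
        using at_within_Icc_at[of s u t] 3 ab by auto
    qed
  qed
  have C1: "\<phi> C1_differentiable_on UNIV"
    unfolding C1_differentiable_on_def using der cont by blast
  have der_eq: "deriv \<phi> = \<theta>"
    using der by (auto intro!: DERIV_imp_deriv simp: has_real_derivative_iff_has_vector_derivative)
  have "{a..b} \<subseteq> {s<..<t}" using ab by auto
  have "(LINT u:{s..t}|lebesgue. deriv \<phi> u *\<^sub>R h u) = - (LINT u:{s..t}|lebesgue. \<phi> u *\<^sub>R (0::'e))"
    using weak[unfolded weak_derivative_on_def, rule_format, of \<phi> "{a..b}"] C1 low high \<open>{a..b} \<subseteq> {s<..<t}\<close>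
    by (auto simp: not_le)
  then show ?thesis
    using set_lebesgue_integral_eq_integral(2)[OF absolutely_integrable_continuous_scaleR[OF cont' h]]
    by (simp add: der_eq)
qed

text \<open>The lemma of du Bois-Reymond, in integrated form: the integral of \<open>h\<close> over an interval is a
  constant vector \<open>C\<close> times the length, that is, \<open>h = C\<close> almost everywhere.
  Subtracting a multiple of a fixed bump turns any continuous weight into one with integral \<open>0\<close>;
  hence \<open>h - C\<close> is orthogonal to all continuous weights with compact support, and trapezoidal
  ones converge to the indicator function of an interval.\<close>

lemma weak_derivative_zero_imp_integral_linear:
  fixes h :: "real \<Rightarrow> 'e::euclidean_space"
  assumes st: "s < t" and h: "h absolutely_integrable_on {s..t}"
    and weak: "weak_derivative_on s t h (\<lambda>_. 0)"
  obtains C where "\<And>u v. s \<le> u \<Longrightarrow> u \<le> v \<Longrightarrow> v \<le> t \<Longrightarrow> (h has_integral (v - u) *\<^sub>R C) {u..v}"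
proof -
  \<comment> \<open>A trapezoid supported in \<open>[a,b]\<close> that converges to the indicator function of \<open>(a,b)\<close>
    as \<open>n\<close> grows. The one for \<open>n = 1\<close> on the middle third of \<open>[s,t]\<close> is
    the fixed bump.\<close>
  define \<psi> :: "real \<Rightarrow> real \<Rightarrow> nat \<Rightarrow> real \<Rightarrow> real" where
    "\<psi> a b n x = min 1 (real n * max 0 (min (x - a) (b - x)))" for a b n x
  have cont: "continuous_on S (\<psi> a b n)" for S a b n
    unfolding \<psi>_def by (intro continuous_intros)
  have supp: "\<psi> a b n u = 0" if "u \<le> a \<or> b \<le> u" for a b n u
  proof -
    have "max 0 (min (u - a) (b - u)) = 0" using that by auto
    then show ?thesis by (simp add: \<psi>_def)
  qed
  have range: "0 \<le> \<psi> a b n u" "\<psi> a b n u \<le> 1" for a b n u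
    by (auto simp: \<psi>_def)
  define a0 b0 where "a0 = (2 * s + t) / 3" and "b0 = (s + 2 * t) / 3"
  have ab0: "s < a0" "a0 < b0" "b0 < t"
    using st by (auto simp: a0_def b0_def)
  define k where "k = integral {s..t} (\<psi> a0 b0 1)"
  have int: "\<psi> a b n integrable_on {u..v}" for a b n u v
    by (rule integrable_continuous_real) (rule cont)
  have "k \<ge> 0"
    unfolding k_def by (intro integral_nonneg int range)
  moreover have "k \<noteq> 0"
  proof
    assume "k = 0"
    then have "(\<psi> a0 b0 1 has_integral 0) (cbox s t)"
      using integrable_integral[OF int, of a0 b0 1 s t] by (simp add: k_def)
    then have "\<psi> a0 b0 1 ((a0 + b0)/2) = 0"
      using ab0 cont range by (intro has_integral_0_cbox_imp_0[of s t]) auto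
    then show False
      using ab0 by (auto simp: \<psi>_def min_def max_def split: if_splits)
  qed
  ultimately have k: "k > 0" by simp
  define C where "C = (1/k) *\<^sub>R integral {s..t} (\<lambda>u. \<psi> a0 b0 1 u *\<^sub>R h u)"
  have ai: "(\<lambda>u. \<psi> a b n u *\<^sub>R h u) absolutely_integrable_on {s..t}" for a b n
    by (intro absolutely_integrable_continuous_scaleR cont h)
  have aii: "(\<lambda>u. \<psi> a b n u *\<^sub>R h u) integrable_on {s..t}" for a b n
    using ai set_lebesgue_integral_eq_integral(1) by blast
  have key: "integral {s..t} (\<lambda>u. \<psi> a b n u *\<^sub>R (h u - C)) = 0" if ab: "s < a" "a < b" "b < t" for a b n
  proof -
    define \<kappa> where "\<kappa> = integral {s..t} (\<psi> a b n)"
    let ?\<theta> = "\<lambda>u. \<psi> a b n u - (\<kappa>/k) * \<psi> a0 b0 1 u"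
    have "integral {s..t} ?\<theta> = \<kappa> - (\<kappa>/k) * k"
      unfolding \<kappa>_def k_def
      using integral_unique[OF has_integral_diff[OF integrable_integral[OF int] has_integral_mult_right[OF integrable_integral[OF int]]]]
      by blast
    then have mean: "integral {s..t} ?\<theta> = 0" using k by simp
    have "integral {s..t} (\<lambda>u. ?\<theta> u *\<^sub>R h u) = 0"
    proof (rule weak_derivative_zero_test[OF h weak _ _ _ _ _ mean])
      show "continuous_on UNIV ?\<theta>" by (intro continuous_intros cont)
      show "s < min a a0" "min a a0 < max b b0" "max b b0 < t" using ab ab0 by auto
      show "?\<theta> u = 0" if "u \<le> min a a0 \<or> max b b0 \<le> u" for u
        using that by (auto simp: supp)
    qed
    moreover have "((\<lambda>u. \<psi> a b n u *\<^sub>R h u - (\<kappa>/k) *\<^sub>R (\<psi> a0 b0 1 u *\<^sub>R h u)) has_integral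
        (integral {s..t} (\<lambda>u. \<psi> a b n u *\<^sub>R h u) - (\<kappa>/k) *\<^sub>R integral {s..t} (\<lambda>u. \<psi> a0 b0 1 u *\<^sub>R h u))) {s..t}"
      by (intro has_integral_diff has_integral_cmul integrable_integral aii)
    ultimately have "integral {s..t} (\<lambda>u. \<psi> a b n u *\<^sub>R h u) = \<kappa> *\<^sub>R C"
      by (auto simp: C_def algebra_simps dest!: integral_unique)
    moreover have "((\<lambda>u. \<psi> a b n u *\<^sub>R h u - \<psi> a b n u *\<^sub>R C) has_integral
        (integral {s..t} (\<lambda>u. \<psi> a b n u *\<^sub>R h u) - \<kappa> *\<^sub>R C)) {s..t}"
      unfolding \<kappa>_def by (intro has_integral_diff has_integral_scaleR_left integrable_integral aii int)
    ultimately show ?thesis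
      by (auto simp: algebra_simps dest!: integral_unique)
  qed
  have hC: "(\<lambda>u. h u - C) absolutely_integrable_on {s..t}"
    using h absolutely_integrable_continuous_real[of s t "\<lambda>_. C"] by (intro set_integral_diff) auto
  have hCi: "(\<lambda>u. h u - C) integrable_on {s..t}"
    using hC set_lebesgue_integral_eq_integral(1) by blast
  define D where "D v = integral {s..v} (\<lambda>u. h u - C)" for v
  have Dc: "continuous_on {s..t} D"
    unfolding D_def by (rule indefinite_integral_continuous_1[OF hCi])
  have sub: "(\<lambda>u. h u - C) integrable_on {u..v}" if "s \<le> u" "v \<le> t" for u v
    using integrable_on_subinterval[OF hCi, of u v] that by auto
  have Dd: "integral {u..v} (\<lambda>u. h u - C) = D v - D u" if "s \<le> u" "u \<le> v" "v \<le> t" for u v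
    using Henstock_Kurzweil_Integration.integral_combine[of s u v "\<lambda>u. h u - C"] sub[of s v] that
    by (simp add: D_def algebra_simps)
  have inner: "D v = D u" if uv: "s < u" "u < v" "v < t" for u v
  proof -
    let ?g = "\<lambda>x. if x \<in> {u<..<v} then h x - C else 0"
    have lim: "(\<lambda>n. integral {s..t} (\<lambda>x. \<psi> u v n x *\<^sub>R (h x - C))) \<longlonglongrightarrow> integral {s..t} ?g"
    proof (rule dominated_convergence(2))
      show "(\<lambda>x. \<psi> u v n x *\<^sub>R (h x - C)) integrable_on {s..t}" for n
        using absolutely_integrable_continuous_scaleR[OF cont hC] set_lebesgue_integral_eq_integral(1) by blast
      show "(\<lambda>x. norm (h x - C)) integrable_on {s..t}"
        using absolutely_integrable_norm[OF hC] set_lebesgue_integral_eq_integral(1) by (auto simp: o_def)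
      show "norm (\<psi> u v n x *\<^sub>R (h x - C)) \<le> norm (h x - C)" for n x
        using range[of u v n x] by (simp add: mult_left_le_one_le)
      fix x assume "x \<in> {s..t}"
      show "(\<lambda>n. \<psi> u v n x *\<^sub>R (h x - C)) \<longlonglongrightarrow> ?g x"
      proof (cases "x \<in> {u<..<v}")
        case True
        then have "min (x - u) (v - x) > 0" by auto
        then obtain N :: nat where N: "1 < real N * min (x - u) (v - x)"
          using reals_Archimedean3 by blast
        have "\<psi> u v n x = 1" if "n \<ge> N" for n
        proof -
          have "1 < real n * min (x - u) (v - x)"
            using N \<open>min (x - u) (v - x) > 0\<close> that
            by (meson less_le_trans mult_right_mono of_nat_le_iff less_imp_le)
          then show ?thesis
            using \<open>min (x - u) (v - x) > 0\<close> by (simp add: \<psi>_def max_absorb2 min_absorb1)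
        qed
        then have "eventually (\<lambda>n. \<psi> u v n x *\<^sub>R (h x - C) = ?g x) sequentially"
          using True eventually_sequentiallyI[of N] by simp
        then show ?thesis by (rule tendsto_eventually)
      next
        case False
        then have "\<psi> u v n x *\<^sub>R (h x - C) = ?g x" for n
          using supp[of x u v n] by auto
        then show ?thesis by simp
      qed
    qed
    have "integral {s..t} ?g = 0"
      using LIMSEQ_unique[OF lim] key[OF uv] by simp
    moreover have "integral {s..t} ?g = integral {u<..<v} (\<lambda>x. h x - C)"
      using uv by (subst Henstock_Kurzweil_Integration.integral_restrict_Int) (auto intro: arg_cong2[where f=integral])
    ultimately show ?thesis
      using Dd[of u v] uv integral_open_interval_real[of u v "\<lambda>x. h x - C"] by auto
  qed
  have const: "D v = D ((s+t)/2)" if "v \<in> {s..t}" for v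
  proof (rule continuous_constant_on_closure[of "{s<..<t}" D])
    show "continuous_on (closure {s<..<t}) D"
      using Dc st by simp
    show "D x = D ((s+t)/2)" if "x \<in> {s<..<t}" for x
    proof -
      consider "x < (s+t)/2" | "x = (s+t)/2" | "(s+t)/2 < x" by linarith
      then show ?thesis
      proof cases
        case 1 then show ?thesis using inner[of x "(s+t)/2"] that st by simp
      next
        case 2 then show ?thesis by (rule arg_cong)
      next
        case 3 then show ?thesis using inner[of "(s+t)/2" x] that st by simp
      qed
    qed
  qed (use that st in simp)
  show ?thesis
  proof (rule that)
    fix u v assume uv: "s \<le> u" "u \<le> v" "v \<le> t"
    have "((\<lambda>x. h x - C) has_integral 0) {u..v}"
      using integrable_integral[OF sub[of u v]] Dd[OF uv] const[of u] const[of v] uv by auto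
    from has_integral_add[OF this has_integral_const_real[of C u v]]
    show "(h has_integral (v - u) *\<^sub>R C) {u..v}" using uv by simp
  qed
qed

lemma weak_derivative_diff_primitive:
  fixes F G :: "real \<Rightarrow> 'e::euclidean_space"
  assumes "s < t" and F: "F absolutely_integrable_on {s..t}" "weak_derivative_on s t F f"
    and G: "primitive_on s t G f"
  shows "weak_derivative_on s t (\<lambda>u. F u - G u) (\<lambda>_. 0)"
  unfolding weak_derivative_on_def
proof (intro allI impI, elim conjE)
  fix \<phi> :: "real \<Rightarrow> real" and K
  assume C1: "\<phi> C1_differentiable_on UNIV" and K: "compact K" "K \<subseteq> {s<..<t}" and zero: "\<forall>u. u \<notin> K \<longrightarrow> \<phi> u = 0"
  obtain D where D: "\<And>x. (\<phi> has_vector_derivative D x) (at x)" "continuous_on UNIV D"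
    using C1 by (auto simp: C1_differentiable_on_def)
  have "deriv \<phi> = D"
    using D(1) by (auto intro!: DERIV_imp_deriv simp: has_real_derivative_iff_has_vector_derivative)
  then have cont: "continuous_on {s..t} (deriv \<phi>)"
    using continuous_on_subset[OF D(2)] by simp
  have "G absolutely_integrable_on {s..t}"
    using G by (intro absolutely_integrable_continuous_real primitive_on_continuous)
  then have ai: "(\<lambda>u. deriv \<phi> u *\<^sub>R F u) absolutely_integrable_on {s..t}" "(\<lambda>u. deriv \<phi> u *\<^sub>R G u) absolutely_integrable_on {s..t}"
    using F(1) cont by (auto intro: absolutely_integrable_continuous_scaleR)
  have "(LINT u:{s..t}|lebesgue. deriv \<phi> u *\<^sub>R F u - deriv \<phi> u *\<^sub>R G u) =
    (LINT u:{s..t}|lebesgue. deriv \<phi> u *\<^sub>R F u) - (LINT u:{s..t}|lebesgue. deriv \<phi> u *\<^sub>R G u)"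
    by (rule set_integral_diff(2)[OF ai])
  then show "(LINT u:{s..t}|lebesgue. deriv \<phi> u *\<^sub>R (F u - G u)) = - (LINT u:{s..t}|lebesgue. \<phi> u *\<^sub>R 0)"
    using F(2)[unfolded weak_derivative_on_def, rule_format, of \<phi> K]
      primitive_on_imp_weak_derivative[OF G \<open>s < t\<close>, unfolded weak_derivative_on_def, rule_format, of \<phi> K]
      C1 K zero by (simp add: scaleR_diff_right)
qed

lemma primitive_on_integral:
  "f absolutely_integrable_on {s..t} \<Longrightarrow> primitive_on s t (\<lambda>u. integral {s..u} f) f"
proof (rule primitive_onI)
  assume f: "f absolutely_integrable_on {s..t}"
  fix u v assume uv: "s \<le> u" "u \<le> v" "v \<le> t"
  have "f integrable_on {s..v}" "f integrable_on {u..v}"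
    using uv by (auto intro!: set_lebesgue_integral_eq_integral(1) absolutely_integrable_on_subinterval[OF f])
  then have "integral {u..v} f = integral {s..v} f - integral {s..u} f" "(f has_integral integral {u..v} f) {u..v}"
    using Henstock_Kurzweil_Integration.integral_combine[of s u v f] integrable_integral[of f "{u..v}"] uv
    by (auto simp: algebra_simps)
  then show "(f has_integral (integral {s..v} f - integral {s..u} f)) {u..v}"
    by simp
qed

text \<open>The difference of \<open>F\<close> and a primitive of \<open>f\<close> has weak derivative \<open>0\<close>;
  being continuous, it is constant.\<close>

lemma weak_derivative_imp_primitive_on:
  fixes F :: "real \<Rightarrow> 'e::euclidean_space"
  assumes "s < t" and F: "continuous_on {s..t} F" "weak_derivative_on s t F f"
    and f: "f absolutely_integrable_on {s..t}"
  shows "primitive_on s t F f"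
proof -
  define G where "G u = integral {s..u} f" for u
  have G: "primitive_on s t G f"
    unfolding G_def by (rule primitive_on_integral[OF f])
  have Fi: "F absolutely_integrable_on {s..t}"
    using F(1) by (rule absolutely_integrable_continuous_real)
  let ?h = "\<lambda>u. F u - G u"
  have hc: "continuous_on {s..t} ?h"
    using F(1) primitive_on_continuous[OF G] by (rule continuous_on_diff)
  obtain C where C: "\<And>u v. s \<le> u \<Longrightarrow> u \<le> v \<Longrightarrow> v \<le> t \<Longrightarrow> (?h has_integral (v - u) *\<^sub>R C) {u..v}"
    using weak_derivative_zero_imp_integral_linear[OF \<open>s < t\<close> absolutely_integrable_continuous_real[OF hc]
        weak_derivative_diff_primitive[OF \<open>s < t\<close> Fi F(2) G]] by blast
  have h: "?h u = C" if u: "u \<in> {s..t}" for u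
  proof -
    have "((\<lambda>v. integral {s..v} ?h) has_vector_derivative ?h u) (at u within {s..t})"
      using hc u by (rule integral_has_vector_derivative)
    moreover have "((\<lambda>v. integral {s..v} ?h) has_vector_derivative C) (at u within {s..t})"
    proof (rule has_vector_derivative_transform[OF u])
      show "integral {s..v} ?h = (v - s) *\<^sub>R C" if "v \<in> {s..t}" for v
        using integral_unique[OF C[of s v]] that by auto
      show "((\<lambda>v. (v - s) *\<^sub>R C) has_vector_derivative C) (at u within {s..t})"
        by (auto intro!: derivative_eq_intros)
    qed
    ultimately show ?thesis
      using vector_derivative_unique_within_closed_interval[of s t u] \<open>s < t\<close> u by auto
  qed
  have "primitive_on s t (\<lambda>u. G u + C) (\<lambda>u. f u + 0)"
    by (rule primitive_on_add[OF G primitive_on_const])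
  then show ?thesis
    by (rule primitive_on_cong) (use h in \<open>auto simp: algebra_simps\<close>)
qed

section \<open>Square integrable functions on an interval\<close>

lemma L2_on_iff:
  "L2_on s t f \<longleftrightarrow> f \<in> borel_measurable (lebesgue_on {s..t}) \<and> integrable (lebesgue_on {s..t}) (\<lambda>u. (norm (f u))\<^sup>2)"
  unfolding L2_on_def set_borel_measurable_def set_integrable_def
  by (subst borel_measurable_restrict_space_iff, simp, subst integrable_restrict_space) auto

lemma absolutely_integrable_on_iff_lebesgue_on:
  "f absolutely_integrable_on {s..t} \<longleftrightarrow> integrable (lebesgue_on {s..t::real}) f"
  unfolding set_integrable_def by (subst integrable_restrict_space) auto

lemma L2_on_imp_absolutely_integrable:
  assumes "L2_on s t f" shows "f absolutely_integrable_on {s..t}"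
proof -
  have I: "integrable (lebesgue_on {s..t}) (\<lambda>u. 1 + (norm (f u))\<^sup>2)"
    using assms absolutely_integrable_continuous_real[of s t "\<lambda>_. 1::real"]
    by (auto simp: L2_on_iff absolutely_integrable_on_iff_lebesgue_on)
  have le: "norm (f u) \<le> norm (1 + (norm (f u))\<^sup>2)" for u
  proof -
    have "2 * norm (f u) \<le> 1 + (norm (f u))\<^sup>2"
      using zero_le_power2[of "norm (f u) - 1"] by (simp add: power2_eq_square algebra_simps)
    then show ?thesis
      using norm_ge_zero[of "f u"] unfolding real_norm_def by linarith
  qed
  have "f \<in> borel_measurable (lebesgue_on {s..t})"
    using assms by (simp add: L2_on_iff)
  then have "integrable (lebesgue_on {s..t}) f"
    by (rule Bochner_Integration.integrable_bound[OF I]) (rule AE_I2, rule le)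
  then show ?thesis
    by (simp only: absolutely_integrable_on_iff_lebesgue_on)
qed

lemma L2_on_continuous:
  assumes "continuous_on {s..t} f" shows "L2_on s t f"
proof -
  have "continuous_on {s..t} (\<lambda>u. (norm (f u))\<^sup>2)"
    using assms by (intro continuous_intros)
  then show ?thesis
    using assms unfolding L2_on_iff absolutely_integrable_on_iff_lebesgue_on[symmetric]
    by (auto intro: continuous_imp_measurable_on_sets_lebesgue absolutely_integrable_continuous_real)
qed

lemma L2_on_add:
  assumes "L2_on s t f" "L2_on s t g" shows "L2_on s t (\<lambda>u. f u + g u)"
  unfolding L2_on_iff
proof
  show m: "(\<lambda>u. f u + g u) \<in> borel_measurable (lebesgue_on {s..t})"
    using assms by (auto simp: L2_on_iff)
  have "(norm (f u + g u))\<^sup>2 \<le> 2 * (norm (f u))\<^sup>2 + 2 * (norm (g u))\<^sup>2" for u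
  proof -
    have "(norm (f u + g u))\<^sup>2 \<le> (norm (f u) + norm (g u))\<^sup>2"
      by (intro power_mono norm_triangle_ineq) auto
    also have "\<dots> \<le> 2 * (norm (f u))\<^sup>2 + 2 * (norm (g u))\<^sup>2"
      using sum_power2_ge_zero[of "norm (f u) - norm (g u)" 0] by (simp add: power2_eq_square algebra_simps)
    finally show ?thesis .
  qed
  moreover have "integrable (lebesgue_on {s..t}) (\<lambda>u. 2 * (norm (f u))\<^sup>2 + 2 * (norm (g u))\<^sup>2)"
    using assms by (auto simp: L2_on_iff)
  ultimately show "integrable (lebesgue_on {s..t}) (\<lambda>u. (norm (f u + g u))\<^sup>2)"
    using m by (elim Bochner_Integration.integrable_bound) auto
qed

lemma L2_on_sum:
  assumes "finite I" "\<And>i. i \<in> I \<Longrightarrow> L2_on s t (f i)"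
  shows "L2_on s t (\<lambda>u. \<Sum>i\<in>I. f i u)"
  using assms by (induction I rule: finite_induct) (auto intro: L2_on_add L2_on_continuous)

text \<open>Taking components and multiplying by bounded functions preserve square integrability by this comparison.\<close>

lemma L2_on_dominated:
  assumes g: "L2_on s t g" and m: "f \<in> borel_measurable (lebesgue_on {s..t})"
    and le: "\<And>u. u \<in> {s..t} \<Longrightarrow> norm (f u) \<le> B * norm (g u)"
  shows "L2_on s t f"
  unfolding L2_on_iff
proof
  have "integrable (lebesgue_on {s..t}) (\<lambda>u. B\<^sup>2 * (norm (g u))\<^sup>2)"
    using g by (auto simp: L2_on_iff)
  then show "integrable (lebesgue_on {s..t}) (\<lambda>u. (norm (f u))\<^sup>2)"
  proof (rule Bochner_Integration.integrable_bound)
    show "(\<lambda>u. (norm (f u))\<^sup>2) \<in> borel_measurable (lebesgue_on {s..t})" using m by measurable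
    have "(norm (f u))\<^sup>2 \<le> B\<^sup>2 * (norm (g u))\<^sup>2" if "u \<in> {s..t}" for u
      using power_mono[OF le[OF that], of 2] by (simp add: power_mult_distrib)
    then show "AE u in lebesgue_on {s..t}. norm ((norm (f u))\<^sup>2) \<le> norm (B\<^sup>2 * (norm (g u))\<^sup>2)"
      by (intro AE_I2) auto
  qed
qed (rule m)

lemma L2_on_scaleR_continuous:
  fixes f :: "real \<Rightarrow> real" and G :: "real \<Rightarrow> 'e::euclidean_space"
  assumes f: "L2_on s t f" and G: "continuous_on {s..t} G"
  shows "L2_on s t (\<lambda>u. f u *\<^sub>R G u)"
proof -
  have "bounded (G ` {s..t})"
    using G by (intro compact_imp_bounded compact_continuous_image) auto
  then have "\<exists>B. \<forall>u\<in>{s..t}. norm (G u) \<le> B"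
    by (simp add: bounded_iff)
  then obtain B where "\<And>u. u \<in> {s..t} \<Longrightarrow> norm (G u) \<le> B"
    by blast
  moreover have "(\<lambda>u. f u *\<^sub>R G u) \<in> borel_measurable (lebesgue_on {s..t})"
    using f continuous_imp_measurable_on_sets_lebesgue[OF G]
    by (intro borel_measurable_scaleR) (auto simp: L2_on_iff)
  ultimately show ?thesis
    by (intro L2_on_dominated[OF f, of _ B]) (auto simp: mult.commute[of B] intro: mult_left_mono)
qed

lemma L2_on_component:
  assumes "L2_on s t f" shows "L2_on s t (\<lambda>u. f u \<bullet> i)"
  using assms by (intro L2_on_dominated[OF assms, of _ "norm i"])
    (auto simp: L2_on_iff Cauchy_Schwarz_ineq2 mult.commute[of "norm i"])

lemma L2_on_mult_integrable:
  fixes f g :: "real \<Rightarrow> real"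
  assumes "L2_on s t f" "L2_on s t g"
  shows "(\<lambda>u. f u * g u) absolutely_integrable_on {s..t}"
  unfolding absolutely_integrable_on_iff_lebesgue_on
proof (rule Bochner_Integration.integrable_bound)
  show "integrable (lebesgue_on {s..t}) (\<lambda>u. (norm (f u))\<^sup>2 + (norm (g u))\<^sup>2)"
    using assms by (auto simp: L2_on_iff)
  show "(\<lambda>u. f u * g u) \<in> borel_measurable (lebesgue_on {s..t})"
    using assms by (auto simp: L2_on_iff)
  have "\<bar>f u * g u\<bar> \<le> (f u)\<^sup>2 + (g u)\<^sup>2" for u
  proof -
    have "2 * (\<bar>f u\<bar> * \<bar>g u\<bar>) \<le> (f u)\<^sup>2 + (g u)\<^sup>2"
      using sum_squares_bound[of "\<bar>f u\<bar>" "\<bar>g u\<bar>"] by (simp add: mult.assoc)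
    moreover have "0 \<le> \<bar>f u\<bar> * \<bar>g u\<bar>" by simp
    ultimately show ?thesis
      unfolding abs_mult by linarith
  qed
  then show "AE u in lebesgue_on {s..t}. norm (f u * g u) \<le> norm ((norm (f u))\<^sup>2 + (norm (g u))\<^sup>2)"
    by (intro AE_I2) auto
qed

lemma L2_on_cong:
  assumes "L2_on s t f" "\<And>u. u \<in> {s..t} \<Longrightarrow> f u = g u"
  shows "L2_on s t g"
proof -
  have "g \<in> borel_measurable (lebesgue_on {s..t})"
    using assms measurable_cong[of "lebesgue_on {s..t}" f g borel] by (auto simp: L2_on_iff)
  then show ?thesis
    by (rule L2_on_dominated[OF assms(1), of _ 1]) (use assms(2) in auto)
qed

lemma L2_on_subinterval:
  assumes "L2_on s t f" "s \<le> u" "v \<le> t" shows "L2_on u v f"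
proof -
  have "f \<in> borel_measurable (lebesgue_on {u..v})"
    using assms
    by (auto simp: L2_on_iff intro: measurable_restrict_mono)
  moreover have "(\<lambda>x. (norm (f x))\<^sup>2) absolutely_integrable_on {s..t}"
    using assms by (simp add: L2_on_def)
  then have "(\<lambda>x. (norm (f x))\<^sup>2) absolutely_integrable_on {u..v}"
    by (rule absolutely_integrable_on_subinterval) (use assms in auto)
  ultimately show ?thesis
    by (simp add: L2_on_iff absolutely_integrable_on_iff_lebesgue_on)
qed

lemma L2_on_join:
  assumes ab: "L2_on a b f" and bc: "L2_on b c f" and le: "a \<le> b" "b \<le> c"
  shows "L2_on a c f"
proof -
  have un: "{a..b} \<union> {b..c} = {a..c}" using le by auto
  have "(\<lambda>x. if x \<in> {..b} then indicat_real {a..b} x *\<^sub>R f x else indicat_real {b..c} x *\<^sub>R f x) \<in> borel_measurable lebesgue"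
    using ab bc by (intro measurable_If_set) (auto simp: L2_on_def set_borel_measurable_def)
  moreover have "(if x \<in> {..b} then indicat_real {a..b} x *\<^sub>R f x else indicat_real {b..c} x *\<^sub>R f x) =
      indicat_real {a..c} x *\<^sub>R f x" for x
    using le by (auto simp: indicator_def)
  moreover have "(\<lambda>x. (norm (f x))\<^sup>2) absolutely_integrable_on {a..b} \<union> {b..c}"
    using ab bc by (intro absolutely_integrable_Un) (auto simp: L2_on_def)
  ultimately show ?thesis
    unfolding L2_on_def set_borel_measurable_def un by simp
qed

lemma L2_on_spike:
  assumes f: "L2_on a b f" and fg: "\<And>t. t \<noteq> z \<Longrightarrow> g t = f t"
  shows "L2_on a b g"
proof -
  have "(\<lambda>x. if x \<in> {z} then g z else f x) \<in> borel_measurable (lebesgue_on {a..b})"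
  proof (rule measurable_If_set)
    show "f \<in> borel_measurable (lebesgue_on {a..b})" using f by (simp only: L2_on_iff)
    show "{z} \<inter> space (lebesgue_on {a..b}) \<in> sets (lebesgue_on {a..b})"
      unfolding sets_restrict_space by (rule image_eqI[of _ _ "{z}"]) auto
  qed (rule borel_measurable_const)
  moreover have "(\<lambda>x. if x \<in> {z} then g z else f x) = g" using fg by auto
  ultimately have "g \<in> borel_measurable (lebesgue_on {a..b})" by simp
  moreover have "(\<lambda>x. (norm (f x))\<^sup>2) absolutely_integrable_on {a..b}" using f unfolding L2_on_def by (rule conjunct2)
  then have "(\<lambda>x. (norm (g x))\<^sup>2) absolutely_integrable_on {a..b}"
    by (rule absolutely_integrable_spike[where S = "{z}"]) (use fg in auto)
  ultimately show ?thesis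
    by (simp add: L2_on_iff absolutely_integrable_on_iff_lebesgue_on)
qed

text \<open>By du Bois-Reymond the first weak derivative differs from a primitive \<open>G\<close> of the second one by a
  constant \<open>C\<close>, up to a null set. So \<open>f\<close> is a primitive of the continuous function
  \<open>F = G + C\<close>.\<close>

lemma H2_on_imp_C1:
  fixes f :: "real \<Rightarrow> 'e::euclidean_space"
  assumes "s < t" and H2: "H2_on s t f" and cont: "continuous_on {s..t} f"
  obtains F w where "\<And>u. u \<in> {s..t} \<Longrightarrow> (f has_vector_derivative F u) (at u within {s..t})"
    and "primitive_on s t F w" and "L2_on s t w"
proof -
  obtain f' f'' where f': "L2_on s t f'" "weak_derivative_on s t f f'"
    and f'': "L2_on s t f''" "weak_derivative_on s t f' f''"
    using H2 by (auto simp: H2_on_def)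
  note ai = L2_on_imp_absolutely_integrable[OF f'(1)] L2_on_imp_absolutely_integrable[OF f''(1)]
  have p: "primitive_on s t f f'"
    by (rule weak_derivative_imp_primitive_on[OF \<open>s < t\<close> cont f'(2) ai(1)])
  define G where "G u = integral {s..u} f''" for u
  have G: "primitive_on s t G f''"
    unfolding G_def by (rule primitive_on_integral[OF ai(2)])
  have Gc: "continuous_on {s..t} G" by (rule primitive_on_continuous[OF G])
  let ?h = "\<lambda>u. f' u - G u"
  have "?h absolutely_integrable_on {s..t}"
    using ai(1) absolutely_integrable_continuous_real[OF Gc] by (rule set_integral_diff)
  then obtain C where C: "\<And>u v. s \<le> u \<Longrightarrow> u \<le> v \<Longrightarrow> v \<le> t \<Longrightarrow> (?h has_integral (v - u) *\<^sub>R C) {u..v}"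
    using weak_derivative_zero_imp_integral_linear[OF \<open>s < t\<close> _ weak_derivative_diff_primitive[OF \<open>s < t\<close> ai(1) f''(2) G]]
    by blast
  define F where "F u = G u + C" for u
  have F: "primitive_on s t F f''"
    using primitive_on_add[OF G primitive_on_const[of s t C]] by (simp add: F_def[abs_def])
  have Fc: "continuous_on {s..t} F" by (rule primitive_on_continuous[OF F])
  have "primitive_on s t f F"
  proof (rule primitive_onI)
    show "F absolutely_integrable_on {s..t}"
      by (rule absolutely_integrable_continuous_real[OF Fc])
    fix u v assume uv: "s \<le> u" "u \<le> v" "v \<le> t"
    have "((\<lambda>x. f' x - ?h x + C) has_integral (f v - f u - (v - u) *\<^sub>R C + (v - u) *\<^sub>R C)) {u..v}"
      using has_integral_add[OF has_integral_diff[OF primitive_onD(2)[OF p uv] C[OF uv]] has_integral_const_real[of C u v]] uv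
      by simp
    then show "(F has_integral (f v - f u)) {u..v}"
      by (simp add: F_def[abs_def])
  qed
  then show ?thesis
    using that primitive_on_derivative[OF _ Fc] F f''(1) by blast
qed

section \<open>Second derivatives\<close>

lemma DERIV_along_line:
  fixes f :: "'a::real_normed_vector \<Rightarrow> real"
  assumes "(f has_derivative f') (at (p + s *\<^sub>R v))"
  shows "((\<lambda>s. f (p + s *\<^sub>R v)) has_real_derivative f' v) (at s)"
proof -
  have "((\<lambda>s. p + s *\<^sub>R v) has_derivative (\<lambda>h. h *\<^sub>R v)) (at s)"
    by (auto intro!: derivative_eq_intros)
  from has_derivative_compose[OF this assms]
  have "((\<lambda>s. f (p + s *\<^sub>R v)) has_derivative (\<lambda>h. f' (h *\<^sub>R v))) (at s)" .
  moreover have "(\<lambda>h. f' (h *\<^sub>R v)) = (*) (f' v)"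
    using linear_cmul[OF has_derivative_linear[OF assms]] by (auto simp: mult.commute)
  ultimately show ?thesis
    by (simp add: has_field_derivative_def)
qed

text \<open>The mean value theorem, applied first in direction \<open>v\<close> and then in direction \<open>w\<close>.
  The second difference on the left is symmetric in \<open>v\<close> and \<open>w\<close>, the right-hand side
  is a second derivative at a nearby point.\<close>

lemma second_difference_mean_value:
  fixes f :: "'a::real_normed_vector \<Rightarrow> real"
  assumes h: "h > 0" and sub: "\<And>s t. 0 \<le> s \<Longrightarrow> s \<le> h \<Longrightarrow> 0 \<le> t \<Longrightarrow> t \<le> h \<Longrightarrow> x + s *\<^sub>R v + t *\<^sub>R w \<in> S"
    and f': "\<And>y. y \<in> S \<Longrightarrow> (f has_derivative f' y) (at y)"
    and A: "\<And>y. y \<in> S \<Longrightarrow> ((\<lambda>z. f' z v) has_derivative A y) (at y)"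
  obtains s t where "0 < s" "s < h" "0 < t" "t < h"
    "f (x + h *\<^sub>R v + h *\<^sub>R w) - f (x + h *\<^sub>R v) - f (x + h *\<^sub>R w) + f x = h * h * A (x + s *\<^sub>R v + t *\<^sub>R w) w"
proof -
  let ?\<phi> = "\<lambda>s. f ((x + h *\<^sub>R w) + s *\<^sub>R v) - f (x + s *\<^sub>R v)"
  have "(?\<phi> has_real_derivative (f' ((x + h *\<^sub>R w) + s *\<^sub>R v) v - f' (x + s *\<^sub>R v) v)) (at s)"
    if "0 \<le> s" "s \<le> h" for s
    using sub[of s h] sub[of s 0] that h
    by (intro DERIV_diff DERIV_along_line f') (auto simp: algebra_simps)
  from MVT2[OF h this]
  obtain s where s: "0 < s" "s < h"
    "?\<phi> h - ?\<phi> 0 = h * (f' ((x + h *\<^sub>R w) + s *\<^sub>R v) v - f' (x + s *\<^sub>R v) v)"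
    by auto
  have "((\<lambda>t. f' ((x + s *\<^sub>R v) + t *\<^sub>R w) v) has_real_derivative A ((x + s *\<^sub>R v) + t *\<^sub>R w) w) (at t)"
    if "0 \<le> t" "t \<le> h" for t
    using sub[of s t] that s by (intro DERIV_along_line[of "\<lambda>z. f' z v"] A) auto
  from MVT2[OF h this]
  obtain t where t: "0 < t" "t < h"
    "f' ((x + s *\<^sub>R v) + h *\<^sub>R w) v - f' ((x + s *\<^sub>R v) + 0 *\<^sub>R w) v = h * A ((x + s *\<^sub>R v) + t *\<^sub>R w) w"
    by auto
  show ?thesis
    using that[of s t] s t by (simp add: algebra_simps)
qed

text \<open>The theorem of Schwarz: divide the two evaluations of the symmetric second difference by
  \<open>h\<^sup>2\<close> and let \<open>h\<close> tend to \<open>0\<close>.\<close>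

lemma mixed_second_derivatives_eq_real:
  fixes f :: "'a::real_normed_vector \<Rightarrow> real"
  assumes S: "open S" "x \<in> S"
    and f': "\<And>y. y \<in> S \<Longrightarrow> (f has_derivative f' y) (at y)"
    and A: "\<And>y. y \<in> S \<Longrightarrow> ((\<lambda>z. f' z v) has_derivative A y) (at y)"
    and B: "\<And>y. y \<in> S \<Longrightarrow> ((\<lambda>z. f' z w) has_derivative B y) (at y)"
    and cA: "continuous_on S (\<lambda>y. A y w)" and cB: "continuous_on S (\<lambda>y. B y v)"
  shows "A x w = B x v"
proof -
  have "\<bar>A x w - B x v\<bar> \<le> 0"
  proof (rule field_le_epsilon)
    fix e :: real assume e: "e > 0"
    have "isCont (\<lambda>y. A y w) x" "isCont (\<lambda>y. B y v) x"
      using cA cB S by (auto simp: continuous_on_eq_continuous_at)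
    note cont = this
    obtain d1 where d1: "d1 > 0" "\<And>y. norm (y - x) < d1 \<Longrightarrow> norm (A y w - A x w) < e/2"
      using cont(1)[unfolded continuous_at_eps_delta, rule_format, of "e/2"] e by (auto simp: dist_norm)
    obtain d2 where d2: "d2 > 0" "\<And>y. norm (y - x) < d2 \<Longrightarrow> norm (B y v - B x v) < e/2"
      using cont(2)[unfolded continuous_at_eps_delta, rule_format, of "e/2"] e by (auto simp: dist_norm)
    note d = d1(1) d2(1) d1(2) d2(2)
    obtain d0 where d0: "d0 > 0" "ball x d0 \<subseteq> S"
      using S openE by blast
    define d where "d = min d0 (min d1 d2)"
    have dpos: "d > 0" using d d0 by (auto simp: d_def)
    define n where "n = norm v + norm w + 1"
    have n: "n > 0" unfolding n_def by (smt (verit) norm_ge_zero)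
    define h where "h = d / (2 * n)"
    have h: "h > 0" "h * n < d"
      using dpos n by (auto simp: h_def field_simps)
    have near: "norm ((x + s *\<^sub>R a + t *\<^sub>R b) - x) < d"
      if "0 \<le> s" "s \<le> h" "0 \<le> t" "t \<le> h" "a = v \<and> b = w \<or> a = w \<and> b = v" for s t a b
    proof -
      have "norm ((x + s *\<^sub>R a + t *\<^sub>R b) - x) \<le> s * norm a + t * norm b"
        using norm_triangle_ineq[of "s *\<^sub>R a" "t *\<^sub>R b"] that by simp
      also have "\<dots> \<le> h * norm a + h * norm b"
        using that by (intro add_mono mult_right_mono) auto
      also have "\<dots> \<le> h * n"
        using that h by (auto simp: n_def algebra_simps)
      finally show ?thesis using h by simp
    qed
    have mem: "x + s *\<^sub>R a + t *\<^sub>R b \<in> S"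
      if "0 \<le> s" "s \<le> h" "0 \<le> t" "t \<le> h" "a = v \<and> b = w \<or> a = w \<and> b = v" for s t a b
    proof -
      have "dist (x + s *\<^sub>R a + t *\<^sub>R b) x < d0"
        using near[OF that] by (simp only: d_def dist_norm min_less_iff_conj)
      then show ?thesis
        using d0(2) by (metis dist_commute mem_ball subsetD)
    qed
    let ?\<Delta> = "\<lambda>v w. f (x + h *\<^sub>R v + h *\<^sub>R w) - f (x + h *\<^sub>R v) - f (x + h *\<^sub>R w) + f x"
    obtain s t where st: "0 < s" "s < h" "0 < t" "t < h" "?\<Delta> v w = h * h * A (x + s *\<^sub>R v + t *\<^sub>R w) w"
      using second_difference_mean_value[where S = S and x = x and v = v and w = w, OF h(1) _ f' A] mem by blast
    obtain s' t' where st': "0 < s'" "s' < h" "0 < t'" "t' < h" "?\<Delta> w v = h * h * B (x + s' *\<^sub>R w + t' *\<^sub>R v) v"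
      using second_difference_mean_value[where S = S and x = x and v = w and w = v, OF h(1) _ f' B] mem by blast
    have "?\<Delta> v w = ?\<Delta> w v" by (simp add: algebra_simps)
    then have "A (x + s *\<^sub>R v + t *\<^sub>R w) w = B (x + s' *\<^sub>R w + t' *\<^sub>R v) v"
      using st(5) st'(5) h by simp
    moreover have "norm (A (x + s *\<^sub>R v + t *\<^sub>R w) w - A x w) < e/2"
      using near[of s t v w] st by (intro d) (auto simp: d_def)
    moreover have "norm (B (x + s' *\<^sub>R w + t' *\<^sub>R v) v - B x v) < e/2"
      using near[of s' t' w v] st' by (intro d) (auto simp: d_def)
    ultimately show "\<bar>A x w - B x v\<bar> \<le> 0 + e"
      unfolding real_norm_def by linarith
  qed
  then show ?thesis by simp
qed

lemma smooth_on_derivative: "smooth_on S f \<Longrightarrow> smooth_on S (\<lambda>x. frechet_derivative f (at x) v)"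
  unfolding smooth_on_def by (metis Ck_on.simps(2))

lemma smooth_on_imp_continuous_on: "smooth_on S f \<Longrightarrow> continuous_on S f"
  unfolding smooth_on_def by (metis Ck_on.simps(1))

lemma smooth_on_has_derivative:
  "smooth_on S f \<Longrightarrow> x \<in> S \<Longrightarrow> (f has_derivative frechet_derivative f (at x)) (at x)"
  unfolding smooth_on_def by (metis Ck_on.simps(2) frechet_derivative_works)

lemma smooth_on_linear_derivative:
  "smooth_on S f \<Longrightarrow> x \<in> S \<Longrightarrow> linear (frechet_derivative f (at x))"
  by (rule has_derivative_linear[OF smooth_on_has_derivative])

text \<open>The argument \<open>w\<close> is the direction of the outer derivative.\<close>

definition second_derivative :: "('a::euclidean_space \<Rightarrow> 'b::real_normed_vector) \<Rightarrow> 'a \<Rightarrow> 'a \<Rightarrow> 'a \<Rightarrow> 'b" where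
  "second_derivative f x w v = frechet_derivative (\<lambda>y. frechet_derivative f (at y) v) (at x) w"

lemma second_derivative_symmetric:
  fixes f :: "'a::euclidean_space \<Rightarrow> 'b::euclidean_space"
  assumes S: "open S" "x \<in> S" and f: "smooth_on S f"
  shows "second_derivative f x w v = second_derivative f x v w"
proof (rule euclidean_eqI)
  fix i :: 'b assume "i \<in> Basis"
  note D = has_derivative_inner_left[OF smooth_on_has_derivative]
  have cont: "continuous_on S (\<lambda>y. frechet_derivative (\<lambda>z. frechet_derivative f (at z) a) (at y) b \<bullet> i)" for a b
    by (intro continuous_intros smooth_on_imp_continuous_on smooth_on_derivative f)
  show "second_derivative f x w v \<bullet> i = second_derivative f x v w \<bullet> i"
    unfolding second_derivative_def
    by (rule mixed_second_derivatives_eq_real[OF S D[OF f] D[OF smooth_on_derivative[OF f]]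
          D[OF smooth_on_derivative[OF f]] cont cont])
qed

section \<open>Linear algebra depending on parameters\<close>

lemma linear_basis_expansion:
  assumes "linear L" shows "L v = (\<Sum>i\<in>Basis. (v \<bullet> i) *\<^sub>R L i)"
proof -
  have "L v = L (\<Sum>i\<in>Basis. (v \<bullet> i) *\<^sub>R i)" by (simp add: euclidean_representation)
  then show ?thesis by (simp add: linear_sum[OF assms] linear_cmul[OF assms])
qed

lemma bilinear_basis_expansion:
  assumes "bilinear B" shows "B a b = (\<Sum>i\<in>Basis. \<Sum>j\<in>Basis. (a \<bullet> i) *\<^sub>R (b \<bullet> j) *\<^sub>R B i j)"
proof -
  have "B a b = (\<Sum>i\<in>Basis. (a \<bullet> i) *\<^sub>R B i b)"
    using assms by (intro linear_basis_expansion[of "\<lambda>a. B a b"]) (auto simp: bilinear_def)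
  also have "\<dots> = (\<Sum>i\<in>Basis. (a \<bullet> i) *\<^sub>R (\<Sum>j\<in>Basis. (b \<bullet> j) *\<^sub>R B i j))"
    using assms linear_basis_expansion[of "B _" b] by (auto simp: bilinear_def)
  finally show ?thesis by (simp add: scaleR_sum_right)
qed

text \<open>The rules of calculus are needed for families of linear maps known only through their values on fixed vectors
  (the components of the metric, its derivatives, Christoffel symbols, coordinate changes). Expanding the
  argument in the standard basis reduces them to the rules for products.\<close>

lemma continuous_on_linear_family:
  fixes X :: "'x::topological_space \<Rightarrow> 'a::euclidean_space" and L :: "'x \<Rightarrow> 'a \<Rightarrow> 'b::real_normed_vector"
  assumes "\<And>t. t \<in> T \<Longrightarrow> linear (L t)" "\<And>i. i \<in> Basis \<Longrightarrow> continuous_on T (\<lambda>t. L t i)" "continuous_on T X"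
  shows "continuous_on T (\<lambda>t. L t (X t))"
proof -
  have "continuous_on T (\<lambda>t. \<Sum>i\<in>Basis. (X t \<bullet> i) *\<^sub>R L t i)"
    using assms by (intro continuous_intros)
  then show ?thesis
    by (rule continuous_on_eq) (rule linear_basis_expansion[OF assms(1), symmetric])
qed

lemma continuous_on_bilinear_family:
  fixes X Z :: "'x::topological_space \<Rightarrow> 'a::euclidean_space" and B :: "'x \<Rightarrow> 'a \<Rightarrow> 'a \<Rightarrow> 'b::real_normed_vector"
  assumes "\<And>t. t \<in> T \<Longrightarrow> bilinear (B t)" "\<And>i j. continuous_on T (\<lambda>t. B t i j)"
    "continuous_on T X" "continuous_on T Z"
  shows "continuous_on T (\<lambda>t. B t (X t) (Z t))"
proof (rule continuous_on_linear_family[of T "\<lambda>t. B t (X t)"])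
  show "linear (B t (X t))" if "t \<in> T" for t
    using assms(1)[OF that] by (simp add: bilinear_def)
  show "continuous_on T (\<lambda>t. B t (X t) i)" for i
    by (rule continuous_on_linear_family[of T "\<lambda>t a. B t a i"]) (use assms in \<open>auto simp: bilinear_def\<close>)
qed (rule assms(4))

lemma has_derivative_linear_family:
  fixes X :: "'x::real_normed_vector \<Rightarrow> 'a::euclidean_space" and L :: "'x \<Rightarrow> 'a \<Rightarrow> 'b::real_normed_vector"
  assumes x0: "x0 \<in> S" and lin: "\<And>y. y \<in> S \<Longrightarrow> linear (L y)"
    and L': "\<And>a. ((\<lambda>y. L y a) has_derivative L' a) (at x0 within S)"
    and X': "(X has_derivative X') (at x0 within S)" and linL': "\<And>h. linear (\<lambda>a. L' a h)"
  shows "((\<lambda>y. L y (X y)) has_derivative (\<lambda>h. L' (X x0) h + L x0 (X' h))) (at x0 within S)"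
proof -
  have "((\<lambda>y. \<Sum>i\<in>Basis. (X y \<bullet> i) *\<^sub>R L y i) has_derivative
      (\<lambda>h. \<Sum>i\<in>Basis. (X x0 \<bullet> i) *\<^sub>R L' i h + (X' h \<bullet> i) *\<^sub>R L x0 i)) (at x0 within S)"
    by (intro has_derivative_sum has_derivative_scaleR has_derivative_inner_left X' L')
  moreover have "(\<Sum>i\<in>Basis. (X x0 \<bullet> i) *\<^sub>R L' i h + (X' h \<bullet> i) *\<^sub>R L x0 i) = L' (X x0) h + L x0 (X' h)" for h
    using linear_basis_expansion[OF linL', of "X x0" h] linear_basis_expansion[OF lin[OF x0], of "X' h"]
    by (simp add: sum.distrib)
  ultimately have "((\<lambda>y. \<Sum>i\<in>Basis. (X y \<bullet> i) *\<^sub>R L y i) has_derivative (\<lambda>h. L' (X x0) h + L x0 (X' h))) (at x0 within S)"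
    by simp
  then show ?thesis
    by (rule has_derivative_transform[OF x0, rotated]) (rule linear_basis_expansion[OF lin])
qed

lemma primitive_on_linear_family:
  fixes X :: "real \<Rightarrow> 'a::euclidean_space" and L :: "real \<Rightarrow> 'a \<Rightarrow> 'b::euclidean_space"
  assumes X: "primitive_on a b X w" and L: "\<And>i. i \<in> Basis \<Longrightarrow> primitive_on a b (\<lambda>t. L t i) (\<lambda>t. L' t i)"
    and lin: "\<And>t. t \<in> {a..b} \<Longrightarrow> linear (L t)" "\<And>t. t \<in> {a..b} \<Longrightarrow> linear (L' t)"
  shows "primitive_on a b (\<lambda>t. L t (X t)) (\<lambda>t. L' t (X t) + L t (w t))"
proof -
  have "primitive_on a b (\<lambda>t. \<Sum>i\<in>Basis. (X t \<bullet> i) *\<^sub>R L t i)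
      (\<lambda>t. \<Sum>i\<in>Basis. (w t \<bullet> i) *\<^sub>R L t i + (X t \<bullet> i) *\<^sub>R L' t i)"
    by (intro primitive_on_sum primitive_on_scaleR L primitive_on_linear[OF X, of "\<lambda>x. x \<bullet> _"] bounded_linear_inner_left) auto
  then show ?thesis
  proof (rule primitive_on_cong)
    fix t assume t: "t \<in> {a..b}"
    show "(\<Sum>i\<in>Basis. (X t \<bullet> i) *\<^sub>R L t i) = L t (X t)"
      by (rule linear_basis_expansion[OF lin(1)[OF t], symmetric])
    show "(\<Sum>i\<in>Basis. (w t \<bullet> i) *\<^sub>R L t i + (X t \<bullet> i) *\<^sub>R L' t i) = L' t (X t) + L t (w t)"
      using linear_basis_expansion[OF lin(1)[OF t], of "w t"] linear_basis_expansion[OF lin(2)[OF t], of "X t"]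
      by (simp add: sum.distrib)
  qed
qed

lemma L2_on_linear_family:
  fixes w :: "real \<Rightarrow> 'a::euclidean_space" and L :: "real \<Rightarrow> 'a \<Rightarrow> 'b::euclidean_space"
  assumes w: "L2_on a b w" and L: "\<And>i. i \<in> Basis \<Longrightarrow> continuous_on {a..b} (\<lambda>t. L t i)"
    and lin: "\<And>t. t \<in> {a..b} \<Longrightarrow> linear (L t)"
  shows "L2_on a b (\<lambda>t. L t (w t))"
proof -
  have "L2_on a b (\<lambda>t. \<Sum>i\<in>Basis. (w t \<bullet> i) *\<^sub>R L t i)"
    by (intro L2_on_sum L2_on_scaleR_continuous L2_on_component w L) auto
  then show ?thesis
    by (rule L2_on_cong) (rule linear_basis_expansion[OF lin, symmetric])
qed

text \<open>A positive continuous function on the compact product of \<open>K\<close> with the unit sphere has a positive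
  minimum.\<close>

lemma bilinear_family_coercive:
  fixes G :: "'x::topological_space \<Rightarrow> 'a::euclidean_space \<Rightarrow> 'a \<Rightarrow> real"
  assumes K: "compact K" and bil: "\<And>x. x \<in> K \<Longrightarrow> bilinear (G x)"
    and cont: "\<And>a b. continuous_on K (\<lambda>x. G x a b)"
    and pos: "\<And>x a. x \<in> K \<Longrightarrow> a \<noteq> 0 \<Longrightarrow> G x a a > 0"
  obtains m where "m > 0" "\<And>x a. x \<in> K \<Longrightarrow> m * (norm a)\<^sup>2 \<le> G x a a"
proof (cases "K = {}")
  case False
  let ?f = "\<lambda>z. G (fst z) (snd z) (snd z)" and ?C = "K \<times> sphere (0::'a) 1"
  have "continuous_on ?C (\<lambda>z. G (fst z) i j)" for i j
    by (rule continuous_on_compose2[OF cont]) (auto intro: continuous_intros)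
  then have "continuous_on ?C ?f"
    by (intro continuous_on_bilinear_family[of ?C "\<lambda>z. G (fst z)" snd snd])
      (auto intro: bil continuous_intros)
  moreover have "compact ?C" "?C \<noteq> {}"
    using K False by (auto intro: compact_Times)
  ultimately obtain z where z: "z \<in> ?C" "\<And>y. y \<in> ?C \<Longrightarrow> ?f z \<le> ?f y"
    using continuous_attains_inf[of ?C ?f] by blast
  show ?thesis
  proof (rule that)
    have "snd z \<noteq> 0" using z(1) by auto
    then show "?f z > 0" using z(1) pos[of "fst z" "snd z"] by (auto simp: mem_Times_iff)
    fix x a assume x: "x \<in> K"
    show "?f z * (norm a)\<^sup>2 \<le> G x a a"
    proof (cases "a = 0")
      case True then show ?thesis using bilinear_lzero[OF bil[OF x]] by simp
    next
      case False
      let ?u = "(1 / norm a) *\<^sub>R a"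
      have "?f z \<le> G x ?u ?u" using z(2)[of "(x, ?u)"] x False by simp
      also have "\<dots> = G x a a / (norm a)\<^sup>2"
        using bil[OF x] by (simp add: bilinear_lmul bilinear_rmul power2_eq_square)
      finally show ?thesis using False by (simp add: field_simps)
    qed
  qed
qed (use that[of 1] in auto)

lemma posdef_riesz:
  fixes G :: "'a::euclidean_space \<Rightarrow> 'a \<Rightarrow> real"
  assumes bil: "bilinear G" and pos: "\<And>a. a \<noteq> 0 \<Longrightarrow> G a a > 0" and l: "linear l"
  shows "\<exists>!y. \<forall>b. G y b = l b"
proof -
  define L where "L y = (\<Sum>i\<in>Basis. G y i *\<^sub>R i)" for y
  have L: "L y \<bullet> i = G y i" if "i \<in> Basis" for y i
    using that by (simp add: L_def inner_sum_left inner_Basis if_distrib sum.delta cong: if_cong)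
  have linL: "linear L"
    by (rule linearI) (auto simp: L_def bilinear_ladd[OF bil] bilinear_lmul[OF bil] scaleR_add_left sum.distrib scaleR_sum_right)
  have G_eq: "G y b = L y \<bullet> b" for y b
  proof -
    have "G y b = (\<Sum>i\<in>Basis. (b \<bullet> i) *\<^sub>R G y i)"
      using bil by (intro linear_basis_expansion) (auto simp: bilinear_def)
    also have "\<dots> = L y \<bullet> b"
      by (subst euclidean_inner) (auto simp: L mult.commute intro: sum.cong)
    finally show ?thesis .
  qed
  have inj: "inj L"
  proof (rule linear_injective_0[THEN iffD2, OF linL], intro allI impI)
    fix y assume "L y = 0"
    then show "y = 0" using G_eq[of y y] pos[of y] by force
  qed
  then obtain y where "L y = (\<Sum>i\<in>Basis. l i *\<^sub>R i)"
    using linear_injective_imp_surjective[OF linL] by (metis surjD)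
  then have "G y b = l b" for b
    unfolding G_eq by (subst linear_basis_expansion[OF l]) (auto simp: inner_sum_left inner_commute[of b] mult.commute intro!: sum.cong)
  moreover have "y' = y" if "\<And>b. G y' b = G y b" for y'
    using that inj injD[OF inj, of y' y] by (metis G_eq inner_commute vector_eq_ldot)
  ultimately show ?thesis by metis
qed

text \<open>The Christoffel symbols are the solution of a linear system with the metric as coefficients (Koszul formula).
  To see that the solution depends continuously on the base point, compare with \<open>x0\<close>: with
  \<open>k x = h x - h x0\<close>, coercivity at \<open>x0\<close> survives nearby with half the constant, and
  bounds \<open>k x\<close> by the functional \<open>b \<mapsto> G x (k x) b\<close>, which tends to
  \<open>0\<close>.\<close>

lemma continuous_on_posdef_solution:
  fixes G :: "'x::topological_space \<Rightarrow> 'a::euclidean_space \<Rightarrow> 'a \<Rightarrow> real" and h :: "'x \<Rightarrow> 'a"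
  assumes bil: "\<And>x. x \<in> S \<Longrightarrow> bilinear (G x)"
    and cont: "\<And>a b. continuous_on S (\<lambda>x. G x a b)"
    and pos: "\<And>x a. x \<in> S \<Longrightarrow> a \<noteq> 0 \<Longrightarrow> G x a a > 0"
    and sol: "\<And>b. continuous_on S (\<lambda>x. G x (h x) b)"
  shows "continuous_on S h"
  unfolding continuous_on_def
proof
  fix x0 assume x0: "x0 \<in> S"
  let ?F = "at x0 within S"
  have inS: "eventually (\<lambda>x. x \<in> S) ?F"
    by (simp add: eventually_at_filter)
  obtain m where m: "m > 0" "\<And>a. m * (norm a)\<^sup>2 \<le> G x0 a a"
    by (rule bilinear_family_coercive[of "{x0}" G]) (use bil pos x0 in auto)
  define k where "k x = h x - h x0" for x
  define e where "e x i = G x (h x) i - G x (h x0) i" for x i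
  define E where "E x = (\<Sum>i\<in>Basis. \<Sum>j\<in>Basis. \<bar>G x i j - G x0 i j\<bar>)" for x
  have e0: "((\<lambda>x. \<Sum>i\<in>Basis. \<bar>e x i\<bar>) \<longlongrightarrow> (\<Sum>i\<in>Basis. \<bar>e x0 i\<bar>)) ?F"
    unfolding e_def using sol cont x0 by (intro tendsto_intros) (auto simp: continuous_on_def)
  have E0: "(E \<longlongrightarrow> E x0) ?F"
    unfolding E_def using cont x0 by (intro tendsto_intros) (auto simp: continuous_on_def)
  have "E x0 = 0" by (simp add: E_def)
  then have ev: "eventually (\<lambda>x. E x < m/2) ?F"
    using order_tendstoD(2)[OF E0, of "m/2"] m by simp
  have bound: "norm (k x) \<le> (2/m) * (\<Sum>i\<in>Basis. \<bar>e x i\<bar>)" if x: "x \<in> S" and Ex: "E x < m/2" for x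
  proof -
    let ?a = "k x"
    have ek: "G x ?a b = (\<Sum>i\<in>Basis. (b \<bullet> i) * e x i)" for b
    proof -
      have "G x ?a b = G x (h x) b - G x (h x0) b"
        unfolding k_def by (rule bilinear_lsub[OF bil[OF x]])
      then show ?thesis
        using linear_basis_expansion[of "G x (h x)" b] linear_basis_expansion[of "G x (h x0)" b] bil[OF x]
        by (simp add: e_def bilinear_def sum_subtractf algebra_simps)
    qed
    have "\<bar>G x ?a ?a\<bar> \<le> (\<Sum>i\<in>Basis. norm ?a * \<bar>e x i\<bar>)"
      unfolding ek by (rule order_trans[OF sum_abs]) (auto simp: abs_mult intro!: sum_mono mult_right_mono Basis_le_norm)
    then have 1: "\<bar>G x ?a ?a\<bar> \<le> norm ?a * (\<Sum>i\<in>Basis. \<bar>e x i\<bar>)"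
      by (simp add: sum_distrib_left)
    have "G x ?a ?a - G x0 ?a ?a = (\<Sum>i\<in>Basis. \<Sum>j\<in>Basis. (?a \<bullet> i) * (?a \<bullet> j) * (G x i j - G x0 i j))"
      by (subst bilinear_basis_expansion[OF bil[OF x]], subst bilinear_basis_expansion[OF bil[OF x0]])
        (simp add: sum_subtractf algebra_simps)
    also have "\<bar>\<dots>\<bar> \<le> (\<Sum>i\<in>Basis. \<Sum>j\<in>Basis. norm ?a * norm ?a * \<bar>G x i j - G x0 i j\<bar>)"
      by (rule order_trans[OF sum_abs], rule sum_mono, rule order_trans[OF sum_abs], rule sum_mono)
        (auto simp: abs_mult intro!: mult_right_mono mult_mono Basis_le_norm)
    also have "\<dots> = (norm ?a)\<^sup>2 * E x"
      by (simp add: E_def sum_distrib_left power2_eq_square)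
    also have "\<dots> \<le> (norm ?a)\<^sup>2 * (m/2)"
      using Ex by (intro mult_left_mono) auto
    finally have "\<bar>G x ?a ?a - G x0 ?a ?a\<bar> \<le> (norm ?a)\<^sup>2 * (m/2)" .
    then have "m * (norm ?a)\<^sup>2 - (norm ?a)\<^sup>2 * (m/2) \<le> norm ?a * (\<Sum>i\<in>Basis. \<bar>e x i\<bar>)"
      using m(2)[of ?a] 1 by linarith
    then have "norm ?a * (m/2 * norm ?a) \<le> norm ?a * (\<Sum>i\<in>Basis. \<bar>e x i\<bar>)"
      by (simp add: power2_eq_square algebra_simps)
    then show ?thesis
    proof (cases "?a = 0")
      case False
      then have "m/2 * norm ?a \<le> (\<Sum>i\<in>Basis. \<bar>e x i\<bar>)"
        using \<open>norm ?a * _ \<le> _\<close> by (simp add: mult_le_cancel_left)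
      then show ?thesis using m by (simp add: field_simps)
    qed (use m in \<open>auto intro!: mult_nonneg_nonneg sum_nonneg\<close>)
  qed
  have "((\<lambda>x. (2/m) * (\<Sum>i\<in>Basis. \<bar>e x i\<bar>)) \<longlongrightarrow> (2/m) * 0) ?F"
    using e0 by (intro tendsto_intros) (simp add: e_def)
  then have "((\<lambda>x. (2/m) * (\<Sum>i\<in>Basis. \<bar>e x i\<bar>)) \<longlongrightarrow> 0) ?F" by simp
  then have "(k \<longlongrightarrow> 0) ?F"
    by (rule Lim_null_comparison[rotated]) (use eventually_conj[OF inS ev] bound in \<open>auto elim: eventually_mono\<close>)
  then show "(h \<longlongrightarrow> h x0) ?F"
    unfolding k_def by (rule LIM_zero_cancel)
qed

section \<open>The algebraic Levi-Civita lemma\<close>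

text \<open>At a fixed point: \<open>G\<close> is the metric, \<open>D z\<close> its derivative in the direction
  \<open>z\<close>.\<close>

definition levi_civita_form :: "('a::euclidean_space \<Rightarrow> 'a \<Rightarrow> real) \<Rightarrow> ('a \<Rightarrow> 'a \<Rightarrow> 'a \<Rightarrow> real) \<Rightarrow> ('a \<Rightarrow> 'a \<Rightarrow> 'a) \<Rightarrow> bool" where
  "levi_civita_form G D \<Gamma> \<longleftrightarrow> bilinear \<Gamma> \<and> (\<forall>a b. \<Gamma> a b = \<Gamma> b a) \<and>
     (\<forall>z a b. D z a b = G (\<Gamma> z a) b + G a (\<Gamma> z b))"

text \<open>Add the compatibility conditions for two of the cyclic permutations of \<open>a\<close>, \<open>b\<close>,
  \<open>c\<close> and subtract the third; by symmetry of \<open>\<Gamma>\<close> all but two equal terms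
  cancel.\<close>

lemma levi_civita_form_koszul:
  assumes sym: "\<And>a b. G a b = G b a" and lc: "levi_civita_form G D \<Gamma>"
  shows "2 * G (\<Gamma> a b) c = D a b c + D b a c - D c a b"
proof -
  have D: "D z a b = G (\<Gamma> z a) b + G a (\<Gamma> z b)" and S: "\<Gamma> a b = \<Gamma> b a" for z a b
    using lc by (auto simp: levi_civita_form_def)
  have "D a b c + D b a c - D c a b =
     (G (\<Gamma> a b) c + G b (\<Gamma> a c)) + (G (\<Gamma> b a) c + G a (\<Gamma> b c)) - (G (\<Gamma> c a) b + G a (\<Gamma> c b))"
    unfolding D ..
  also have "\<dots> = 2 * G (\<Gamma> a b) c"
    using S[of a b] S[of a c] S[of b c] sym[of "\<Gamma> c a" b] by simp
  finally show ?thesis by simp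
qed

text \<open>The Koszul formula determines \<open>\<Gamma> a b\<close> through its products with all vectors, and
  conversely defines a form with the two properties.\<close>

lemma levi_civita_form_ex1:
  fixes G :: "'a::euclidean_space \<Rightarrow> 'a \<Rightarrow> real"
  assumes bil: "bilinear G" and pos: "\<And>a. a \<noteq> 0 \<Longrightarrow> G a a > 0" and sym: "\<And>a b. G a b = G b a"
    and D1: "\<And>a b. linear (\<lambda>z. D z a b)" and D2: "\<And>z b. linear (\<lambda>a. D z a b)"
    and Dsym: "\<And>z a b. D z a b = D z b a"
  shows "\<exists>!\<Gamma>. levi_civita_form G D \<Gamma>"
proof -
  have D3: "linear (\<lambda>b. D z a b)" for z a
    using D2[of z a] Dsym[of z] by simp
  let ?K = "\<lambda>a b c. (D a b c + D b a c - D c a b) / 2"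
  have D_add: "D (x + y) a b = D x a b + D y a b" "D z (x + y) b = D z x b + D z y b" "D z a (x + y) = D z a x + D z a y" for x y z a b
    using linear_add[OF D1] linear_add[OF D2] linear_add[OF D3] by auto
  have D_mul: "D (r *\<^sub>R x) a b = r * D x a b" "D z (r *\<^sub>R x) b = r * D z x b" "D z a (r *\<^sub>R x) = r * D z a x" for x z a b r
    using linear_cmul[OF D1] linear_cmul[OF D2] linear_cmul[OF D3] by auto
  have "linear (?K a b)" for a b
    by (rule linearI) (auto simp: D_add D_mul field_simps)
  note ex1 = posdef_riesz[OF bil pos this]
  define \<Gamma> where "\<Gamma> a b = (THE y. \<forall>c. G y c = ?K a b c)" for a b
  have \<Gamma>: "G (\<Gamma> a b) c = ?K a b c" for a b c
    using theI'[OF ex1, of a b] unfolding \<Gamma>_def by blast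
  have eqI: "x = y" if "\<And>c. G x c = G y c" for x y
  proof (rule ccontr)
    assume "x \<noteq> y"
    then show False
      using pos[of "x - y"] that[of "x - y"] bilinear_lsub[OF bil, of x y "x - y"] by simp
  qed
  have sym\<Gamma>: "\<Gamma> a b = \<Gamma> b a" for a b
    by (rule eqI) (simp add: \<Gamma> Dsym[of _ a b])
  have lin: "linear (\<lambda>b. \<Gamma> a b)" for a
    by (rule linearI; rule eqI) (auto simp: \<Gamma> bilinear_ladd[OF bil] bilinear_lmul[OF bil] D_add D_mul field_simps)
  moreover have "linear (\<lambda>a. \<Gamma> a b)" for b
    using lin[of b] by (subst sym\<Gamma>)
  ultimately have bil\<Gamma>: "bilinear \<Gamma>" by (simp add: bilinear_def)
  have "D z a b = G (\<Gamma> z a) b + G a (\<Gamma> z b)" for z a b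
    by (simp add: sym[of a] \<Gamma> Dsym[of z b a] Dsym[of a b z] Dsym[of b a z] field_simps)
  then have ex: "levi_civita_form G D \<Gamma>"
    using bil\<Gamma> sym\<Gamma> unfolding levi_civita_form_def by blast
  show ?thesis
  proof (rule ex1I[where a = \<Gamma>])
    show "levi_civita_form G D \<Gamma>" by (rule ex)
  next
    fix \<Gamma>' assume "levi_civita_form G D \<Gamma>'"
    then have "G (\<Gamma>' a b) c = G (\<Gamma> a b) c" for a b c
      using levi_civita_form_koszul[where G = G, OF sym, where D = D and \<Gamma> = \<Gamma>' and a = a and b = b and c = c]
        levi_civita_form_koszul[OF sym ex, where a = a and b = b and c = c] by simp
    then show "\<Gamma>' = \<Gamma>" by (intro ext eqI)
  qed
qed

section \<open>Coordinates, tangent vectors and the Levi-Civita connection\<close>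

abbreviation transition :: "('m, 'e) chart \<Rightarrow> ('m, 'e) chart \<Rightarrow> 'e \<Rightarrow> 'e" where
  "transition c c' \<equiv> chart_map c' \<circ> chart_inv c"

abbreviation chart_img :: "('m, 'e) chart \<Rightarrow> 'e set" where
  "chart_img c \<equiv> chart_map c ` chart_dom c"

locale riemannian =
  fixes \<A> :: "('m::{t2_space, second_countable_topology}, 'e::euclidean_space) chart set"
    and g :: "('m, 'e) metric"
  assumes mfd: "riemannian_manifold \<A> g"
begin

lemma atlas: "smooth_atlas \<A>" and metric: "riemannian_metric \<A> g"
  using mfd by (auto simp: riemannian_manifold_def)

lemma chart_exists: obtains c where "c \<in> \<A>" "q \<in> chart_dom c"
  using atlas unfolding smooth_atlas_def by blast

context
  fixes c assumes c: "c \<in> \<A>"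
begin

lemma is_chart: "is_chart c"
  using atlas c by (auto simp: smooth_atlas_def)

lemma open_chart_dom: "open (chart_dom c)" and open_chart_img: "open (chart_img c)"
  and continuous_on_chart_map: "continuous_on (chart_dom c) (chart_map c)"
  and continuous_on_chart_inv: "continuous_on (chart_img c) (chart_inv c)"
  and chart_inv_map: "\<And>q. q \<in> chart_dom c \<Longrightarrow> chart_inv c (chart_map c q) = q"
  and chart_map_inv: "\<And>x. x \<in> chart_img c \<Longrightarrow> chart_map c (chart_inv c x) = x"
  and chart_inv_dom: "\<And>x. x \<in> chart_img c \<Longrightarrow> chart_inv c x \<in> chart_dom c"
  using is_chart unfolding is_chart_def homeomorphism_def by (auto intro: inv_into_into)

lemma open_overlap: "open (chart_map c ` (chart_dom c \<inter> U))" if "open U"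
proof -
  have "chart_map c ` (chart_dom c \<inter> U) = chart_img c \<inter> chart_inv c -` U"
    using chart_inv_map chart_map_inv chart_inv_dom by (auto simp: image_iff)
  then show ?thesis
    using continuous_open_preimage[OF continuous_on_chart_inv open_chart_img that] by simp
qed

lemma smooth_metric_coords: "smooth_on (chart_img c) (\<lambda>x. metric_coords \<A> g c x a b)"
  using metric c by (auto simp: riemannian_metric_def)

end

lemma smooth_transition:
  "c \<in> \<A> \<Longrightarrow> c' \<in> \<A> \<Longrightarrow> smooth_on (chart_map c ` (chart_dom c \<inter> chart_dom c')) (transition c c')"
  using atlas by (auto simp: smooth_atlas_def)

lemma transition_has_derivative:
  assumes "c \<in> \<A>" "c' \<in> \<A>" "q \<in> chart_dom c" "q \<in> chart_dom c'"
  shows "(transition c c' has_derivative coord_change_deriv c c' q) (at (chart_map c q))"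
  unfolding coord_change_deriv_def
  by (rule smooth_on_has_derivative[OF smooth_transition]) (use assms in auto)

lemma linear_coord_change:
  assumes "c \<in> \<A>" "c' \<in> \<A>" "q \<in> chart_dom c" "q \<in> chart_dom c'"
  shows "linear (coord_change_deriv c c' q)"
  by (rule has_derivative_linear[OF transition_has_derivative[OF assms]])

lemma coord_change_deriv_refl:
  assumes "c \<in> \<A>" "q \<in> chart_dom c" shows "coord_change_deriv c c q a = a"
proof -
  have "((\<lambda>x. x) has_derivative coord_change_deriv c c q) (at (chart_map c q))"
    by (rule has_derivative_transform_within_open[OF transition_has_derivative open_chart_img])
      (use assms chart_map_inv in auto)
  then have "coord_change_deriv c c q = (\<lambda>x. x)"
    using has_derivative_unique[OF _ has_derivative_ident] by blast
  then show ?thesis by simp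
qed

lemma coord_change_deriv_trans:
  assumes "c \<in> \<A>" "c' \<in> \<A>" "c'' \<in> \<A>" "q \<in> chart_dom c" "q \<in> chart_dom c'" "q \<in> chart_dom c''"
  shows "coord_change_deriv c' c'' q (coord_change_deriv c c' q a) = coord_change_deriv c c'' q a"
proof -
  let ?x = "chart_map c q"
  have x: "transition c c' ?x = chart_map c' q"
    using assms chart_inv_map by simp
  have "(transition c' c'' \<circ> transition c c' has_derivative coord_change_deriv c' c'' q \<circ> coord_change_deriv c c' q) (at ?x)"
    using assms by (intro diff_chain_at transition_has_derivative)
      (auto simp only: x intro!: transition_has_derivative)
  then have "(transition c c'' has_derivative coord_change_deriv c' c'' q \<circ> coord_change_deriv c c' q) (at ?x)"
    by (rule has_derivative_transform_within_open[OF _ open_overlap[OF assms(1) open_chart_dom[OF assms(2)]]])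
      (use assms chart_inv_map in auto)
  from has_derivative_unique[OF this transition_has_derivative[OF assms(1,3,4,6)]]
  show ?thesis by (simp add: fun_eq_iff)
qed

lemma coord_change_deriv_inverse:
  assumes "c \<in> \<A>" "c' \<in> \<A>" "q \<in> chart_dom c" "q \<in> chart_dom c'"
  shows "coord_change_deriv c' c q (coord_change_deriv c c' q a) = a"
  using assms by (simp add: coord_change_deriv_trans coord_change_deriv_refl)

lemma tangent_of_coords_in_tangent_space:
  assumes "c \<in> \<A>" "q \<in> chart_dom c" shows "tangent_of_coords \<A> c q a \<in> tangent_space \<A> q"
  using assms by (auto simp: tangent_space_def tangent_of_coords_def coord_change_deriv_trans)

lemma tangent_of_coords_self:
  assumes "c \<in> \<A>" "q \<in> chart_dom c" shows "tangent_of_coords \<A> c q a c = a"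
  using assms by (simp add: tangent_of_coords_def coord_change_deriv_refl)

lemma tangent_space_change:
  assumes "v \<in> tangent_space \<A> q" "c \<in> \<A>" "q \<in> chart_dom c" "c' \<in> \<A>" "q \<in> chart_dom c'"
  shows "v c' = coord_change_deriv c c' q (v c)"
  using assms unfolding tangent_space_def by blast

lemma tangent_space_components:
  assumes v: "v \<in> tangent_space \<A> q" and c: "c \<in> \<A>" "q \<in> chart_dom c"
  shows "v = tangent_of_coords \<A> c q (v c)"
proof
  fix c'
  show "v c' = tangent_of_coords \<A> c q (v c) c'"
  proof (cases "c' \<in> \<A> \<and> q \<in> chart_dom c'")
    case True
    then show ?thesis using tangent_space_change[OF v c, of c'] by (simp add: tangent_of_coords_def)
  next
    case False
    then have "v c' = 0" using v unfolding tangent_space_def by blast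
    then show ?thesis using False by (auto simp: tangent_of_coords_def)
  qed
qed

lemma tangent_of_coords_linear:
  assumes "c \<in> \<A>" "q \<in> chart_dom c"
  shows "tangent_of_coords \<A> c q (r *\<^sub>R a + b) = (\<lambda>c'. r *\<^sub>R tangent_of_coords \<A> c q a c' + tangent_of_coords \<A> c q b c')"
  using assms linear_coord_change[OF assms(1)]
  by (auto simp: tangent_of_coords_def linear_add linear_cmul intro!: ext)

lemma tangent_of_coords_change:
  assumes "c \<in> \<A>" "q \<in> chart_dom c" "c' \<in> \<A>" "q \<in> chart_dom c'"
  shows "tangent_of_coords \<A> c q a = tangent_of_coords \<A> c' q (coord_change_deriv c c' q a)"
  using assms by (auto simp: tangent_of_coords_def coord_change_deriv_trans intro!: ext)

lemma metric_sym: "u \<in> tangent_space \<A> q \<Longrightarrow> v \<in> tangent_space \<A> q \<Longrightarrow> g q u v = g q v u"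
  and metric_lincomb: "u \<in> tangent_space \<A> q \<Longrightarrow> v \<in> tangent_space \<A> q \<Longrightarrow> w \<in> tangent_space \<A> q \<Longrightarrow>
     g q (\<lambda>c. r *\<^sub>R u c + v c) w = r * g q u w + g q v w"
  and metric_pos: "u \<in> tangent_space \<A> q \<Longrightarrow> u \<noteq> (\<lambda>_. 0) \<Longrightarrow> g q u u > 0"
  using metric unfolding riemannian_metric_def by blast+

context
  fixes c assumes c: "c \<in> \<A>"
begin

lemma metric_eq_coords:
  assumes "u \<in> tangent_space \<A> q" "v \<in> tangent_space \<A> q" "q \<in> chart_dom c"
  shows "g q u v = metric_coords \<A> g c (chart_map c q) (u c) (v c)"
  unfolding metric_coords_def using assms c
  by (simp add: chart_inv_map flip: tangent_space_components)

lemma metric_coords_sym: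
  assumes "x \<in> chart_img c" shows "metric_coords \<A> g c x a b = metric_coords \<A> g c x b a"
  unfolding metric_coords_def
  by (rule metric_sym) (use assms c in \<open>auto intro: tangent_of_coords_in_tangent_space chart_inv_dom\<close>)

lemma bilinear_metric_coords:
  assumes x: "x \<in> chart_img c" shows "bilinear (metric_coords \<A> g c x)"
proof -
  note T = tangent_of_coords_in_tangent_space[OF c chart_inv_dom[OF c x]]
  have lc: "metric_coords \<A> g c x (r *\<^sub>R a + a') b = r * metric_coords \<A> g c x a b + metric_coords \<A> g c x a' b" for r a a' b
    unfolding metric_coords_def tangent_of_coords_linear[OF c chart_inv_dom[OF c x]]
    by (rule metric_lincomb[OF T T T])
  have z: "metric_coords \<A> g c x 0 b = 0" for b
    using lc[of 1 0 0 b] by simp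
  have 1: "linear (\<lambda>a. metric_coords \<A> g c x a b)" for b
    using lc[of 1 _ _ b] lc[of _ _ 0 b] z by (intro linearI) auto
  moreover have "linear (\<lambda>b. metric_coords \<A> g c x a b)" for a
    using 1[of a] by (subst metric_coords_sym[OF x])
  ultimately show ?thesis by (simp add: bilinear_def)
qed

lemma metric_coords_pos:
  assumes x: "x \<in> chart_img c" and "a \<noteq> 0" shows "metric_coords \<A> g c x a a > 0"
  unfolding metric_coords_def
proof (rule metric_pos)
  show "tangent_of_coords \<A> c (chart_inv c x) a \<in> tangent_space \<A> (chart_inv c x)"
    by (intro tangent_of_coords_in_tangent_space chart_inv_dom c x)
  show "tangent_of_coords \<A> c (chart_inv c x) a \<noteq> (\<lambda>_. 0)"
    using tangent_of_coords_self[OF c chart_inv_dom[OF c x], of a] \<open>a \<noteq> 0\<close> by auto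
qed

lemma metric_coords_nonneg: "x \<in> chart_img c \<Longrightarrow> metric_coords \<A> g c x a a \<ge> 0"
  using metric_coords_pos[of x a] bilinear_lzero[OF bilinear_metric_coords[of x]] by (cases "a = 0") auto

definition metric_deriv :: "'e \<Rightarrow> 'e \<Rightarrow> 'e \<Rightarrow> 'e \<Rightarrow> real" where
  "metric_deriv x z a b = frechet_derivative (\<lambda>y. metric_coords \<A> g c y a b) (at x) z"

lemma metric_coords_has_derivative:
  "x \<in> chart_img c \<Longrightarrow> ((\<lambda>y. metric_coords \<A> g c y a b) has_derivative (\<lambda>z. metric_deriv x z a b)) (at x)"
  unfolding metric_deriv_def by (rule smooth_on_has_derivative[OF smooth_metric_coords[OF c]])

lemma continuous_on_metric_deriv: "continuous_on (chart_img c) (\<lambda>x. metric_deriv x z a b)"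
  unfolding metric_deriv_def by (intro smooth_on_imp_continuous_on smooth_on_derivative smooth_metric_coords c)

lemma metric_deriv_linear1: "x \<in> chart_img c \<Longrightarrow> linear (\<lambda>z. metric_deriv x z a b)"
  by (rule has_derivative_linear[OF metric_coords_has_derivative])

lemma metric_deriv_sym:
  assumes x: "x \<in> chart_img c" shows "metric_deriv x z a b = metric_deriv x z b a"
proof -
  have "((\<lambda>y. metric_coords \<A> g c y a b) has_derivative (\<lambda>z. metric_deriv x z b a)) (at x)"
    by (rule has_derivative_transform_within_open[OF metric_coords_has_derivative open_chart_img[OF c]])
      (use x metric_coords_sym in auto)
  then show ?thesis
    by (rule fun_cong[OF has_derivative_unique[OF metric_coords_has_derivative[OF x]]])
qed

lemma metric_deriv_linear2:
  assumes x: "x \<in> chart_img c" shows "linear (\<lambda>a. metric_deriv x z a b)"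
proof -
  have "((\<lambda>y. metric_coords \<A> g c y (r *\<^sub>R a + a') b) has_derivative
      (\<lambda>z. r * metric_deriv x z a b + metric_deriv x z a' b)) (at x)" for r a a'
  proof (rule has_derivative_transform_within_open[OF _ open_chart_img[OF c] x])
    show "((\<lambda>y. r * metric_coords \<A> g c y a b + metric_coords \<A> g c y a' b) has_derivative
      (\<lambda>z. r * metric_deriv x z a b + metric_deriv x z a' b)) (at x)"
      by (intro has_derivative_add has_derivative_mult_right metric_coords_has_derivative x)
  qed (auto simp: bilinear_ladd[OF bilinear_metric_coords] bilinear_lmul[OF bilinear_metric_coords])
  then have lc: "metric_deriv x z (r *\<^sub>R a + a') b = r * metric_deriv x z a b + metric_deriv x z a' b" for r a a' z
    by (rule fun_cong[OF has_derivative_unique[OF metric_coords_has_derivative[OF x]]])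
  have "metric_deriv x z 0 b = 0"
    using lc[of z 1 0 0] by simp
  then show ?thesis
    using lc[of z 1] lc[of z _ _ 0] by (intro linearI) auto
qed

lemma christoffel_eq_THE:
  "christoffel \<A> g c x = (THE \<Gamma>. levi_civita_form (metric_coords \<A> g c x) (metric_deriv x) \<Gamma>)"
  by (simp add: christoffel_def levi_civita_form_def metric_deriv_def)

lemma christoffel_ex1:
  "x \<in> chart_img c \<Longrightarrow> \<exists>!\<Gamma>. levi_civita_form (metric_coords \<A> g c x) (metric_deriv x) \<Gamma>"
  by (intro levi_civita_form_ex1 bilinear_metric_coords metric_coords_pos metric_coords_sym
      metric_deriv_linear1 metric_deriv_linear2 metric_deriv_sym)

lemma christoffel_levi_civita:
  "x \<in> chart_img c \<Longrightarrow> levi_civita_form (metric_coords \<A> g c x) (metric_deriv x) (christoffel \<A> g c x)"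
  unfolding christoffel_eq_THE by (rule theI'[OF christoffel_ex1])

lemma christoffel_unique:
  "x \<in> chart_img c \<Longrightarrow> levi_civita_form (metric_coords \<A> g c x) (metric_deriv x) \<Gamma> \<Longrightarrow> christoffel \<A> g c x = \<Gamma>"
  using christoffel_ex1 christoffel_levi_civita by blast

lemma bilinear_christoffel: "x \<in> chart_img c \<Longrightarrow> bilinear (christoffel \<A> g c x)"
  using christoffel_levi_civita by (simp add: levi_civita_form_def)

lemma metric_deriv_christoffel:
  "x \<in> chart_img c \<Longrightarrow> metric_deriv x z a b =
     metric_coords \<A> g c x (christoffel \<A> g c x z a) b + metric_coords \<A> g c x a (christoffel \<A> g c x z b)"
  using christoffel_levi_civita by (simp add: levi_civita_form_def)

lemma continuous_on_christoffel:
  "continuous_on (chart_img c) (\<lambda>x. christoffel \<A> g c x a b)"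
proof (rule continuous_on_posdef_solution[of "chart_img c" "metric_coords \<A> g c"])
  show "continuous_on (chart_img c) (\<lambda>x. metric_coords \<A> g c x (christoffel \<A> g c x a b) d)" for d
  proof (rule continuous_on_eq)
    show "continuous_on (chart_img c) (\<lambda>x. (metric_deriv x a b d + metric_deriv x b a d - metric_deriv x d a b) / 2)"
      by (intro continuous_intros continuous_on_metric_deriv) auto
    show "(metric_deriv x a b d + metric_deriv x b a d - metric_deriv x d a b) / 2 =
        metric_coords \<A> g c x (christoffel \<A> g c x a b) d" if "x \<in> chart_img c" for x
      using levi_civita_form_koszul[OF metric_coords_sym[OF that] christoffel_levi_civita[OF that], of a b d]
      by simp
  qed
qed (auto intro: bilinear_metric_coords metric_coords_pos smooth_on_imp_continuous_on smooth_metric_coords c)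

end

lemma metric_coords_change:
  assumes "c \<in> \<A>" "c' \<in> \<A>" "q \<in> chart_dom c" "q \<in> chart_dom c'"
  shows "metric_coords \<A> g c (chart_map c q) a b =
    metric_coords \<A> g c' (chart_map c' q) (coord_change_deriv c c' q a) (coord_change_deriv c c' q b)"
  using assms by (simp add: metric_coords_def chart_inv_map tangent_of_coords_change[of c q c'])

text \<open>The inhomogeneous transformation law of the Christoffel symbols. Differentiating the identity that expresses
  the metric in the chart \<open>c\<close> by the metric in the chart \<open>c'\<close> shows that the pulled
  back symbols are compatible with the metric; they are symmetric by the theorem of Schwarz. Uniqueness does
  the rest.\<close>

lemma christoffel_change:
  assumes c: "c \<in> \<A>" and c': "c' \<in> \<A>" and q: "q \<in> chart_dom c" "q \<in> chart_dom c'"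
  shows "coord_change_deriv c c' q (christoffel \<A> g c (chart_map c q) a b) =
    christoffel \<A> g c' (chart_map c' q) (coord_change_deriv c c' q a) (coord_change_deriv c c' q b)
    + second_derivative (transition c c') (chart_map c q) a b"
proof -
  let ?x = "chart_map c q" and ?x' = "chart_map c' q" and ?\<tau> = "transition c c'"
  let ?O = "chart_map c ` (chart_dom c \<inter> chart_dom c')"
  let ?A = "coord_change_deriv c c' q" and ?B = "coord_change_deriv c' c q"
  let ?\<Gamma>' = "christoffel \<A> g c' ?x'" and ?H = "second_derivative ?\<tau> ?x"
  define T where "T y = frechet_derivative ?\<tau> (at y)" for y
  have O: "open ?O" using open_overlap[OF c open_chart_dom[OF c']] .
  have xO: "?x \<in> ?O" using q by auto
  have x: "?x \<in> chart_img c" and x': "?x' \<in> chart_img c'" using q by auto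
  have sm: "smooth_on ?O ?\<tau>" by (rule smooth_transition[OF c c'])
  have TA: "T ?x = ?A" by (simp add: T_def coord_change_deriv_def)
  have \<tau>x: "?\<tau> ?x = ?x'" using c q by (simp add: chart_inv_map)
  have \<tau>O: "?\<tau> y \<in> chart_img c'" if "y \<in> ?O" for y
    using that c by (auto simp: chart_inv_map)
  have Hsym: "?H v w = ?H w v" for v w
    by (rule second_derivative_symmetric[OF O xO sm])
  have T': "((\<lambda>y. T y v) has_derivative (\<lambda>h. ?H h v)) (at ?x)" for v
    unfolding T_def second_derivative_def
    by (rule smooth_on_has_derivative[OF smooth_on_derivative[OF sm] xO])
  have Hlin: "linear (\<lambda>h. ?H h v)" for v
    by (rule has_derivative_linear[OF T'])
  have Hbil: "bilinear ?H"
    unfolding bilinear_def using Hlin by (simp add: Hsym[of _ ])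
  have linA: "linear ?A" and linB: "linear ?B"
    using linear_coord_change c c' q by auto
  have AB: "?A (?B v) = v" and BA: "?B (?A v) = v" for v
    using coord_change_deriv_inverse c c' q by auto
  have gT: "metric_coords \<A> g c y v w = metric_coords \<A> g c' (?\<tau> y) (T y v) (T y w)" if y: "y \<in> ?O" for y v w
  proof -
    obtain r where r: "r \<in> chart_dom c" "r \<in> chart_dom c'" "y = chart_map c r" using y by blast
    then have "T y = coord_change_deriv c c' r" "?\<tau> y = chart_map c' r"
      using c by (auto simp: T_def coord_change_deriv_def chart_inv_map)
    then show ?thesis using metric_coords_change[OF c c' r(1,2)] r by simp
  qed
  let ?D' = "metric_deriv c' ?x'" and ?G' = "metric_coords \<A> g c' ?x'"
  have bilG': "bilinear ?G'" by (rule bilinear_metric_coords[OF c' x'])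
  have D': "((\<lambda>y. metric_coords \<A> g c' (?\<tau> y) v w) has_derivative (\<lambda>h. ?D' (?A h) v w)) (at ?x)" for v w
  proof -
    have "((\<lambda>y. metric_coords \<A> g c' y v w) has_derivative (\<lambda>z. ?D' z v w)) (at (?\<tau> ?x))"
      unfolding \<tau>x by (rule metric_coords_has_derivative[OF c' x'])
    from has_derivative_compose[OF transition_has_derivative[OF c c' q] this]
    show ?thesis .
  qed
  have at: "at ?x = at ?x within ?O" using at_within_open[OF xO O] by simp
  have der: "((\<lambda>y. metric_coords \<A> g c' (?\<tau> y) (T y v) (T y w)) has_derivative
      (\<lambda>h. (?D' (?A h) (?A v) (?A w) + ?G' (?H h v) (?A w)) + ?G' (?A v) (?H h w))) (at ?x within ?O)" for v w
  proof -
    have bil: "bilinear (metric_coords \<A> g c' (?\<tau> y))" if "y \<in> ?O" for y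
      using bilinear_metric_coords[OF c' \<tau>O[OF that]] .
    have 1: "((\<lambda>y. metric_coords \<A> g c' (?\<tau> y) (T y v) w) has_derivative
        (\<lambda>h. ?D' (?A h) (T ?x v) w + metric_coords \<A> g c' (?\<tau> ?x) (?H h v) w)) (at ?x within ?O)" for w
    proof (rule has_derivative_linear_family[OF xO, where L = "\<lambda>y a. metric_coords \<A> g c' (?\<tau> y) a w"
          and X = "\<lambda>y. T y v" and L' = "\<lambda>a h. ?D' (?A h) a w"])
      show "linear (\<lambda>a. metric_coords \<A> g c' (?\<tau> y) a w)" if "y \<in> ?O" for y
        using bil[OF that] by (simp add: bilinear_def)
      show "((\<lambda>y. metric_coords \<A> g c' (?\<tau> y) a w) has_derivative (\<lambda>h. ?D' (?A h) a w)) (at ?x within ?O)" for a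
        using D'[of a w] at by simp
      show "((\<lambda>y. T y v) has_derivative (\<lambda>h. ?H h v)) (at ?x within ?O)"
        using T' at by simp
      show "linear (\<lambda>a. ?D' (?A h) a w)" for h
        by (rule metric_deriv_linear2[OF c' x'])
    qed
    have "((\<lambda>y. metric_coords \<A> g c' (?\<tau> y) (T y v) (T y w)) has_derivative
        (\<lambda>h. (?D' (?A h) (T ?x v) (T ?x w) + metric_coords \<A> g c' (?\<tau> ?x) (?H h v) (T ?x w))
           + metric_coords \<A> g c' (?\<tau> ?x) (T ?x v) (?H h w))) (at ?x within ?O)"
    proof (rule has_derivative_linear_family[OF xO, where L = "\<lambda>y. metric_coords \<A> g c' (?\<tau> y) (T y v)"
          and X = "\<lambda>y. T y w" and L' = "\<lambda>b h. ?D' (?A h) (T ?x v) b + metric_coords \<A> g c' (?\<tau> ?x) (?H h v) b"])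
      show "linear (metric_coords \<A> g c' (?\<tau> y) (T y v))" if "y \<in> ?O" for y
        using bil[OF that] by (simp add: bilinear_def)
      show "((\<lambda>y. T y w) has_derivative (\<lambda>h. ?H h w)) (at ?x within ?O)"
        using T' at by simp
      have "linear (\<lambda>b. ?D' (?A h) (T ?x v) b)" for h
        using metric_deriv_linear2[OF c' x', of "?A h" "T ?x v"] metric_deriv_sym[OF c' x'] by simp
      moreover have "linear (\<lambda>b. metric_coords \<A> g c' (?\<tau> ?x) (?H h v) b)" for h
        using bil[OF xO] by (simp add: bilinear_def)
      ultimately show "linear (\<lambda>b. ?D' (?A h) (T ?x v) b + metric_coords \<A> g c' (?\<tau> ?x) (?H h v) b)" for h
        by (rule linear_compose_add)
    qed (rule 1)
    then show ?thesis unfolding TA \<tau>x .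
  qed
  have D: "metric_deriv c ?x z v w = ?D' (?A z) (?A v) (?A w) + ?G' (?H z v) (?A w) + ?G' (?A v) (?H z w)" for z v w
  proof -
    have "((\<lambda>y. metric_coords \<A> g c y v w) has_derivative
      (\<lambda>h. (?D' (?A h) (?A v) (?A w) + ?G' (?H h v) (?A w)) + ?G' (?A v) (?H h w))) (at ?x)"
      using der[of v w] unfolding at[symmetric]
      by (rule has_derivative_transform_within_open[OF _ O xO]) (simp only: gT)
    then show ?thesis
      by (rule fun_cong[OF has_derivative_unique[OF metric_coords_has_derivative[OF c x]]])
  qed
  \<comment> \<open>The connection of the chart \<open>c'\<close>, pulled back to the chart \<open>c\<close>.\<close>
  define \<Gamma> where "\<Gamma> v w = ?B (?\<Gamma>' (?A v) (?A w) + ?H v w)" for v w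
  have A\<Gamma>: "?A (\<Gamma> v w) = ?\<Gamma>' (?A v) (?A w) + ?H v w" for v w
    by (simp add: \<Gamma>_def AB)
  have bil\<Gamma>': "bilinear ?\<Gamma>'" by (rule bilinear_christoffel[OF c' x'])
  have sym\<Gamma>': "?\<Gamma>' v w = ?\<Gamma>' w v" for v w
    using christoffel_levi_civita[OF c' x'] by (simp add: levi_civita_form_def)
  have "levi_civita_form (metric_coords \<A> g c ?x) (metric_deriv c ?x) \<Gamma>"
    unfolding levi_civita_form_def
  proof (intro conjI allI)
    have lin: "linear (\<lambda>w. \<Gamma> v w)" for v
      by (rule linearI) (simp_all add: \<Gamma>_def linear_add[OF linA] linear_cmul[OF linA] linear_add[OF linB] linear_cmul[OF linB]
          bilinear_radd[OF bil\<Gamma>'] bilinear_rmul[OF bil\<Gamma>'] bilinear_radd[OF Hbil] bilinear_rmul[OF Hbil] scaleR_add_right)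
    show sym: "\<Gamma> v w = \<Gamma> w v" for v w
      by (simp add: \<Gamma>_def sym\<Gamma>'[of "?A v"] Hsym[of v])
    have "linear (\<lambda>v. \<Gamma> v w)" for w
      using lin[of w] by (subst sym)
    then show "bilinear \<Gamma>" using lin by (simp add: bilinear_def)
    show "metric_deriv c ?x z v w = metric_coords \<A> g c ?x (\<Gamma> z v) w + metric_coords \<A> g c ?x v (\<Gamma> z w)" for z v w
      unfolding D metric_coords_change[OF c c' q] A\<Gamma> metric_deriv_christoffel[OF c' x']
      by (simp add: bilinear_ladd[OF bilG'] bilinear_radd[OF bilG'])
  qed
  then have "christoffel \<A> g c ?x = \<Gamma>"
    by (rule christoffel_unique[OF c x])
  then show ?thesis using A\<Gamma> by simp
qed

end

section \<open>The length of piecewise continuously differentiable curves\<close>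

lemma has_integral_affine_real:
  fixes f :: "real \<Rightarrow> real"
  assumes f: "(f has_integral I) ((\<lambda>u. m * u + k) ` {a..b})" and m: "m \<noteq> 0"
  shows "((\<lambda>u. \<bar>m\<bar> * f (m * u + k)) has_integral I) {a..b}"
proof -
  define p q where "p = (if a \<le> b then if 0 \<le> m then m * a + k else m * b + k else 1)"
    and "q = (if a \<le> b then if 0 \<le> m then m * b + k else m * a + k else 0)"
  have pq: "(\<lambda>u. m * u + k) ` {a..b} = cbox p q"
    by (cases "a \<le> b"; cases "0 \<le> m") (simp_all add: image_affinity_atLeastAtMost p_def q_def)
  have "((\<lambda>x. f (m *\<^sub>R x + k)) has_integral (1 / \<bar>m\<bar> ^ DIM(real)) *\<^sub>R I)
      ((\<lambda>x. (1 / m) *\<^sub>R x + - ((1 / m) *\<^sub>R k)) ` cbox p q)"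
    using has_integral_affinity[OF f[unfolded pq] m] .
  moreover have "(\<lambda>x. (1 / m) *\<^sub>R x + - ((1 / m) *\<^sub>R k)) ` cbox p q = {a..b}"
    unfolding pq[symmetric] image_image using m by (simp add: field_simps)
  ultimately have "((\<lambda>x. f (m * x + k)) has_integral I / \<bar>m\<bar>) {a..b}" by simp
  from has_integral_mult_right[OF this, of "\<bar>m\<bar>"] show ?thesis
    using m by simp
qed

lemma has_integral_nonneg_off_finite:
  fixes f :: "real \<Rightarrow> real"
  assumes "(f has_integral I) A" "finite S" "\<And>t. t \<in> A - S \<Longrightarrow> f t \<ge> 0"
  shows "I \<ge> 0"
proof -
  have "((\<lambda>t. if t \<in> S then 0 else f t) has_integral I) A"
    by (rule has_integral_spike_finite[OF assms(2) _ assms(1)]) auto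
  then show ?thesis by (rule has_integral_nonneg) (use assms(3) in auto)
qed

lemma has_integral_le_off_finite:
  fixes f h :: "real \<Rightarrow> real"
  assumes f: "(f has_integral I) A" and h: "(h has_integral J) A" and S: "finite S" and le: "\<And>t. t \<in> A - S \<Longrightarrow> f t \<le> h t"
  shows "I \<le> J"
  using has_integral_nonneg_off_finite[OF has_integral_diff[OF h f] S] le by auto

lemma C1_on_interval_affine:
  fixes f :: "real \<Rightarrow> 'e::real_normed_vector"
  assumes f: "C1_on_interval p q f" and im: "(\<lambda>u. m * u + k) ` {s..t} \<subseteq> {p..q}"
    and h: "\<And>u. u \<in> {s..t} \<Longrightarrow> h u = f (m * u + k)"
  shows "C1_on_interval s t h"
proof -
  obtain f' where f': "continuous_on {p..q} f'" "\<And>u. u \<in> {p..q} \<Longrightarrow> (f has_vector_derivative f' u) (at u within {p..q})"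
    using f by (auto simp: C1_on_interval_def)
  have "continuous_on {s..t} (\<lambda>u. m *\<^sub>R f' (m * u + k))"
    by (intro continuous_intros continuous_on_compose2[OF f'(1)]) (use im in auto)
  moreover have "(h has_vector_derivative m *\<^sub>R f' (m * u + k)) (at u within {s..t})" if u: "u \<in> {s..t}" for u
  proof -
    have "((\<lambda>u. m * u + k) has_vector_derivative m) (at u within {s..t})"
      by (auto intro!: derivative_eq_intros simp: has_real_derivative_iff_has_vector_derivative[symmetric])
    moreover have "(f has_vector_derivative f' (m * u + k)) (at (m * u + k) within (\<lambda>u. m * u + k) ` {s..t})"
      using im u by (intro has_vector_derivative_within_subset[OF f'(2) im]) blast
    ultimately have "(f \<circ> (\<lambda>u. m * u + k) has_vector_derivative m *\<^sub>R f' (m * u + k)) (at u within {s..t})"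
      by (rule vector_diff_chain_within)
    then show ?thesis
      by (rule has_vector_derivative_transform[OF u, rotated]) (simp add: h)
  qed
  ultimately show ?thesis unfolding C1_on_interval_def by blast
qed

text \<open>Local information on a curve is available on subintervals \<open>[a,b]\<close>, whereas its velocity is
  defined by the derivative within \<open>[0,T]\<close>. The two agree where \<open>[a,b]\<close> is a
  neighbourhood relative to \<open>[0,T]\<close>.\<close>

lemma at_within_relative_nhd:
  fixes a b T t :: real
  assumes "0 \<le> a" "b \<le> T" "a \<le> t" "t \<le> b" "a < t \<or> a = 0" "t < b \<or> b = T"
  shows "at t within {a..b} = at t within {0..T}"
proof -
  define l r where "l = (if a < t then a else t - 1)" and "r = (if t < b then b else t + 1)"
  show ?thesis
    by (rule at_within_nhd[of t "{l<..<r}"]) (use assms in \<open>auto simp: l_def r_def split: if_splits\<close>)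
qed

context riemannian
begin

definition speed :: "real \<Rightarrow> (real \<Rightarrow> 'm) \<Rightarrow> real \<Rightarrow> real" where
  "speed T \<gamma> t = metric_norm g (\<gamma> t) (velocity \<A> T \<gamma> t)"

text \<open>The set of break points is made explicit, because joining and reversing curves transforms it.\<close>

definition C1_off :: "real set \<Rightarrow> real \<Rightarrow> (real \<Rightarrow> 'm) \<Rightarrow> bool" where
  "C1_off S T \<gamma> \<longleftrightarrow> continuous_on {0..T} \<gamma> \<and> finite S \<and> (\<forall>c\<in>\<A>. \<forall>s t. 0 \<le> s \<and> s < t \<and> t \<le> T \<and> {s<..<t} \<inter> S = {} \<and>
        \<gamma> ` {s..t} \<subseteq> chart_dom c \<longrightarrow> C1_on_interval s t (chart_map c \<circ> \<gamma>))"

lemma piecewise_C1_curve_iff: "piecewise_C1_curve \<A> T \<gamma> \<longleftrightarrow> (\<exists>S. C1_off S T \<gamma>)"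
  by (auto simp: piecewise_C1_curve_def C1_off_def)

lemma C1_offD:
  assumes "C1_off S T \<gamma>" "c \<in> \<A>" "0 \<le> s" "s < t" "t \<le> T" "{s<..<t} \<inter> S = {}" "\<gamma> ` {s..t} \<subseteq> chart_dom c"
  shows "C1_on_interval s t (chart_map c \<circ> \<gamma>)"
  using assms unfolding C1_off_def by blast

lemma curve_stays_in_chart:
  assumes "continuous_on {0..T::real} \<gamma>" "t \<in> {0..T}" "\<gamma> t \<in> U" "open U"
  obtains d where "d > 0" "\<And>u. u \<in> {0..T} \<Longrightarrow> \<bar>u - t\<bar> < d \<Longrightarrow> \<gamma> u \<in> U"
proof -
  obtain V where V: "open V" "V \<inter> {0..T} = \<gamma> -` U \<inter> {0..T}"
    using assms(1,4) continuous_on_open_invariant[of "{0..T}" \<gamma>] by blast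
  then have "t \<in> V" using assms by auto
  then obtain d where "d > 0" "ball t d \<subseteq> V" using V(1) openE by blast
  note d = this
  show ?thesis
  proof (rule that[OF d(1)])
    fix u assume u: "u \<in> {0..T}" "\<bar>u - t\<bar> < d"
    then have "u \<in> ball t d" by (simp add: dist_real_def abs_minus_commute)
    then show "\<gamma> u \<in> U" using d(2) u(1) V(2) by blast
  qed
qed

text \<open>By the chain rule the components of the velocity in all charts follow from those in one chart, near which the
  curve stays by continuity.\<close>

lemma velocity_eq:
  assumes c: "c \<in> \<A>" and \<gamma>: "continuous_on {0..T} \<gamma>" and t: "t \<in> {0..T}" and T: "0 < T" and dom: "\<gamma> t \<in> chart_dom c"
    and d: "((chart_map c \<circ> \<gamma>) has_vector_derivative d) (at t within {0..T})"
  shows "velocity \<A> T \<gamma> t = tangent_of_coords \<A> c (\<gamma> t) d"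
proof
  fix c'
  show "velocity \<A> T \<gamma> t c' = tangent_of_coords \<A> c (\<gamma> t) d c'"
  proof (cases "c' \<in> \<A> \<and> \<gamma> t \<in> chart_dom c'")
    case True
    let ?A = "coord_change_deriv c c' (\<gamma> t)"
    have "((chart_map c \<circ> \<gamma>) has_derivative (\<lambda>h. h *\<^sub>R d)) (at t within {0..T})"
      using d by (simp add: has_vector_derivative_def)
    moreover have "(transition c c' has_derivative ?A) (at ((chart_map c \<circ> \<gamma>) t))"
      using transition_has_derivative[OF c _ dom] True by simp
    ultimately have "((\<lambda>u. transition c c' ((chart_map c \<circ> \<gamma>) u)) has_derivative (\<lambda>h. ?A (h *\<^sub>R d))) (at t within {0..T})"
      by (rule has_derivative_compose)
    moreover have "?A (h *\<^sub>R d) = h *\<^sub>R ?A d" for h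
      by (rule linear_cmul[OF linear_coord_change]) (use c True dom in auto)
    ultimately have D: "((\<lambda>u. transition c c' ((chart_map c \<circ> \<gamma>) u)) has_vector_derivative ?A d) (at t within {0..T})"
      by (simp add: has_vector_derivative_def)
    obtain e where e: "e > 0" "\<And>u. u \<in> {0..T} \<Longrightarrow> \<bar>u - t\<bar> < e \<Longrightarrow> \<gamma> u \<in> chart_dom c"
      using curve_stays_in_chart[OF \<gamma> t dom open_chart_dom[OF c]] by metis
    have "((chart_map c' \<circ> \<gamma>) has_vector_derivative ?A d) (at t within {0..T})"
      by (rule has_vector_derivative_transform_within[OF D e(1) t]) (use e(2) chart_inv_map[OF c] in \<open>auto simp: dist_real_def\<close>)
    then have "vector_derivative (chart_map c' \<circ> \<gamma>) (at t within {0..T}) = ?A d"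
      using vector_derivative_within_cbox[of 0 T t] t T by (simp add: cbox_interval)
    then show ?thesis using True by (simp add: velocity_def tangent_of_coords_def)
  qed (auto simp: velocity_def tangent_of_coords_def)
qed

lemma speed_eq:
  assumes "velocity \<A> T \<gamma> t = tangent_of_coords \<A> c (\<gamma> t) d" "c \<in> \<A>" "\<gamma> t \<in> chart_dom c"
  shows "speed T \<gamma> t = sqrt (metric_coords \<A> g c (chart_map c (\<gamma> t)) d d)"
  unfolding speed_def metric_norm_def assms(1)
  using metric_eq_coords[OF assms(2) tangent_of_coords_in_tangent_space[OF assms(2,3)] tangent_of_coords_in_tangent_space[OF assms(2,3)] assms(3), of d d]
  by (simp add: tangent_of_coords_self assms)

lemma C1_off_regular:
  assumes \<gamma>: "C1_off S T \<gamma>" and t: "t \<in> {0..T} - S" and T: "0 < T" and c: "c \<in> \<A>" and dom: "\<gamma> t \<in> chart_dom c"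
  obtains d where "((chart_map c \<circ> \<gamma>) has_vector_derivative d) (at t within {0..T})"
proof -
  have cont: "continuous_on {0..T} \<gamma>" and S: "finite S" using \<gamma> by (auto simp: C1_off_def)
  obtain e1 where e1: "e1 > 0" "\<And>u. u \<in> {0..T} \<Longrightarrow> \<bar>u - t\<bar> < e1 \<Longrightarrow> \<gamma> u \<in> chart_dom c"
    using curve_stays_in_chart[OF cont _ dom open_chart_dom[OF c]] t by (metis DiffD1)
  have "open (- S)" using S by (simp add: finite_imp_closed open_Compl)
  then obtain e2 where e2: "e2 > 0" "ball t e2 \<subseteq> - S" using t openE by blast
  define e where "e = min e1 e2 / 2"
  have e: "e > 0" "e < e1" "e < e2" using e1 e2 by (auto simp: e_def)
  define a b where "a = max 0 (t - e)" and "b = min T (t + e)"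
  have ab: "0 \<le> a" "b \<le> T" "a \<le> t" "t \<le> b" "a < t \<or> a = 0" "t < b \<or> b = T" "a < b"
    using e t T by (auto simp: a_def b_def)
  have near: "\<bar>u - t\<bar> \<le> e" if "u \<in> {a..b}" for u using that by (auto simp: a_def b_def)
  have "C1_on_interval a b (chart_map c \<circ> \<gamma>)"
  proof (rule C1_offD[OF \<gamma> c])
    show "{a<..<b} \<inter> S = {}"
    proof -
      have "u \<notin> S" if "u \<in> {a<..<b}" for u
      proof -
        have "\<bar>u - t\<bar> \<le> e" using near[of u] that by auto
        then have "u \<in> ball t e2" using e by (auto simp: dist_real_def abs_minus_commute)
        then show ?thesis using e2(2) by blast
      qed
      then show ?thesis by blast
    qed
    show "\<gamma> ` {a..b} \<subseteq> chart_dom c"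
    proof (rule image_subsetI)
      fix u assume u: "u \<in> {a..b}"
      then have "\<bar>u - t\<bar> \<le> e" by (rule near)
      then show "\<gamma> u \<in> chart_dom c" using e1(2)[of u] e ab u by auto
    qed
  qed (use ab in auto)
  then show ?thesis
    using that at_within_relative_nhd[OF ab(1-6)] ab(3,4) unfolding C1_on_interval_def by (metis atLeastAtMost_iff)
qed

lemma velocity_in_tangent_space:
  assumes \<gamma>: "C1_off S T \<gamma>" and t: "t \<in> {0..T} - S" and T: "0 < T"
  shows "velocity \<A> T \<gamma> t \<in> tangent_space \<A> (\<gamma> t)"
proof -
  obtain c where c: "c \<in> \<A>" "\<gamma> t \<in> chart_dom c" by (rule chart_exists)
  obtain d where d: "((chart_map c \<circ> \<gamma>) has_vector_derivative d) (at t within {0..T})"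
    using C1_off_regular[OF \<gamma> t T c] by blast
  have "velocity \<A> T \<gamma> t = tangent_of_coords \<A> c (\<gamma> t) d"
    by (rule velocity_eq[OF c(1)]) (use \<gamma> t T c d in \<open>auto simp: C1_off_def\<close>)
  then show ?thesis using tangent_of_coords_in_tangent_space[OF c] by simp
qed

lemma metric_nonneg: "u \<in> tangent_space \<A> q \<Longrightarrow> g q u u \<ge> 0"
  using chart_exists[of q] metric_eq_coords metric_coords_nonneg by (metis imageI)

lemma speed_nonneg: "C1_off S T \<gamma> \<Longrightarrow> t \<in> {0..T} - S \<Longrightarrow> 0 < T \<Longrightarrow> speed T \<gamma> t \<ge> 0"
  unfolding speed_def metric_norm_def by (intro real_sqrt_ge_zero metric_nonneg velocity_in_tangent_space)

text \<open>Between break points the speed agrees, up to the end points, with a function that is continuous on the closed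
  interval.\<close>

lemma speed_on_chart_interval:
  assumes \<gamma>: "C1_off S T \<gamma>" and c: "c \<in> \<A>" and ab: "0 \<le> a" "a < b" "b \<le> T"
    and S: "{a<..<b} \<inter> S = {}" and dom: "\<gamma> ` {a..b} \<subseteq> chart_dom c"
  obtains f' where "continuous_on {a..b} f'"
    "\<And>t. t \<in> {a..b} \<Longrightarrow> ((chart_map c \<circ> \<gamma>) has_vector_derivative f' t) (at t within {a..b})"
    "\<And>t. t \<in> {a<..<b} \<Longrightarrow> speed T \<gamma> t = sqrt (metric_coords \<A> g c (chart_map c (\<gamma> t)) (f' t) (f' t))"
    "continuous_on {a..b} (\<lambda>t. sqrt (metric_coords \<A> g c (chart_map c (\<gamma> t)) (f' t) (f' t)))"
proof -
  have cont: "continuous_on {0..T} \<gamma>" using \<gamma> by (simp add: C1_off_def)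
  obtain f' where f': "continuous_on {a..b} f'"
    "\<And>t. t \<in> {a..b} \<Longrightarrow> ((chart_map c \<circ> \<gamma>) has_vector_derivative f' t) (at t within {a..b})"
    using C1_offD[OF \<gamma> c ab S dom] unfolding C1_on_interval_def by blast
  have img: "chart_map c (\<gamma> t) \<in> chart_img c" if "t \<in> {a..b}" for t using dom that by blast
  have "continuous_on {a..b} (\<lambda>t. chart_map c (\<gamma> t))"
    by (rule continuous_on_compose2[OF continuous_on_chart_map[OF c] continuous_on_subset[OF cont]]) (use ab dom in auto)
  then have "continuous_on {a..b} (\<lambda>t. metric_coords \<A> g c (chart_map c (\<gamma> t)) i j)" for i j
    by (rule continuous_on_compose2[OF smooth_on_imp_continuous_on[OF smooth_metric_coords[OF c]]]) (use img in auto)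
  then have "continuous_on {a..b} (\<lambda>t. metric_coords \<A> g c (chart_map c (\<gamma> t)) (f' t) (f' t))"
    by (intro continuous_on_bilinear_family[of "{a..b}" "\<lambda>t. metric_coords \<A> g c (chart_map c (\<gamma> t))" f' f'] f' bilinear_metric_coords[OF c] img)
  then have 4: "continuous_on {a..b} (\<lambda>t. sqrt (metric_coords \<A> g c (chart_map c (\<gamma> t)) (f' t) (f' t)))"
    by (rule continuous_on_real_sqrt)
  have 3: "speed T \<gamma> t = sqrt (metric_coords \<A> g c (chart_map c (\<gamma> t)) (f' t) (f' t))" if t: "t \<in> {a<..<b}" for t
  proof (rule speed_eq[OF velocity_eq[OF c cont]])
    have "at t within {a..b} = at t within {0..T}"
      by (rule at_within_relative_nhd) (use ab t in auto)
    then show "((chart_map c \<circ> \<gamma>) has_vector_derivative f' t) (at t within {0..T})"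
      using f'(2)[of t] t by simp
  qed (use ab t dom c in auto)
  show ?thesis by (rule that[OF f' 3 4])
qed

lemma finite_isolating:
  fixes x :: real assumes "finite S" obtains d where "d > 0" "\<And>u. \<bar>u - x\<bar> < d \<Longrightarrow> u \<in> S \<Longrightarrow> u = x"
proof -
  have "open (- (S - {x}))" by (intro open_Compl finite_imp_closed finite_Diff assms)
  then obtain d where d: "d > 0" "ball x d \<subseteq> - (S - {x})" using openE[of "- (S - {x})" x] by blast
  show ?thesis
  proof (rule that[OF d(1)])
    fix u assume "\<bar>u - x\<bar> < d" "u \<in> S"
    then show "u = x" using d(2) by (auto simp: subset_iff dist_real_def abs_minus_commute)
  qed
qed

text \<open>Integrability matters because the integral in \<open>curve_length\<close> would otherwise be \<open>0\<close>
  by convention, and no lower bound for the length could hold.\<close>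

lemma absolutely_integrable_speed:
  assumes \<gamma>: "C1_off S T \<gamma>" and T: "0 < T"
  shows "speed T \<gamma> absolutely_integrable_on {0..T}"
proof -
  have cont: "continuous_on {0..T} \<gamma>" and fin: "finite S" using \<gamma> by (auto simp: C1_off_def)
  define P where "P u v \<longleftrightarrow> (0 \<le> u \<longrightarrow> u \<le> v \<longrightarrow> v \<le> T \<longrightarrow> speed T \<gamma> absolutely_integrable_on {u..v})" for u v
  have piece: "P u v" if dom: "\<gamma> ` {u..v} \<subseteq> chart_dom c" and c: "c \<in> \<A>" and S: "{u<..<v} \<inter> S = {}" for u v c
    unfolding P_def
  proof (intro impI)
    assume uv: "0 \<le> u" "u \<le> v" "v \<le> T"
    show "speed T \<gamma> absolutely_integrable_on {u..v}"
    proof (cases "u = v")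
      case True
      show ?thesis
        by (rule absolutely_integrable_spike[OF absolutely_integrable_continuous_real[OF continuous_on_const[of _ 0]], where S = "{u,v}"])
          (use True in auto)
    next
      case False
      then have "u < v" using uv by simp
      obtain f' where "continuous_on {u..v} f'"
        "\<And>t. t \<in> {u..v} \<Longrightarrow> ((chart_map c \<circ> \<gamma>) has_vector_derivative f' t) (at t within {u..v})"
        and f': "\<And>t. t \<in> {u<..<v} \<Longrightarrow> speed T \<gamma> t = sqrt (metric_coords \<A> g c (chart_map c (\<gamma> t)) (f' t) (f' t))"
        "continuous_on {u..v} (\<lambda>t. sqrt (metric_coords \<A> g c (chart_map c (\<gamma> t)) (f' t) (f' t)))"
        by (rule speed_on_chart_interval[OF \<gamma> c uv(1) \<open>u < v\<close> uv(3) S dom]) (rule that)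
      show ?thesis
        by (rule absolutely_integrable_spike[OF absolutely_integrable_continuous_real[OF f'(2)], where S = "{u,v}"]) (use f'(1) in auto)
    qed
  qed
  have "P 0 T"
  proof (rule Bolzano)
    fix x y z assume P: "P x y" "P y z" "x \<le> y" "y \<le> z"
    show "P x z"
      unfolding P_def
    proof (intro impI)
      assume le: "0 \<le> x" "x \<le> z" "z \<le> T"
      have "speed T \<gamma> absolutely_integrable_on {x..y} \<union> {y..z}"
        using P le unfolding P_def by (intro absolutely_integrable_Un) auto
      then show "speed T \<gamma> absolutely_integrable_on {x..z}"
        using P ivl_disj_un_two_touch(4)[of x y z] by simp
    qed
  next
    fix x assume x: "0 \<le> x" "x \<le> T"
    obtain c where c: "c \<in> \<A>" "\<gamma> x \<in> chart_dom c" by (rule chart_exists)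
    obtain d1 where d1: "d1 > 0" "\<And>u. u \<in> {0..T} \<Longrightarrow> \<bar>u - x\<bar> < d1 \<Longrightarrow> \<gamma> u \<in> chart_dom c"
      using curve_stays_in_chart[OF cont _ c(2) open_chart_dom[OF c(1)]] x by auto
    obtain d2 where d2: "d2 > 0" "\<And>u. \<bar>u - x\<bar> < d2 \<Longrightarrow> u \<in> S \<Longrightarrow> u = x" using finite_isolating[OF fin] by metis
    have "P u v" if uv: "u \<le> x" "x \<le> v" "v - u < min d1 d2" for u v
      unfolding P_def
    proof (intro impI)
      assume le: "0 \<le> u" "u \<le> v" "v \<le> T"
      have sub: "\<gamma> ` {u..x} \<subseteq> chart_dom c" "\<gamma> ` {x..v} \<subseteq> chart_dom c"
        using d1(2) uv le by auto
      have "{u<..<x} \<inter> S = {}" "{x<..<v} \<inter> S = {}"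
        using d2(2) uv by force+
      then have "P u x" "P x v" using piece sub c by auto
      then have "speed T \<gamma> absolutely_integrable_on {u..x} \<union> {x..v}"
        using uv le x unfolding P_def by (intro absolutely_integrable_Un) auto
      then show "speed T \<gamma> absolutely_integrable_on {u..v}"
        using uv ivl_disj_un_two_touch(4)[of u x v] by simp
    qed
    then show "\<exists>d>0. \<forall>a b. a \<le> x \<and> x \<le> b \<and> b - a < d \<longrightarrow> P a b"
      using d1(1) d2(1) by (intro exI[of _ "min d1 d2"]) auto
  qed (use T in auto)
  then show ?thesis using T by (simp add: P_def)
qed

lemma curve_length_has_integral:
  assumes "C1_off S T \<gamma>" "0 < T"
  shows "(speed T \<gamma> has_integral curve_length \<A> g T \<gamma>) {0..T}"
  using absolutely_integrable_speed[OF assms]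
  by (simp add: curve_length_def set_lebesgue_integral_eq_integral(2) integrable_integral set_lebesgue_integral_eq_integral(1)
      flip: speed_def)

lemma curve_length_nonneg:
  assumes "C1_off S T \<gamma>" "0 < T" shows "curve_length \<A> g T \<gamma> \<ge> 0"
  by (rule has_integral_nonneg_off_finite[OF curve_length_has_integral[OF assms], of S])
    (use assms speed_nonneg in \<open>auto simp: C1_off_def\<close>)

lemma C1_on_interval_reparam:
  assumes \<gamma>: "C1_off S T \<gamma>" and m: "m \<noteq> 0" and st: "s < t"
    and \<delta>: "\<And>u. u \<in> {s..t} \<Longrightarrow> \<delta> u = \<gamma> (m * u + k)" "\<And>u. u \<in> {s..t} \<Longrightarrow> m * u + k \<in> {0..T}"
    and S: "\<And>u. u \<in> {s<..<t} \<Longrightarrow> m * u + k \<notin> S" and c: "c \<in> \<A>" and dom: "\<delta> ` {s..t} \<subseteq> chart_dom c"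
  shows "C1_on_interval s t (chart_map c \<circ> \<delta>)"
proof -
  define p q where "p = (if m > 0 then m * s + k else m * t + k)" and "q = (if m > 0 then m * t + k else m * s + k)"
  have im: "(\<lambda>u. m * u + k) ` {s..t} = {p..q}"
    using m st by (auto simp: image_affinity_atLeastAtMost p_def q_def)
  have pq: "p < q" using m st by (auto simp: p_def q_def)
  have inv: "\<exists>u\<in>{s<..<t}. x = m * u + k" if "x \<in> {p<..<q}" for x
    using m that by (intro bexI[of _ "(x - k) / m"]) (auto simp: p_def q_def field_simps split: if_splits)
  have "C1_on_interval p q (chart_map c \<circ> \<gamma>)"
  proof (rule C1_offD[OF \<gamma> c _ pq])
    have "p \<in> {p..q}" "q \<in> {p..q}" using pq by auto
    then show "0 \<le> p" "q \<le> T" using \<delta>(2) im[symmetric] by (auto simp: image_iff)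
    show "{p<..<q} \<inter> S = {}" using S inv by blast
    show "\<gamma> ` {p..q} \<subseteq> chart_dom c"
      using dom \<delta>(1) unfolding im[symmetric] by (auto simp: image_subset_iff)
  qed
  then show ?thesis
    by (rule C1_on_interval_affine[of p q _ m k]) (use im \<delta>(1) in auto)
qed

text \<open>Affine changes of the parameter, with factors \<open>2\<close>, \<open>-1\<close> and \<open>t - s\<close>,
  suffice to join, reverse and restrict curves. The formula can only be expected away from break points and
  the ends of the interval.\<close>

lemma speed_reparam:
  assumes \<gamma>: "C1_off S T \<gamma>" and T: "0 < T" and \<delta>: "continuous_on {0..1} \<delta>" and m: "m \<noteq> 0"
    and st: "0 \<le> s" "t \<le> 1" and eq: "\<And>u. u \<in> {s<..<t} \<Longrightarrow> \<delta> u = \<gamma> (m * u + k)"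
    and im: "\<And>u. u \<in> {s<..<t} \<Longrightarrow> m * u + k \<in> {0<..<T}" and u: "u \<in> {s<..<t}" "m * u + k \<notin> S"
  shows "speed 1 \<delta> u = \<bar>m\<bar> * speed T \<gamma> (m * u + k)"
proof -
  let ?r = "m * u + k"
  have cont: "continuous_on {0..T} \<gamma>" using \<gamma> by (simp add: C1_off_def)
  have r: "?r \<in> {0<..<T}" using im u by blast
  have \<delta>u: "\<delta> u = \<gamma> ?r" using eq u by blast
  obtain c where c: "c \<in> \<A>" "\<gamma> ?r \<in> chart_dom c" by (rule chart_exists)
  obtain d where d: "((chart_map c \<circ> \<gamma>) has_vector_derivative d) (at ?r within {0..T})"
    using C1_off_regular[OF \<gamma> _ T c] r u(2) by (metis DiffI atLeastAtMost_iff greaterThanLessThan_iff less_imp_le)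
  have v\<gamma>: "velocity \<A> T \<gamma> ?r = tangent_of_coords \<A> c (\<gamma> ?r) d"
    by (rule velocity_eq[OF c(1) cont _ T c(2) d]) (use r in auto)
  have "((\<lambda>u. m * u + k) has_vector_derivative m) (at u)"
    by (auto intro!: derivative_eq_intros simp: has_real_derivative_iff_has_vector_derivative[symmetric])
  moreover have "((chart_map c \<circ> \<gamma>) has_vector_derivative d) (at ?r)"
    using d at_within_Icc_at[of 0 ?r T] r by simp
  ultimately have "((chart_map c \<circ> \<gamma>) \<circ> (\<lambda>u. m * u + k) has_vector_derivative m *\<^sub>R d) (at u)"
    by (rule vector_diff_chain_at)
  then have "((chart_map c \<circ> \<delta>) has_vector_derivative m *\<^sub>R d) (at u)"
    by (rule has_vector_derivative_transform_within_open[where S = "{s<..<t}"]) (use u eq in auto)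
  then have d\<delta>: "((chart_map c \<circ> \<delta>) has_vector_derivative m *\<^sub>R d) (at u within {0..1})"
    by (rule has_vector_derivative_at_within)
  have v\<delta>: "velocity \<A> 1 \<delta> u = tangent_of_coords \<A> c (\<delta> u) (m *\<^sub>R d)"
    by (rule velocity_eq[OF c(1) \<delta> _ _ _ d\<delta>]) (use st u \<delta>u c in auto)
  have b: "bilinear (metric_coords \<A> g c (chart_map c (\<gamma> ?r)))"
    using c by (intro bilinear_metric_coords) auto
  have "speed 1 \<delta> u = sqrt (metric_coords \<A> g c (chart_map c (\<delta> u)) (m *\<^sub>R d) (m *\<^sub>R d))"
    by (rule speed_eq[OF v\<delta> c(1)]) (use c \<delta>u in auto)
  also have "\<dots> = sqrt (m\<^sup>2 * metric_coords \<A> g c (chart_map c (\<gamma> ?r)) d d)"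
    unfolding \<delta>u by (simp add: bilinear_lmul[OF b] bilinear_rmul[OF b] power2_eq_square mult.assoc)
  also have "\<dots> = \<bar>m\<bar> * speed T \<gamma> ?r"
    by (simp add: real_sqrt_mult speed_eq[OF v\<gamma> c])
  finally show ?thesis .
qed

lemma speed_reparam_has_integral:
  assumes \<gamma>: "C1_off S 1 \<gamma>" and \<delta>: "continuous_on {0..1} \<delta>" and m: "m \<noteq> 0"
    and st: "0 \<le> s" "t \<le> 1" and eq: "\<And>u. u \<in> {s<..<t} \<Longrightarrow> \<delta> u = \<gamma> (m * u + k)"
    and im: "(\<lambda>u. m * u + k) ` {s..t} = {0..1}"
  shows "(speed 1 \<delta> has_integral curve_length \<A> g 1 \<gamma>) {s..t}"
proof -
  have I: "((\<lambda>u. \<bar>m\<bar> * speed 1 \<gamma> (m * u + k)) has_integral curve_length \<A> g 1 \<gamma>) {s..t}"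
    by (rule has_integral_affine_real[OF _ m]) (use curve_length_has_integral[OF \<gamma>] im in simp)
  have inner: "m * u + k \<in> {0<..<1}" if u: "u \<in> {s<..<t}" for u
  proof -
    have "s \<in> {s..t}" "t \<in> {s..t}" using u by auto
    then have "m * s + k \<in> {0..1}" "m * t + k \<in> {0..1}" using im by blast+
    moreover have "m * s < m * u \<and> m * u < m * t \<or> m * t < m * u \<and> m * u < m * s"
      using m u by (auto simp: mult_less_cancel_left neq_iff)
    ultimately show ?thesis by auto
  qed
  let ?S = "{s, t} \<union> (\<lambda>x. (x - k) / m) ` S"
  show ?thesis
  proof (rule has_integral_spike_finite[OF _ _ I, of ?S])
    show "finite ?S" using \<gamma> by (simp add: C1_off_def)
    fix u assume u: "u \<in> {s..t} - ?S"
    then have "m * u + k \<notin> S" using m by (auto simp: image_iff)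
    then show "speed 1 \<delta> u = \<bar>m\<bar> * speed 1 \<gamma> (m * u + k)"
      using u by (intro speed_reparam[OF \<gamma> _ \<delta> m st eq inner]) auto
  qed
qed

lemma C1_off_reversepath:
  assumes \<gamma>: "C1_off S 1 \<gamma>"
  shows "C1_off ((\<lambda>x. 1 - x) ` S) 1 (reversepath \<gamma>)" "curve_length \<A> g 1 (reversepath \<gamma>) = curve_length \<A> g 1 \<gamma>"
proof -
  have cont: "continuous_on {0..1} (reversepath \<gamma>)"
    using \<gamma> path_reversepath[of \<gamma>] by (simp add: C1_off_def path_def)
  have eq: "reversepath \<gamma> u = \<gamma> (-1 * u + 1)" for u by (simp add: reversepath_def)
  show rev: "C1_off ((\<lambda>x. 1 - x) ` S) 1 (reversepath \<gamma>)"
    unfolding C1_off_def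
  proof (intro conjI ballI allI impI cont)
    show "finite ((\<lambda>x. 1 - x) ` S)" using \<gamma> by (simp add: C1_off_def)
    fix c s t assume c: "c \<in> \<A>" and st: "0 \<le> s \<and> s < t \<and> t \<le> 1 \<and> {s<..<t} \<inter> (\<lambda>x. 1 - x) ` S = {} \<and> reversepath \<gamma> ` {s..t} \<subseteq> chart_dom c"
    show "C1_on_interval s t (chart_map c \<circ> reversepath \<gamma>)"
    proof (rule C1_on_interval_reparam[OF \<gamma> _ _ eq _ _ c])
      show "-1 * u + 1 \<notin> S" if "u \<in> {s<..<t}" for u
      proof
        assume "-1 * u + 1 \<in> S"
        then have "u \<in> (\<lambda>x. 1 - x) ` S" by (auto simp: image_iff intro!: bexI[of _ "1 - u"])
        then show False using st that by blast
      qed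
    qed (use st in auto)
  qed
  have "(speed 1 (reversepath \<gamma>) has_integral curve_length \<A> g 1 \<gamma>) {0..1}"
  proof (rule speed_reparam_has_integral[OF \<gamma> cont _ _ _ eq])
    have "(\<lambda>u::real. - u + 1) ` {0..1} = {0..1}"
      using image_affinity_atLeastAtMost[of "-1::real" 1 0 1] by simp
    then show "(\<lambda>u::real. -1 * u + 1) ` {0..1} = {0..1}" by simp
  qed auto
  then show "curve_length \<A> g 1 (reversepath \<gamma>) = curve_length \<A> g 1 \<gamma>"
    using curve_length_has_integral[OF rev] has_integral_unique by auto
qed

lemma C1_off_joinpaths:
  assumes \<gamma>: "C1_off S 1 \<gamma>" and \<eta>: "C1_off R 1 \<eta>" and meet: "\<gamma> 1 = \<eta> 0"
  shows "\<exists>S. C1_off S 1 (\<gamma> +++ \<eta>)" "curve_length \<A> g 1 (\<gamma> +++ \<eta>) = curve_length \<A> g 1 \<gamma> + curve_length \<A> g 1 \<eta>"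
proof -
  let ?S = "insert (1/2) ((\<lambda>x. x / 2) ` S \<union> (\<lambda>x. (x + 1) / 2) ` R)"
  have cont: "continuous_on {0..1} (\<gamma> +++ \<eta>)"
    using \<gamma> \<eta> meet path_join_imp[of \<gamma> \<eta>] by (simp add: C1_off_def path_def pathfinish_def pathstart_def)
  have eq1: "(\<gamma> +++ \<eta>) u = \<gamma> (2 * u + 0)" if "u \<le> 1/2" for u using that by (simp add: joinpaths_def)
  have eq2: "(\<gamma> +++ \<eta>) u = \<eta> (2 * u + (-1))" if "1/2 \<le> u" for u
  proof (cases "u = 1/2")
    case True
    show ?thesis unfolding True joinpaths_def using meet by simp
  qed (use that in \<open>auto simp: joinpaths_def\<close>)
  have join: "C1_off ?S 1 (\<gamma> +++ \<eta>)"
    unfolding C1_off_def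
  proof (intro conjI ballI allI impI cont)
    show "finite ?S" using \<gamma> \<eta> by (simp add: C1_off_def)
    fix c s t assume c: "c \<in> \<A>" and st: "0 \<le> s \<and> s < t \<and> t \<le> 1 \<and> {s<..<t} \<inter> ?S = {} \<and> (\<gamma> +++ \<eta>) ` {s..t} \<subseteq> chart_dom c"
    then have "1/2 \<notin> {s<..<t}" by blast
    then consider "t \<le> 1/2" | "1/2 \<le> s" by fastforce
    then show "C1_on_interval s t (chart_map c \<circ> (\<gamma> +++ \<eta>))"
    proof cases
      case 1
      show ?thesis
      proof (rule C1_on_interval_reparam[OF \<gamma> _ _ eq1 _ _ c])
        show "2 * u + 0 \<notin> S" if "u \<in> {s<..<t}" for u
        proof
          assume "2 * u + 0 \<in> S"
          then have "u \<in> ?S" by (intro insertI2 UnI1 image_eqI[of _ _ "2 * u"]) auto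
          then show False using st that by blast
        qed
      qed (use st 1 in auto)
    next
      case 2
      show ?thesis
      proof (rule C1_on_interval_reparam[OF \<eta> _ _ eq2 _ _ c])
        show "2 * u + (-1) \<notin> R" if "u \<in> {s<..<t}" for u
        proof
          assume "2 * u + (-1) \<in> R"
          then have "u \<in> ?S" by (intro insertI2 UnI2 image_eqI[of _ _ "2 * u + (-1)"]) auto
          then show False using st that by blast
        qed
      qed (use st 2 in auto)
    qed
  qed
  then show "\<exists>S. C1_off S 1 (\<gamma> +++ \<eta>)" by blast
  have "(speed 1 (\<gamma> +++ \<eta>) has_integral curve_length \<A> g 1 \<gamma>) {0..1/2}"
    by (rule speed_reparam_has_integral[OF \<gamma> cont _ _ _ eq1]) (auto simp: image_affinity_atLeastAtMost)
  moreover have "(speed 1 (\<gamma> +++ \<eta>) has_integral curve_length \<A> g 1 \<eta>) {1/2..1}"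
    by (rule speed_reparam_has_integral[OF \<eta> cont _ _ _ eq2])
      (use image_affinity_atLeastAtMost[of "2::real" "-1" "1/2" 1] in auto)
  ultimately have "(speed 1 (\<gamma> +++ \<eta>) has_integral (curve_length \<A> g 1 \<gamma> + curve_length \<A> g 1 \<eta>)) {0..1}"
    by (intro has_integral_combine[of 0 "1/2" 1]) auto
  then show "curve_length \<A> g 1 (\<gamma> +++ \<eta>) = curve_length \<A> g 1 \<gamma> + curve_length \<A> g 1 \<eta>"
    using curve_length_has_integral[OF join] has_integral_unique by auto
qed

end

section \<open>The Riemannian distance\<close>

context riemannian
begin

text \<open>The straight segment in the chart; it is \<open>C\<^sup>1\<close> in every other chart because the coordinate
  changes are smooth.\<close>

lemma chart_segment:
  assumes c: "c \<in> \<A>" and x: "x \<in> chart_dom c" and ball: "ball (chart_map c x) r \<subseteq> chart_img c"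
    and y: "y \<in> chart_dom c" "chart_map c y \<in> ball (chart_map c x) r"
  shows "\<exists>\<sigma>. C1_off {} 1 \<sigma> \<and> \<sigma> 0 = x \<and> \<sigma> 1 = y"
proof -
  let ?x = "chart_map c x" and ?v = "chart_map c y - chart_map c x"
  define l where "l u = ?x + u *\<^sub>R ?v" for u :: real
  define \<sigma> where "\<sigma> u = chart_inv c (l u)" for u
  have r: "r > 0" using y(2) by (metis ball_eq_empty empty_iff not_le)
  have l_img: "l u \<in> chart_img c" if "u \<in> {0..1}" for u
  proof -
    have "norm (u *\<^sub>R ?v) \<le> norm ?v" using that by (simp add: mult_left_le_one_le)
    then have "l u \<in> ball ?x r" using y(2) by (simp add: l_def dist_norm norm_minus_commute)
    then show ?thesis using ball by blast
  qed
  have l_cont: "continuous_on S l" for S unfolding l_def by (intro continuous_intros)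
  have cont: "continuous_on {0..1} \<sigma>"
    unfolding \<sigma>_def by (rule continuous_on_compose2[OF continuous_on_chart_inv[OF c] l_cont]) (use l_img in auto)
  have "C1_off {} 1 \<sigma>"
    unfolding C1_off_def
  proof (intro conjI ballI allI impI cont)
    fix c' s t assume c': "c' \<in> \<A>" and st: "0 \<le> s \<and> s < t \<and> t \<le> 1 \<and> {s<..<t} \<inter> {} = {} \<and> \<sigma> ` {s..t} \<subseteq> chart_dom c'"
    let ?O = "chart_map c ` (chart_dom c \<inter> chart_dom c')"
    have lO: "l u \<in> ?O" if u: "u \<in> {s..t}" for u
    proof -
      have "l u \<in> chart_img c" using l_img u st by auto
      moreover have "\<sigma> u \<in> chart_dom c'" using u st by blast
      ultimately show ?thesis
        unfolding \<sigma>_def using chart_map_inv[OF c] chart_inv_dom[OF c] by (metis IntI imageI)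
    qed
    have "continuous_on {s..t} (\<lambda>u. frechet_derivative (transition c c') (at (l u)) ?v)"
      by (rule continuous_on_compose2[OF smooth_on_imp_continuous_on[OF smooth_on_derivative[OF smooth_transition[OF c c']]] l_cont])
        (use lO in auto)
    moreover have "((chart_map c' \<circ> \<sigma>) has_vector_derivative frechet_derivative (transition c c') (at (l u)) ?v) (at u within {s..t})"
      if u: "u \<in> {s..t}" for u
    proof -
      have T: "(transition c c' has_derivative frechet_derivative (transition c c') (at (l u))) (at (l u))"
        by (rule smooth_on_has_derivative[OF smooth_transition[OF c c'] lO[OF u]])
      have "(l has_derivative (\<lambda>h. h *\<^sub>R ?v)) (at u within {s..t})"
        unfolding l_def by (auto intro!: derivative_eq_intros)
      from has_derivative_compose[OF this T]
      have "((chart_map c' \<circ> \<sigma>) has_derivative (\<lambda>h. frechet_derivative (transition c c') (at (l u)) (h *\<^sub>R ?v))) (at u within {s..t})"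
        by (simp add: \<sigma>_def o_def)
      then show ?thesis
        unfolding has_vector_derivative_def by (simp only: linear_cmul[OF has_derivative_linear[OF T]])
    qed
    ultimately show "C1_on_interval s t (chart_map c' \<circ> \<sigma>)"
      unfolding C1_on_interval_def by blast
  qed simp
  moreover have "\<sigma> 0 = x" "\<sigma> 1 = y" using chart_inv_map[OF c] x y by (auto simp: \<sigma>_def l_def)
  ultimately show ?thesis by blast
qed

definition C1_connected :: "'m \<Rightarrow> 'm \<Rightarrow> bool" where
  "C1_connected p q \<longleftrightarrow> (\<exists>\<gamma> S. C1_off S 1 \<gamma> \<and> \<gamma> 0 = p \<and> \<gamma> 1 = q)"

lemma C1_connected_trans: "C1_connected p q \<Longrightarrow> C1_connected q r \<Longrightarrow> C1_connected p r"
  unfolding C1_connected_def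
proof (elim exE conjE)
  fix \<gamma> S \<eta> R assume "C1_off S 1 \<gamma>" "\<gamma> 0 = p" "\<gamma> 1 = q" "C1_off R 1 \<eta>" "\<eta> 0 = q" "\<eta> 1 = r"
  then show "\<exists>\<gamma> S. C1_off S 1 \<gamma> \<and> \<gamma> 0 = p \<and> \<gamma> 1 = r"
    using C1_off_joinpaths(1)[of S \<gamma> R \<eta>] by (intro exI[of _ "\<gamma> +++ \<eta>"]) (auto simp: joinpaths_def)
qed

lemma C1_connected_sym: "C1_connected p q \<Longrightarrow> C1_connected q p"
  unfolding C1_connected_def
proof (elim exE conjE)
  fix \<gamma> S assume "C1_off S 1 \<gamma>" "\<gamma> 0 = p" "\<gamma> 1 = q"
  then show "\<exists>\<gamma> S. C1_off S 1 \<gamma> \<and> \<gamma> 0 = q \<and> \<gamma> 1 = p"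
    using C1_off_reversepath(1)[of S \<gamma>] by (intro exI[of _ "reversepath \<gamma>"]) (auto simp: reversepath_def)
qed

lemma C1_connected_nhd: "\<exists>U. open U \<and> x \<in> U \<and> (\<forall>y\<in>U. C1_connected x y)"
proof -
  obtain c where c: "c \<in> \<A>" "x \<in> chart_dom c" by (rule chart_exists)
  have "chart_map c x \<in> chart_img c" using c by auto
  then obtain r where r: "r > 0" "ball (chart_map c x) r \<subseteq> chart_img c"
    using open_chart_img[OF c(1)] openE by blast
  let ?U = "chart_dom c \<inter> chart_map c -` ball (chart_map c x) r"
  have "open ?U"
    by (rule continuous_open_preimage[OF continuous_on_chart_map open_chart_dom]) (use c in auto)
  moreover have "C1_connected x y" if "y \<in> ?U" for y
    using chart_segment[OF c r(2), of y] that by (auto simp: C1_connected_def)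
  ultimately show ?thesis using c r by (intro exI[of _ ?U]) auto
qed

text \<open>The points that can be reached from \<open>p\<close> form an open and closed set.\<close>

lemma C1_connected_all:
  assumes "connected (UNIV :: 'm set)" shows "C1_connected p q"
proof -
  let ?U = "{q. C1_connected p q}"
  have "open ?U"
  proof (subst open_subopen, intro ballI)
    fix x assume x: "x \<in> ?U"
    obtain U where "open U" "x \<in> U" "\<forall>y\<in>U. C1_connected x y" using C1_connected_nhd by blast
    then show "\<exists>T. open T \<and> x \<in> T \<and> T \<subseteq> ?U" using x C1_connected_trans by (intro exI[of _ U]) auto
  qed
  moreover have "open (- ?U)"
  proof (subst open_subopen, intro ballI)
    fix x assume x: "x \<in> - ?U"
    obtain U where "open U" "x \<in> U" "\<forall>y\<in>U. C1_connected x y" using C1_connected_nhd by blast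
    then show "\<exists>T. open T \<and> x \<in> T \<and> T \<subseteq> - ?U" using x C1_connected_trans C1_connected_sym by (intro exI[of _ U]) blast
  qed
  moreover have "p \<in> ?U" using C1_connected_nhd[of p] by blast
  ultimately have "?U = UNIV"
    using assms unfolding connected_clopen by (auto simp: closed_def)
  then show ?thesis by blast
qed

text \<open>Up to the first time \<open>t1\<close> at which the curve leaves the coordinate ball, its speed is at least
  \<open>sqrt m\<close> times the Euclidean speed in the chart, and the Euclidean length of that piece is at
  least the radius.\<close>

lemma curve_length_ge_leaving_ball:
  assumes c: "c \<in> \<A>" and p: "p \<in> chart_dom c" and \<rho>: "\<rho> > 0" and ball: "cball (chart_map c p) \<rho> \<subseteq> chart_img c"
    and m: "m > 0" "\<And>x a. x \<in> cball (chart_map c p) \<rho> \<Longrightarrow> m * (norm a)\<^sup>2 \<le> metric_coords \<A> g c x a a"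
    and \<gamma>: "C1_off S 1 \<gamma>" "\<gamma> 0 = p" and out: "\<gamma> 1 \<notin> chart_inv c ` ball (chart_map c p) \<rho>"
  shows "curve_length \<A> g 1 \<gamma> \<ge> sqrt m * \<rho>"
proof -
  let ?x = "chart_map c p" and ?W = "chart_inv c ` ball (chart_map c p) \<rho>" and ?K = "chart_inv c ` cball (chart_map c p) \<rho>"
  have cont: "continuous_on {0..1} \<gamma>" and S: "finite S" using \<gamma> by (auto simp: C1_off_def)
  have W_eq: "?W = chart_dom c \<inter> chart_map c -` ball ?x \<rho>"
  proof (intro equalityI subsetI)
    fix q assume "q \<in> ?W"
    then obtain x where x: "x \<in> ball ?x \<rho>" "q = chart_inv c x" by blast
    then have "x \<in> chart_img c" using ball ball_subset_cball by blast
    then show "q \<in> chart_dom c \<inter> chart_map c -` ball ?x \<rho>"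
      using x chart_map_inv[OF c] chart_inv_dom[OF c] by simp
  next
    fix q assume "q \<in> chart_dom c \<inter> chart_map c -` ball ?x \<rho>"
    then show "q \<in> ?W" using chart_inv_map[OF c] by (intro image_eqI[of _ _ "chart_map c q"]) auto
  qed
  have W: "open ?W"
    unfolding W_eq by (rule continuous_open_preimage[OF continuous_on_chart_map open_chart_dom]) (use c in auto)
  have "compact ?K"
    by (intro compact_continuous_image continuous_on_subset[OF continuous_on_chart_inv[OF c] ball]) simp
  then have K: "closed ?K" by (rule compact_imp_closed)
  have WK: "?W \<subseteq> ?K" by (intro image_mono) auto
  let ?Z = "{t \<in> {0..1}. \<gamma> t \<in> - ?W}"
  have Z: "closed ?Z"
  proof -
    have "?Z = {0..1} \<inter> \<gamma> -` (- ?W)" by auto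
    then show ?thesis
      using continuous_closed_preimage[OF cont closed_atLeastAtMost closed_Compl[OF W]] by (simp only:)
  qed
  have Zne: "?Z \<noteq> {}" using out by force
  have Zbd: "bdd_below ?Z" by (rule bdd_belowI[of _ 0]) auto
  define t1 where "t1 = Inf ?Z"
  have t1: "t1 \<in> ?Z" unfolding t1_def by (rule closed_contains_Inf[OF Zne Zbd Z])
  have before: "\<gamma> t \<in> ?W" if "0 \<le> t" "t < t1" for t
  proof (rule ccontr)
    assume "\<gamma> t \<notin> ?W"
    then have "t \<in> ?Z" using that t1 by auto
    then have "t1 \<le> t" unfolding t1_def by (rule cInf_lower[OF _ Zbd])
    then show False using that by simp
  qed
  have "p \<in> ?W" using p \<rho> unfolding W_eq by simp
  then have t1pos: "0 < t1" using t1 \<gamma>(2) by (cases "t1 = 0") auto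
  have "\<gamma> ` {0..<t1} \<subseteq> ?K" using before WK by auto
  moreover have "closure {0..<t1} = {0..t1}" using t1pos by simp
  moreover have "continuous_on {0..t1} \<gamma>" using cont t1 by (auto intro: continuous_on_subset)
  ultimately have in_K: "\<gamma> ` {0..t1} \<subseteq> ?K"
    using image_closure_subset[of "{0..<t1}" \<gamma> ?K] K by simp
  have "?K \<subseteq> chart_dom c" by (rule image_subsetI) (rule chart_inv_dom[OF c subsetD[OF ball]])
  with in_K have dom: "\<gamma> ` {0..t1} \<subseteq> chart_dom c" by (rule order_trans)
  have in_cball: "chart_map c (\<gamma> t) \<in> cball ?x \<rho>" if t: "t \<in> {0..t1}" for t
  proof -
    have "\<gamma> t \<in> ?K" using in_K t by blast
    then obtain x where x: "x \<in> cball ?x \<rho>" "\<gamma> t = chart_inv c x" by blast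
    then show ?thesis using chart_map_inv[OF c subsetD[OF ball x(1)]] by simp
  qed
  have exit: "norm (chart_map c (\<gamma> t1) - ?x) \<ge> \<rho>"
  proof (rule ccontr)
    assume "\<not> ?thesis"
    then have "\<gamma> t1 \<in> ?W" unfolding W_eq using dom t1pos by (auto simp: dist_norm norm_minus_commute)
    then show False using t1 by simp
  qed
  define f where "f = chart_map c \<circ> \<gamma>"
  have fc: "continuous_on {0..t1} f"
    unfolding f_def by (intro continuous_on_compose \<open>continuous_on {0..t1} \<gamma>\<close> continuous_on_subset[OF continuous_on_chart_map[OF c] dom])
  define f' where "f' t = vector_derivative f (at t within {0..1})" for t
  have t1le: "t1 \<le> 1" using t1 by simp
  have der: "(f has_vector_derivative f' t) (at t within {0..1})" if t: "t \<in> {0..t1} - S" for t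
  proof -
    have t': "t \<in> {0..1} - S" "\<gamma> t \<in> chart_dom c" using t t1le dom by auto
    obtain d where "(f has_vector_derivative d) (at t within {0..1})"
      unfolding f_def by (rule C1_off_regular[OF \<gamma>(1) t'(1) zero_less_one c t'(2)])
    then show ?thesis
      unfolding f'_def using vector_derivative_within_cbox[of 0 1 t f d] t' by (simp add: cbox_interval)
  qed
  have ftc: "(f' has_integral (f t1 - f 0)) {0..t1}"
  proof (rule fundamental_theorem_of_calculus_interior_strong[OF S _ _ fc])
    fix t assume "t \<in> {0<..<t1} - S"
    then show "(f has_vector_derivative f' t) (at t)"
      using der[of t] at_within_Icc_at[of 0 t 1] t1le by simp
  qed (use t1pos in simp)
  have speed_ge: "sqrt m * norm (f' t) \<le> speed 1 \<gamma> t" if t: "t \<in> {0..t1} - S" for t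
  proof -
    have v: "velocity \<A> 1 \<gamma> t = tangent_of_coords \<A> c (\<gamma> t) (f' t)"
      by (rule velocity_eq[OF c cont]) (use t dom der[OF t] t1le in \<open>auto simp: f_def\<close>)
    have "speed 1 \<gamma> t = sqrt (metric_coords \<A> g c (chart_map c (\<gamma> t)) (f' t) (f' t))"
      by (rule speed_eq[OF v c]) (use t dom in auto)
    moreover have "sqrt (m * (norm (f' t))\<^sup>2) \<le> sqrt (metric_coords \<A> g c (chart_map c (\<gamma> t)) (f' t) (f' t))"
      using m(2)[OF in_cball[of t]] t by simp
    ultimately show ?thesis by (simp add: real_sqrt_mult)
  qed
  have L: "(speed 1 \<gamma> has_integral curve_length \<A> g 1 \<gamma>) {0..1}" by (rule curve_length_has_integral[OF \<gamma>(1)]) simp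
  have Li: "speed 1 \<gamma> integrable_on {0..t1}" "speed 1 \<gamma> integrable_on {t1..1}"
    using L t1pos t1le by (auto intro: integrable_on_subinterval[where S = "{0..1}"])
  let ?f = "\<lambda>t. if t \<in> S then 0 else f' t" and ?s = "\<lambda>t. if t \<in> S then 0 else speed 1 \<gamma> t / sqrt m"
  have 1: "(?f has_integral (f t1 - f 0)) {0..t1}"
    by (rule has_integral_spike_finite[OF S _ ftc]) auto
  have "((\<lambda>t. speed 1 \<gamma> t / sqrt m) has_integral (integral {0..t1} (speed 1 \<gamma>) / sqrt m)) {0..t1}"
    by (rule has_integral_divide[OF integrable_integral[OF Li(1)]])
  then have 2: "(?s has_integral (integral {0..t1} (speed 1 \<gamma>) / sqrt m)) {0..t1}"
    by (rule has_integral_spike_finite[OF S, rotated]) auto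
  have "norm (integral {0..t1} ?f) \<le> integral {0..t1} ?s"
  proof (rule integral_norm_bound_integral)
    show "norm (?f t) \<le> ?s t" if "t \<in> {0..t1}" for t
      using speed_ge[of t] that m(1) by (auto simp: pos_le_divide_eq mult.commute)
  qed (use 1 2 in auto)
  then have "sqrt m * norm (f t1 - f 0) \<le> integral {0..t1} (speed 1 \<gamma>)"
    using m(1) unfolding integral_unique[OF 1] integral_unique[OF 2] by (simp add: pos_le_divide_eq mult.commute)
  moreover have "sqrt m * \<rho> \<le> sqrt m * norm (f t1 - f 0)"
    using exit m(1) \<gamma>(2) by (simp add: f_def)
  moreover have "integral {t1..1} (speed 1 \<gamma>) \<ge> 0"
    by (rule has_integral_nonneg_off_finite[OF integrable_integral[OF Li(2)] S])
      (use speed_nonneg[OF \<gamma>(1)] t1pos in auto)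
  moreover have "integral {0..t1} (speed 1 \<gamma>) + integral {t1..1} (speed 1 \<gamma>) = curve_length \<A> g 1 \<gamma>"
    using Henstock_Kurzweil_Integration.integral_combine[of 0 t1 1 "speed 1 \<gamma>"] L t1pos t1le by (auto simp: integral_unique)
  ultimately show ?thesis by linarith
qed

abbreviation d :: "'m \<Rightarrow> 'm \<Rightarrow> real" where "d \<equiv> riemannian_dist \<A> g"

lemma riemannian_dist_eq:
  "d p q = Inf {curve_length \<A> g 1 \<gamma> |\<gamma>. (\<exists>S. C1_off S 1 \<gamma>) \<and> \<gamma> 0 = p \<and> \<gamma> 1 = q}"
  by (simp add: riemannian_dist_def piecewise_C1_curve_iff)

lemma riemannian_dist_le:
  assumes "C1_off S 1 \<gamma>" shows "d (\<gamma> 0) (\<gamma> 1) \<le> curve_length \<A> g 1 \<gamma>"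
  unfolding riemannian_dist_eq
  by (rule cInf_lower) (use assms curve_length_nonneg in \<open>auto intro!: bdd_belowI[of _ 0]\<close>)

text \<open>The hypothesis that \<open>p\<close> and \<open>q\<close> can be joined is essential: the infimum of the empty
  set is an unspecified real number.\<close>

lemma riemannian_dist_geI:
  assumes "C1_connected p q" "\<And>\<gamma> S. C1_off S 1 \<gamma> \<Longrightarrow> \<gamma> 0 = p \<Longrightarrow> \<gamma> 1 = q \<Longrightarrow> b \<le> curve_length \<A> g 1 \<gamma>"
  shows "b \<le> d p q"
  unfolding riemannian_dist_eq
  by (rule cInf_greatest) (use assms in \<open>auto simp: C1_connected_def\<close>)

lemma riemannian_dist_lessE:
  assumes "C1_connected p q" "d p q < b"
  obtains \<gamma> S where "C1_off S 1 \<gamma>" "\<gamma> 0 = p" "\<gamma> 1 = q" "curve_length \<A> g 1 \<gamma> < b"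
  using riemannian_dist_geI[OF assms(1), of b] assms(2) by force

lemma riemannian_dist_self: "d p p \<le> 0"
proof -
  let ?\<gamma> = "\<lambda>_::real. p"
  have const: "C1_off {} 1 ?\<gamma>"
    by (auto simp: C1_off_def C1_on_interval_def o_def intro!: exI[of _ "\<lambda>_. 0"])
  have "speed 1 ?\<gamma> t = 0" if t: "t \<in> {0..1}" for t
  proof -
    obtain c where c: "c \<in> \<A>" "p \<in> chart_dom c" by (rule chart_exists)
    have "velocity \<A> 1 ?\<gamma> t = tangent_of_coords \<A> c p 0"
      by (rule velocity_eq[OF c(1), of 1 ?\<gamma>]) (use t c in \<open>auto simp: o_def\<close>)
    then have "speed 1 ?\<gamma> t = sqrt (metric_coords \<A> g c (chart_map c p) 0 0)"
      by (intro speed_eq) (use c in auto)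
    then show ?thesis using bilinear_lzero[OF bilinear_metric_coords[OF c(1)]] c by simp
  qed
  then have "(speed 1 ?\<gamma> has_integral 0) {0..1}" by (rule has_integral_is_0)
  then have "curve_length \<A> g 1 ?\<gamma> = 0"
    using curve_length_has_integral[OF const] has_integral_unique by auto
  then show ?thesis using riemannian_dist_le[OF const] by simp
qed

lemma riemannian_dist_pos:
  assumes conn: "C1_connected p q" and "p \<noteq> q" shows "0 < d p q"
proof -
  obtain c where c: "c \<in> \<A>" "p \<in> chart_dom c" by (rule chart_exists)
  let ?x = "chart_map c p"
  have "?x \<in> chart_img c" using c by auto
  then obtain r where r: "r > 0" "ball ?x r \<subseteq> chart_img c"
    using open_chart_img[OF c(1)] openE by blast
  \<comment> \<open>If \<open>q\<close> lies in the chart, the ball must also be too small to contain it.\<close>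
  define \<rho> where "\<rho> = min (r/2) (if q \<in> chart_dom c then dist ?x (chart_map c q) else r)"
  have "?x \<noteq> chart_map c q" if "q \<in> chart_dom c"
    using \<open>p \<noteq> q\<close> chart_inv_map[OF c(1)] c(2) that by metis
  then have \<rho>: "\<rho> > 0" using r by (auto simp: \<rho>_def)
  have cball: "cball ?x \<rho> \<subseteq> chart_img c"
    using r by (intro order_trans[OF _ r(2)]) (auto simp: \<rho>_def)
  have out: "q \<notin> chart_inv c ` ball ?x \<rho>"
  proof
    assume "q \<in> chart_inv c ` ball ?x \<rho>"
    then obtain y where y: "y \<in> ball ?x \<rho>" "q = chart_inv c y" by blast
    then have "y \<in> chart_img c" using cball ball_subset_cball by blast
    then have "q \<in> chart_dom c" "chart_map c q = y" using y chart_inv_dom[OF c(1)] chart_map_inv[OF c(1)] by auto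
    then show False using y(1) by (simp add: \<rho>_def)
  qed
  obtain m where m: "m > 0" "\<And>x a. x \<in> cball ?x \<rho> \<Longrightarrow> m * (norm a)\<^sup>2 \<le> metric_coords \<A> g c x a a"
  proof (rule bilinear_family_coercive[of "cball ?x \<rho>" "metric_coords \<A> g c"])
    show "continuous_on (cball ?x \<rho>) (\<lambda>x. metric_coords \<A> g c x a b)" for a b
      by (rule continuous_on_subset[OF smooth_on_imp_continuous_on[OF smooth_metric_coords[OF c(1)]] cball])
  qed (use cball bilinear_metric_coords[OF c(1)] metric_coords_pos[OF c(1)] in auto)
  have "sqrt m * \<rho> \<le> d p q"
    using conn by (rule riemannian_dist_geI)
      (use curve_length_ge_leaving_ball[OF c \<rho> cball m] out in auto)
  moreover have "0 < sqrt m * \<rho>" using m \<rho> by simp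
  ultimately show ?thesis by linarith
qed

lemma riemannian_dist_commute_le:
  assumes "C1_connected p q" shows "d q p \<le> d p q"
proof (rule riemannian_dist_geI[OF assms])
  fix \<gamma> S assume "C1_off S 1 \<gamma>" "\<gamma> 0 = p" "\<gamma> 1 = q"
  then show "d q p \<le> curve_length \<A> g 1 \<gamma>"
    using riemannian_dist_le[OF C1_off_reversepath(1)] C1_off_reversepath(2) by (auto simp: reversepath_def)
qed

lemma riemannian_dist_triangle:
  assumes "C1_connected p q" "C1_connected q r" shows "d p r \<le> d p q + d q r"
proof (rule field_le_epsilon)
  fix e :: real assume "e > 0"
  then have "d p q < d p q + e/2" "d q r < d q r + e/2" by auto
  then obtain \<gamma> S \<eta> R where "C1_off S 1 \<gamma>" "\<gamma> 0 = p" "\<gamma> 1 = q" "curve_length \<A> g 1 \<gamma> < d p q + e/2"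
    "C1_off R 1 \<eta>" "\<eta> 0 = q" "\<eta> 1 = r" "curve_length \<A> g 1 \<eta> < d q r + e/2"
    using riemannian_dist_lessE[OF assms(1)] riemannian_dist_lessE[OF assms(2)] by metis
  note * = this
  obtain S' where J: "C1_off S' 1 (\<gamma> +++ \<eta>)" using C1_off_joinpaths(1)[OF *(1,5)] * by auto
  have "d p r \<le> curve_length \<A> g 1 (\<gamma> +++ \<eta>)"
    using riemannian_dist_le[OF J] * by (simp add: joinpaths_def)
  also have "\<dots> = curve_length \<A> g 1 \<gamma> + curve_length \<A> g 1 \<eta>"
    using C1_off_joinpaths(2)[OF *(1,5)] * by simp
  finally show "d p r \<le> d p q + d q r + e" using * by simp
qed

theorem riemannian_dist_Metric_space:
  assumes "connected (UNIV :: 'm set)"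
  shows "Metric_space UNIV d"
proof
  note conn = C1_connected_all[OF assms]
  show nonneg: "0 \<le> d p q" for p q
    by (rule riemannian_dist_geI[OF conn]) (rule curve_length_nonneg, auto)
  show "d p q = d q p" for p q
    by (intro antisym riemannian_dist_commute_le conn)
  show "d p q = 0 \<longleftrightarrow> p = q" for p q
    using riemannian_dist_pos[OF conn, of p q] riemannian_dist_self[of p] nonneg[of p p] by fastforce
  show "d p r \<le> d p q + d q r" for p q r
    by (rule riemannian_dist_triangle[OF conn conn])
qed

lemma riemannian_dist_le_speed_bound:
  assumes q: "C1_off S T q" and T: "0 < T" and st: "0 \<le> s" "s < t" "t \<le> T"
    and M: "\<And>u. u \<in> {0..T} \<Longrightarrow> speed T q u \<le> M"
  shows "d (q s) (q t) \<le> M * (t - s)"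
proof -
  let ?m = "t - s"
  define \<sigma> where "\<sigma> u = q (?m * u + s)" for u
  define R where "R = (\<lambda>x. (x - s) / ?m) ` S"
  have m: "?m \<noteq> 0" and fin: "finite R" using st q by (auto simp: R_def C1_off_def)
  have range: "?m * u + s \<in> {0..T}" if "u \<in> {0..1}" for u
  proof -
    have *: "0 \<le> ?m * u" "?m * u \<le> ?m * 1" using that st by (intro mult_nonneg_nonneg mult_left_mono; simp)+
    have "0 \<le> ?m * u + s" using * st by linarith
    moreover have "?m * u + s \<le> T" using *(2) st unfolding mult_1_right by linarith
    ultimately show ?thesis by (simp only: atLeastAtMost_iff simp_thms)
  qed
  have range': "?m * u + s \<in> {0<..<T}" if "u \<in> {0<..<1}" for u
  proof -
    have *: "0 < ?m * u" "?m * u < ?m * 1" using that st by (intro mult_pos_pos mult_strict_left_mono; simp)+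
    have "0 < ?m * u + s" using * st by linarith
    moreover have "?m * u + s < T" using *(2) st unfolding mult_1_right by linarith
    ultimately show ?thesis by (simp only: greaterThanLessThan_iff simp_thms)
  qed
  have R: "?m * u + s \<notin> S" if "u \<notin> R" for u
  proof
    assume "?m * u + s \<in> S"
    then have "u \<in> R" unfolding R_def using m by (intro image_eqI[of _ _ "?m * u + s"]) auto
    then show False using that by simp
  qed
  have cont: "continuous_on {0..1} \<sigma>"
    unfolding \<sigma>_def
  proof (rule continuous_on_compose2[where g = q])
    show "continuous_on {0..T} q" using q by (simp add: C1_off_def)
    show "continuous_on {0..1} (\<lambda>u. ?m * u + s)" by (intro continuous_intros)
    show "(\<lambda>u. ?m * u + s) ` {0..1} \<subseteq> {0..T}" using range by blast
  qed
  have C: "C1_off R 1 \<sigma>"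
    unfolding C1_off_def
  proof (intro conjI ballI allI impI cont fin)
    fix c a b assume c: "c \<in> \<A>" and ab: "0 \<le> a \<and> a < b \<and> b \<le> 1 \<and> {a<..<b} \<inter> R = {} \<and> \<sigma> ` {a..b} \<subseteq> chart_dom c"
    show "C1_on_interval a b (chart_map c \<circ> \<sigma>)"
    proof (rule C1_on_interval_reparam[OF q m _ _ _ _ c])
      show "\<sigma> u = q (?m * u + s)" for u by (simp add: \<sigma>_def)
      show "?m * u + s \<in> {0..T}" if "u \<in> {a..b}" for u
        by (rule range) (use that ab in simp)
      show "?m * u + s \<notin> S" if "u \<in> {a<..<b}" for u
        by (rule R) (use that ab in blast)
    qed (use ab in auto)
  qed
  have "curve_length \<A> g 1 \<sigma> \<le> M * ?m"
  proof (rule has_integral_le_off_finite[OF curve_length_has_integral[OF C] _ finite.insertI[OF finite.insertI[OF fin, of 0], of 1]])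
    show "((\<lambda>_. M * ?m) has_integral M * ?m) {0..1::real}"
      using has_integral_const_real[of "M * ?m" 0 1] by simp
    fix u assume u: "u \<in> {0..1} - insert 1 (insert 0 R)"
    have "speed 1 \<sigma> u = \<bar>?m\<bar> * speed T q (?m * u + s)"
      using u by (intro speed_reparam[OF q T cont m order_refl order_refl, where k = s] range' R) (auto simp: \<sigma>_def)
    also have "\<dots> \<le> ?m * M" using M[OF range[of u]] u st by (auto intro: mult_left_mono)
    finally show "speed 1 \<sigma> u \<le> M * ?m" by (simp add: mult.commute)
  qed simp
  then show ?thesis
    using riemannian_dist_le[OF C] by (simp add: \<sigma>_def)
qed

end

section \<open>Sobolev curves and their covariant acceleration\<close>

context riemannian
begin

lemma chart_interval_nhd:
  assumes q: "continuous_on {0..T::real} q" and t: "t \<in> {0..T}" and T: "0 < T" and dom: "q t \<in> U" "open U"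
  obtains a b where "0 \<le> a" "b \<le> T" "a \<le> t" "t \<le> b" "a < t \<or> a = 0" "t < b \<or> b = T" "a < b" "q ` {a..b} \<subseteq> U"
proof -
  obtain e1 where e1: "e1 > 0" "\<And>u. u \<in> {0..T} \<Longrightarrow> \<bar>u - t\<bar> < e1 \<Longrightarrow> q u \<in> U"
    using curve_stays_in_chart[OF q t dom] by blast
  show ?thesis
    by (rule that[of "max 0 (t - e1/2)" "min T (t + e1/2)"]) (use e1 t T in auto)
qed

context
  fixes T q
  assumes T: "0 < T" and H2: "H2_curve \<A> T q"
begin

abbreviation X where "X \<equiv> velocity \<A> T q"

abbreviation x where "x c t \<equiv> chart_map c (q t)"

lemma continuous_on_H2: "continuous_on {0..T} q"
  using H2 by (simp add: H2_curve_def)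

lemma continuous_on_coords:
  assumes "c \<in> \<A>" "0 \<le> s" "t \<le> T" "q ` {s..t} \<subseteq> chart_dom c"
  shows "continuous_on {s..t} (x c)"
  by (rule continuous_on_compose2[OF continuous_on_chart_map[OF assms(1)] continuous_on_subset[OF continuous_on_H2]])
    (use assms in auto)

lemma coords_in_img: "q ` {s..t} \<subseteq> chart_dom c \<Longrightarrow> u \<in> {s..t} \<Longrightarrow> x c u \<in> chart_img c"
  by blast

lemma H2_chart_C1:
  assumes c: "c \<in> \<A>" and st: "0 \<le> s" "s < t" "t \<le> T" and dom: "q ` {s..t} \<subseteq> chart_dom c"
  obtains F w where "\<And>u. u \<in> {s..t} \<Longrightarrow> (chart_map c \<circ> q has_vector_derivative F u) (at u within {s..t})"
    and "primitive_on s t F w" and "L2_on s t w"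
proof -
  have "H2_on s t (chart_map c \<circ> q)"
    using H2 c st dom unfolding H2_curve_def by blast
  moreover have "continuous_on {s..t} (chart_map c \<circ> q)"
    using continuous_on_coords[OF c st(1,3) dom] by (simp add: o_def)
  ultimately show ?thesis
    using H2_on_imp_C1[OF st(2)] that by blast
qed

text \<open>At an end point of a subinterval the derivative in the chart is one-sided, whereas the velocity at an interior
  time is two-sided. Hence the derivative is taken in a subinterval that is a neighbourhood of
  \<open>t\<close> relative to \<open>[0,T]\<close>.\<close>

lemma H2_velocity:
  assumes t: "t \<in> {0..T}" and c: "c \<in> \<A>" "q t \<in> chart_dom c"
  shows "(chart_map c \<circ> q has_vector_derivative X t c) (at t within {0..T})" "X t \<in> tangent_space \<A> (q t)"
proof -
  obtain a b where ab: "0 \<le> a" "b \<le> T" "a \<le> t" "t \<le> b" "a < t \<or> a = 0" "t < b \<or> b = T" "a < b" "q ` {a..b} \<subseteq> chart_dom c"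
    by (rule chart_interval_nhd[OF continuous_on_H2 t T c(2) open_chart_dom[OF c(1)]])
  obtain F w where F: "\<And>u. u \<in> {a..b} \<Longrightarrow> (chart_map c \<circ> q has_vector_derivative F u) (at u within {a..b})"
    and "primitive_on a b F w" "L2_on a b w"
    by (rule H2_chart_C1[OF c(1) ab(1,7,2,8)]) (rule that)
  have F': "(chart_map c \<circ> q has_vector_derivative F t) (at t within {0..T})"
    using F[of t] ab(3,4) at_within_relative_nhd[OF ab(1-6)] by simp
  have X: "X t = tangent_of_coords \<A> c (q t) (F t)"
    by (rule velocity_eq[OF c(1) continuous_on_H2 t T c(2) F'])
  then show "X t \<in> tangent_space \<A> (q t)"
    using tangent_of_coords_in_tangent_space[OF c] by simp
  show "(chart_map c \<circ> q has_vector_derivative X t c) (at t within {0..T})"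
    using F' X tangent_of_coords_self[OF c] by simp
qed

lemma velocity_tangent: "t \<in> {0..T} \<Longrightarrow> X t \<in> tangent_space \<A> (q t)"
  using H2_velocity(2) chart_exists by metis

lemma H2_chart:
  assumes c: "c \<in> \<A>" and st: "0 \<le> s" "s < t" "t \<le> T" and dom: "q ` {s..t} \<subseteq> chart_dom c"
  shows "\<And>u. u \<in> {s..t} \<Longrightarrow> (x c has_vector_derivative X u c) (at u within {s..t})"
    and "\<exists>w. primitive_on s t (\<lambda>u. X u c) w \<and> L2_on s t w"
proof -
  obtain F w where F: "\<And>u. u \<in> {s..t} \<Longrightarrow> (chart_map c \<circ> q has_vector_derivative F u) (at u within {s..t})"
    and w: "primitive_on s t F w" "L2_on s t w"
    by (rule H2_chart_C1[OF c st dom]) (rule that)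
  have X: "(chart_map c \<circ> q has_vector_derivative X u c) (at u within {s..t})" if u: "u \<in> {s..t}" for u
    by (rule has_vector_derivative_within_subset[OF H2_velocity(1)]) (use u c st dom in auto)
  then show "(x c has_vector_derivative X u c) (at u within {s..t})" if u: "u \<in> {s..t}" for u
    using that by (simp add: o_def)
  have "F u = X u c" if u: "u \<in> {s..t}" for u
    using vector_derivative_unique_within_closed_interval[OF st(2), of u "chart_map c \<circ> q"] F[OF u] X[OF u] u
    by (simp add: cbox_interval)
  then have "primitive_on s t (\<lambda>u. X u c) w"
    by (intro primitive_on_cong[OF w(1)]) auto
  then show "\<exists>w. primitive_on s t (\<lambda>u. X u c) w \<and> L2_on s t w"
    using w(2) by blast
qed

lemma H2_imp_C1_off: "C1_off {} T q"
  unfolding C1_off_def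
proof (intro conjI ballI allI impI continuous_on_H2)
  fix c s t assume c: "c \<in> \<A>" and st: "0 \<le> s \<and> s < t \<and> t \<le> T \<and> {s<..<t} \<inter> {} = {} \<and> q ` {s..t} \<subseteq> chart_dom c"
  have st': "0 \<le> s" "s < t" "t \<le> T" "q ` {s..t} \<subseteq> chart_dom c" using st by auto
  obtain F w where "\<And>u. u \<in> {s..t} \<Longrightarrow> (chart_map c \<circ> q has_vector_derivative F u) (at u within {s..t})"
    "primitive_on s t F w" "L2_on s t w"
    by (rule H2_chart_C1[OF c st']) (rule that)
  then show "C1_on_interval s t (chart_map c \<circ> q)"
    unfolding C1_on_interval_def using primitive_on_continuous by blast
qed simp

lemma continuous_on_velocity_coords:
  assumes c: "c \<in> \<A>" and st: "0 \<le> s" "s < t" "t \<le> T" and dom: "q ` {s..t} \<subseteq> chart_dom c"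
  shows "continuous_on {s..t} (\<lambda>u. X u c)"
  using H2_chart(2)[OF assms] primitive_on_continuous by blast

text \<open>The quadratic term \<open>\<Gamma>(q', q')\<close> of the geodesic equation.\<close>

definition geod :: "('m, 'e) chart \<Rightarrow> real \<Rightarrow> 'e" where
  "geod c t = christoffel \<A> g c (x c t) (X t c) (X t c)"

lemma continuous_on_geod:
  assumes c: "c \<in> \<A>" and st: "0 \<le> s" "s < t" "t \<le> T" and dom: "q ` {s..t} \<subseteq> chart_dom c"
  shows "continuous_on {s..t} (geod c)"
  unfolding geod_def
proof (rule continuous_on_bilinear_family[where B = "\<lambda>t. christoffel \<A> g c (x c t)"])
  show "bilinear (christoffel \<A> g c (x c u))" if "u \<in> {s..t}" for u
    by (rule bilinear_christoffel[OF c coords_in_img[OF dom that]])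
  show "continuous_on {s..t} (\<lambda>u. christoffel \<A> g c (x c u) i j)" for i j
    by (rule continuous_on_compose2[OF continuous_on_christoffel[OF c] continuous_on_coords[OF c st(1,3) dom]])
      (use coords_in_img[OF dom] in blast)
qed (rule continuous_on_velocity_coords[OF assms])+

text \<open>The components of the velocity in the new chart are a coordinate change matrix times those in the old chart.
  The product rule produces a term with the second derivative of the coordinate change, which is exactly the
  inhomogeneous term in the transformation law of the Christoffel symbols.\<close>

lemma acceleration_change_of_chart:
  assumes c: "c \<in> \<A>" and c': "c' \<in> \<A>" and st: "0 \<le> s" "s < t" "t \<le> T"
    and dom: "q ` {s..t} \<subseteq> chart_dom c" and dom': "q ` {s..t} \<subseteq> chart_dom c'"
    and w: "primitive_on s t (\<lambda>u. X u c) w" "L2_on s t w"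
    and Y: "\<And>u. u \<in> {s..t} \<Longrightarrow> Y u = tangent_of_coords \<A> c (q u) (w u + geod c u)"
  shows "L2_on s t (\<lambda>u. Y u c')" "primitive_on s t (\<lambda>u. X u c') (\<lambda>u. Y u c' - geod c' u)"
proof -
  let ?\<tau> = "transition c c'" and ?O = "chart_map c ` (chart_dom c \<inter> chart_dom c')"
  define A where "A u = coord_change_deriv c c' (q u)" for u
  define H where "H u = second_derivative ?\<tau> (x c u)" for u
  have sm: "smooth_on ?O ?\<tau>" by (rule smooth_transition[OF c c'])
  have O: "open ?O" using open_overlap[OF c open_chart_dom[OF c']] .
  have mem: "q u \<in> chart_dom c" "q u \<in> chart_dom c'" "x c u \<in> ?O" if u: "u \<in> {s..t}" for u
  proof -
    show 1: "q u \<in> chart_dom c" "q u \<in> chart_dom c'" using dom dom' u by blast+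
    show "x c u \<in> ?O" using 1 by (intro imageI IntI)
  qed
  have A_eq: "A u = frechet_derivative ?\<tau> (at (x c u))" for u
    by (simp add: A_def coord_change_deriv_def)
  have linA: "linear (A u)" if "u \<in> {s..t}" for u
    unfolding A_def by (rule linear_coord_change[OF c c' mem(1,2)[OF that]])
  have Hsym: "H u v b = H u b v" if "u \<in> {s..t}" for u v b
    unfolding H_def by (rule second_derivative_symmetric[OF O mem(3)[OF that] sm])
  have linH: "linear (\<lambda>v. H u v b)" if "u \<in> {s..t}" for u b
    unfolding H_def second_derivative_def
    by (rule smooth_on_linear_derivative[OF smooth_on_derivative[OF sm] mem(3)[OF that]])
  have linH': "linear (H u v)" if "u \<in> {s..t}" for u v
    using linH[OF that, of v] Hsym[OF that] by (simp add: linear_iff)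
  have contx: "continuous_on {s..t} (x c)" by (rule continuous_on_coords[OF c st(1,3) dom])
  have contX: "continuous_on {s..t} (\<lambda>u. X u c)" by (rule continuous_on_velocity_coords[OF c st dom])
  have primA: "primitive_on s t (\<lambda>u. A u i) (\<lambda>u. H u (X u c) i)" for i
  proof (rule primitive_on_C1)
    show "((\<lambda>u. A u i) has_vector_derivative H u (X u c) i) (at u within {s..t})" if u: "u \<in> {s..t}" for u
    proof -
      have D: "((\<lambda>y. frechet_derivative ?\<tau> (at y) i) has_derivative (\<lambda>h. H u h i)) (at (x c u))"
        unfolding H_def second_derivative_def
        by (rule smooth_on_has_derivative[OF smooth_on_derivative[OF sm] mem(3)[OF u]])
      have "(x c has_derivative (\<lambda>h. h *\<^sub>R X u c)) (at u within {s..t})"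
        using H2_chart(1)[OF c st dom u] by (simp add: has_vector_derivative_def)
      from has_derivative_compose[OF this D]
      show ?thesis
        unfolding has_vector_derivative_def A_eq by (simp only: linear_cmul[OF linH[OF u]])
    qed
    show "continuous_on {s..t} (\<lambda>u. H u (X u c) i)"
    proof (rule continuous_on_linear_family[where L = "\<lambda>u v. H u v i"])
      show "continuous_on {s..t} (\<lambda>u. H u b i)" for b
        unfolding H_def second_derivative_def
        by (rule continuous_on_compose2[OF smooth_on_imp_continuous_on[OF smooth_on_derivative[OF smooth_on_derivative[OF sm]]] contx])
          (use mem in blast)
    qed (use linH contX in auto)
  qed
  have contA: "continuous_on {s..t} (\<lambda>u. A u i)" for i
    by (rule primitive_on_continuous[OF primA])
  have Xc': "X u c' = A u (X u c)" if u: "u \<in> {s..t}" for u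
    unfolding A_def by (rule tangent_space_change[OF velocity_tangent]) (use u mem[OF u] st c c' in auto)
  have Yc': "Y u c' = A u (w u + geod c u)" if u: "u \<in> {s..t}" for u
    using Y[OF u] mem[OF u] c' by (simp add: tangent_of_coords_def A_def)
  have "L2_on s t (\<lambda>u. w u + geod c u)"
    by (intro L2_on_add w(2) L2_on_continuous continuous_on_geod c st dom)
  then have "L2_on s t (\<lambda>u. A u (w u + geod c u))"
    by (rule L2_on_linear_family) (use contA linA in auto)
  then show "L2_on s t (\<lambda>u. Y u c')"
    by (rule L2_on_cong) (simp add: Yc')
  have "primitive_on s t (\<lambda>u. A u (X u c)) (\<lambda>u. H u (X u c) (X u c) + A u (w u))"
    by (rule primitive_on_linear_family[OF w(1) primA linA linH'])
  then show "primitive_on s t (\<lambda>u. X u c') (\<lambda>u. Y u c' - geod c' u)"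
  proof (rule primitive_on_cong)
    fix u assume u: "u \<in> {s..t}"
    show "A u (X u c) = X u c'" by (rule Xc'[OF u, symmetric])
    have "A u (geod c u) = geod c' u + H u (X u c) (X u c)"
      unfolding geod_def Xc'[OF u] A_def H_def by (rule christoffel_change[OF c c' mem(1,2)[OF u]])
    then show "H u (X u c) (X u c) + A u (w u) = Y u c' - geod c' u"
      unfolding Yc'[OF u] by (simp add: linear_add[OF linA[OF u]])
  qed
qed

text \<open>The covariant derivative of the velocity, restricted to a time interval and with the weak derivative replaced
  by the integral identity, so that it can be glued.\<close>

definition is_acceleration_on :: "real \<Rightarrow> real \<Rightarrow> (real \<Rightarrow> ('m, 'e) tangent) \<Rightarrow> bool" where
  "is_acceleration_on a b Y \<longleftrightarrow> (\<forall>t\<in>{a..b}. Y t \<in> tangent_space \<A> (q t)) \<and>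
     (\<forall>c\<in>\<A>. \<forall>s t. a \<le> s \<and> s < t \<and> t \<le> b \<and> q ` {s..t} \<subseteq> chart_dom c \<longrightarrow>
        L2_on s t (\<lambda>u. Y u c) \<and> primitive_on s t (\<lambda>u. X u c) (\<lambda>u. Y u c - geod c u))"

lemma is_acceleration_onD:
  assumes "is_acceleration_on a b Y" "c \<in> \<A>" "a \<le> s" "s < t" "t \<le> b" "q ` {s..t} \<subseteq> chart_dom c"
  shows "L2_on s t (\<lambda>u. Y u c)" "primitive_on s t (\<lambda>u. X u c) (\<lambda>u. Y u c - geod c u)"
  using assms unfolding is_acceleration_on_def by blast+

lemma is_acceleration_on_join:
  assumes Y: "is_acceleration_on a b Y" and Z: "is_acceleration_on b e Z"
  shows "is_acceleration_on a e (\<lambda>t. if t \<le> b then Y t else Z t)"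
  unfolding is_acceleration_on_def
proof (intro conjI ballI allI impI)
  let ?W = "\<lambda>t. if t \<le> b then Y t else Z t"
  show "?W t \<in> tangent_space \<A> (q t)" if "t \<in> {a..e}" for t
    using Y Z that by (auto simp: is_acceleration_on_def)
  fix c s t assume c: "c \<in> \<A>" and st: "a \<le> s \<and> s < t \<and> t \<le> e \<and> q ` {s..t} \<subseteq> chart_dom c"
  have left: "L2_on u v (\<lambda>u. ?W u c) \<and> primitive_on u v (\<lambda>u. X u c) (\<lambda>u. ?W u c - geod c u)"
    if uv: "a \<le> u" "u < v" "v \<le> b" "q ` {u..v} \<subseteq> chart_dom c" for u v
  proof
    show "L2_on u v (\<lambda>u. ?W u c)"
      by (rule L2_on_cong[OF is_acceleration_onD(1)[OF Y c uv]]) (use uv in auto)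
    show "primitive_on u v (\<lambda>u. X u c) (\<lambda>u. ?W u c - geod c u)"
      by (rule primitive_on_cong[OF is_acceleration_onD(2)[OF Y c uv]]) (use uv in auto)
  qed
  have right: "L2_on u v (\<lambda>u. ?W u c) \<and> primitive_on u v (\<lambda>u. X u c) (\<lambda>u. ?W u c - geod c u)"
    if uv: "b \<le> u" "u < v" "v \<le> e" "q ` {u..v} \<subseteq> chart_dom c" for u v
  proof
    \<comment> \<open>At the common end point \<open>b\<close> the value of \<open>Y\<close> has been kept, so \<open>Z\<close> is
      altered there.\<close>
    define Z' where "Z' t = (if t = b then Y t else Z t)" for t
    have "L2_on u v (\<lambda>u. Z' u c)"
      by (rule L2_on_spike[OF is_acceleration_onD(1)[OF Z c uv], of b]) (simp add: Z'_def)
    then show "L2_on u v (\<lambda>u. ?W u c)"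
      by (rule L2_on_cong) (use uv in \<open>auto simp: Z'_def\<close>)
    have "primitive_on u v (\<lambda>u. X u c) (\<lambda>u. Z' u c - geod c u)"
      by (rule primitive_on_spike[OF is_acceleration_onD(2)[OF Z c uv], of b]) (simp add: Z'_def)
    then show "primitive_on u v (\<lambda>u. X u c) (\<lambda>u. ?W u c - geod c u)"
      by (rule primitive_on_cong) (use uv in \<open>auto simp: Z'_def\<close>)
  qed
  consider "t \<le> b" | "b \<le> s" | "s < b" "b < t" by linarith
  then have "L2_on s t (\<lambda>u. ?W u c) \<and> primitive_on s t (\<lambda>u. X u c) (\<lambda>u. ?W u c - geod c u)"
  proof cases
    case 3
    have sub: "q ` {s..b} \<subseteq> chart_dom c" "q ` {b..t} \<subseteq> chart_dom c" using st 3 by (auto simp: image_subset_iff)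
    show ?thesis
      using left[of s b] right[of b t] sub 3 st by (auto intro: L2_on_join primitive_on_join)
  qed (use st left right in blast)+
  then show "L2_on s t (\<lambda>u. ?W u c)" "primitive_on s t (\<lambda>u. X u c) (\<lambda>u. ?W u c - geod c u)" by auto
qed

text \<open>On a short interval inside a chart the coordinate expression \<open>x'' + \<Gamma>(x', x')\<close> serves as
  the acceleration.\<close>

lemma acceleration_exists: "\<exists>Y. is_acceleration_on 0 T Y"
proof -
  define P where "P a b \<longleftrightarrow> (0 \<le> a \<longrightarrow> a \<le> b \<longrightarrow> b \<le> T \<longrightarrow> (\<exists>Y. is_acceleration_on a b Y))" for a b
  have "P 0 T"
  proof (rule Bolzano[where P = P])
    fix a b e assume P: "P a b" "P b e" "a \<le> b" "b \<le> e"
    show "P a e"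
      unfolding P_def
    proof (intro impI)
      assume le: "0 \<le> a" "a \<le> e" "e \<le> T"
      obtain Y Z where "is_acceleration_on a b Y" "is_acceleration_on b e Z"
        using P le unfolding P_def by auto
      then show "\<exists>Y. is_acceleration_on a e Y"
        using is_acceleration_on_join by blast
    qed
  next
    fix z assume z: "0 \<le> z" "z \<le> T"
    obtain c where c: "c \<in> \<A>" "q z \<in> chart_dom c" by (rule chart_exists)
    obtain d where d: "d > 0" "\<And>u. u \<in> {0..T} \<Longrightarrow> \<bar>u - z\<bar> < d \<Longrightarrow> q u \<in> chart_dom c"
      using curve_stays_in_chart[OF continuous_on_H2 _ c(2) open_chart_dom[OF c(1)]] z by auto
    have "P a b" if ab: "a \<le> z" "z \<le> b" "b - a < d" for a b
      unfolding P_def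
    proof (intro impI)
      assume le: "0 \<le> a" "a \<le> b" "b \<le> T"
      have dom: "q ` {a..b} \<subseteq> chart_dom c"
        using d(2) ab le by auto
      show "\<exists>Y. is_acceleration_on a b Y"
      proof (cases "a < b")
        case False
        then show ?thesis
          using velocity_tangent le by (intro exI[of _ X]) (auto simp: is_acceleration_on_def)
      next
        case True
        obtain w where w: "primitive_on a b (\<lambda>u. X u c) w" "L2_on a b w"
          using H2_chart(2)[OF c(1) le(1) True le(3) dom] by blast
        define Y where "Y u = tangent_of_coords \<A> c (q u) (w u + geod c u)" for u
        have "is_acceleration_on a b Y"
          unfolding is_acceleration_on_def
        proof (intro conjI ballI allI impI)
          show "Y t \<in> tangent_space \<A> (q t)" if "t \<in> {a..b}" for t
            unfolding Y_def using that dom by (intro tangent_of_coords_in_tangent_space c) auto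
          fix c' s t assume c': "c' \<in> \<A>" and st: "a \<le> s \<and> s < t \<and> t \<le> b \<and> q ` {s..t} \<subseteq> chart_dom c'"
          have sub: "q ` {s..t} \<subseteq> chart_dom c" using dom st by (auto simp: image_subset_iff)
          have w': "primitive_on s t (\<lambda>u. X u c) w" "L2_on s t w"
            using st by (auto intro: primitive_on_subinterval[OF w(1)] L2_on_subinterval[OF w(2)])
          have st': "0 \<le> s" "s < t" "t \<le> T" "q ` {s..t} \<subseteq> chart_dom c'" using st le by auto
          show "L2_on s t (\<lambda>u. Y u c')" "primitive_on s t (\<lambda>u. X u c') (\<lambda>u. Y u c' - geod c' u)"
            by (rule acceleration_change_of_chart[OF c(1) c' st'(1-3) sub st'(4) w' Y_def])+
        qed
        then show ?thesis by blast
      qed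
    qed
    then show "\<exists>d>0. \<forall>a b. a \<le> z \<and> z \<le> b \<and> b - a < d \<longrightarrow> P a b"
      using d(1) by blast
  qed (use T in simp)
  then show ?thesis using T by (simp add: P_def)
qed

lemma has_covariant_derivative_iff:
  "has_covariant_derivative \<A> g T q X Y \<longleftrightarrow> is_acceleration_on 0 T Y"
proof -
  have "weak_derivative_on s t (\<lambda>u. X u c) (\<lambda>u. Y u c - geod c u) \<longleftrightarrow>
      primitive_on s t (\<lambda>u. X u c) (\<lambda>u. Y u c - geod c u)"
    if c: "c \<in> \<A>" and st: "0 \<le> s" "s < t" "t \<le> T" and dom: "q ` {s..t} \<subseteq> chart_dom c" and L2: "L2_on s t (\<lambda>u. Y u c)" for c s t
  proof
    have "(\<lambda>u. Y u c - geod c u) absolutely_integrable_on {s..t}"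
      using L2_on_imp_absolutely_integrable[OF L2] absolutely_integrable_continuous_real[OF continuous_on_geod[OF c st dom]]
      by (rule set_integral_diff)
    then show "primitive_on s t (\<lambda>u. X u c) (\<lambda>u. Y u c - geod c u)"
      if "weak_derivative_on s t (\<lambda>u. X u c) (\<lambda>u. Y u c - geod c u)"
      using that by (intro weak_derivative_imp_primitive_on st(2) continuous_on_velocity_coords[OF c st dom])
  qed (rule primitive_on_imp_weak_derivative[OF _ st(2)])
  then show ?thesis
    unfolding has_covariant_derivative_def is_acceleration_on_def geod_def by blast
qed

lemma covariant_acceleration: "is_acceleration_on 0 T (covariant_acceleration \<A> g T q)"
  unfolding covariant_acceleration_def has_covariant_derivative_iff
  by (rule someI_ex[OF acceleration_exists])

end
end

section \<open>Energy and speed\<close>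

context riemannian
begin

context
  fixes T q Y
  assumes T: "0 < T" and H2: "H2_curve \<A> T q" and Y: "is_acceleration_on T q 0 T Y"
begin

abbreviation v where "v \<equiv> velocity \<A> T q"

abbreviation y where "y c t \<equiv> chart_map c (q t)"

lemma acceleration_tangent: "t \<in> {0..T} \<Longrightarrow> Y t \<in> tangent_space \<A> (q t)"
  using Y by (simp add: is_acceleration_on_def[OF T H2])

text \<open>The metric is compatible with the connection: the derivative of the coefficients of the metric along the curve
  cancels the Christoffel terms that distinguish \<open>Y\<close> from the second derivative of the
  coordinates.\<close>

lemma energy_local:
  assumes c: "c \<in> \<A>" and st: "0 \<le> s" "s < t" "t \<le> T" and dom: "q ` {s..t} \<subseteq> chart_dom c"
  shows "primitive_on s t (\<lambda>u. g (q u) (v u) (v u)) (\<lambda>u. 2 * g (q u) (Y u) (v u))"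
    and "(\<lambda>u. g (q u) (Y u) (Y u)) absolutely_integrable_on {s..t}"
proof -
  let ?G = "\<lambda>u. metric_coords \<A> g c (y c u)" and ?D = "\<lambda>u. metric_deriv c (y c u) (v u c)"
  let ?w = "\<lambda>u. Y u c - geod T q c u"
  have img: "y c u \<in> chart_img c" "q u \<in> chart_dom c" "u \<in> {0..T}" if u: "u \<in> {s..t}" for u
  proof -
    show 1: "q u \<in> chart_dom c" using dom u by blast
    then show "y c u \<in> chart_img c" by blast
    show "u \<in> {0..T}" using u st by auto
  qed
  have v: "v u \<in> tangent_space \<A> (q u)" and Yu: "Y u \<in> tangent_space \<A> (q u)" if "u \<in> {s..t}" for u
    using velocity_tangent[OF T H2] acceleration_tangent img(3)[OF that] by auto
  have L2: "L2_on s t (\<lambda>u. Y u c)" and prim: "primitive_on s t (\<lambda>u. v u c) ?w"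
    using is_acceleration_onD[OF T H2 Y c st dom] by auto
  have bilG: "bilinear (?G u)" if "u \<in> {s..t}" for u
    by (rule bilinear_metric_coords[OF c img(1)[OF that]])
  have contx: "continuous_on {s..t} (y c)" by (rule continuous_on_coords[OF T H2 c st(1,3) dom])
  have contG: "continuous_on {s..t} (\<lambda>u. ?G u i j)" for i j
    by (rule continuous_on_compose2[OF smooth_on_imp_continuous_on[OF smooth_metric_coords[OF c]] contx])
      (use img in blast)
  have linD1: "linear (\<lambda>z. metric_deriv c (y c u) z i j)" if "u \<in> {s..t}" for u i j
    by (rule metric_deriv_linear1[OF c img(1)[OF that]])
  have linD2: "linear (\<lambda>a. ?D u a b)" if "u \<in> {s..t}" for u b
    by (rule metric_deriv_linear2[OF c img(1)[OF that]])
  have linD3: "linear (?D u a)" if "u \<in> {s..t}" for u a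
    using linD2[OF that, of a] metric_deriv_sym[OF c img(1)[OF that]] by (simp add: linear_iff)
  have primG: "primitive_on s t (\<lambda>u. ?G u i j) (\<lambda>u. ?D u i j)" for i j
  proof (rule primitive_on_C1)
    show "((\<lambda>u. ?G u i j) has_vector_derivative ?D u i j) (at u within {s..t})" if u: "u \<in> {s..t}" for u
    proof -
      have "(y c has_derivative (\<lambda>h. h *\<^sub>R v u c)) (at u within {s..t})"
        using H2_chart(1)[OF T H2 c st dom u] by (simp add: has_vector_derivative_def)
      from has_derivative_compose[OF this metric_coords_has_derivative[OF c img(1)[OF u]]]
      show ?thesis
        unfolding has_vector_derivative_def by (simp only: linear_cmul[OF linD1[OF u]])
    qed
    show "continuous_on {s..t} (\<lambda>u. ?D u i j)"
    proof (rule continuous_on_linear_family[where L = "\<lambda>u z. metric_deriv c (y c u) z i j"])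
      show "continuous_on {s..t} (\<lambda>u. metric_deriv c (y c u) z i j)" for z
        by (rule continuous_on_compose2[OF continuous_on_metric_deriv[OF c] contx]) (use img in blast)
      show "continuous_on {s..t} (\<lambda>u. v u c)" by (rule continuous_on_velocity_coords[OF T H2 c st dom])
    qed (rule linD1)
  qed
  have 1: "primitive_on s t (\<lambda>u. ?G u (v u c) j) (\<lambda>u. ?D u (v u c) j + ?G u (?w u) j)" for j
    by (rule primitive_on_linear_family[where L = "\<lambda>u a. ?G u a j", OF prim primG])
      (use bilG linD2 in \<open>auto simp: bilinear_def\<close>)
  have "primitive_on s t (\<lambda>u. ?G u (v u c) (v u c))
      (\<lambda>u. (?D u (v u c) (v u c) + ?G u (?w u) (v u c)) + ?G u (v u c) (?w u))"
  proof (rule primitive_on_linear_family[where L = "\<lambda>u. ?G u (v u c)", OF prim 1])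
    show "linear (?G u (v u c))" if "u \<in> {s..t}" for u
      using bilG[OF that] by (simp add: bilinear_def)
    show "linear (\<lambda>j. ?D u (v u c) j + ?G u (?w u) j)" if "u \<in> {s..t}" for u
      using bilG[OF that] linD3[OF that] by (intro linear_compose_add) (auto simp: bilinear_def)
  qed
  then show "primitive_on s t (\<lambda>u. g (q u) (v u) (v u)) (\<lambda>u. 2 * g (q u) (Y u) (v u))"
  proof (rule primitive_on_cong)
    fix u assume u: "u \<in> {s..t}"
    show "?G u (v u c) (v u c) = g (q u) (v u) (v u)"
      by (rule metric_eq_coords[OF c v[OF u] v[OF u] img(2)[OF u], symmetric])
    have "?D u (v u c) (v u c) = ?G u (geod T q c u) (v u c) + ?G u (v u c) (geod T q c u)"
      unfolding geod_def[OF T H2] by (rule metric_deriv_christoffel[OF c img(1)[OF u]])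
    then have "?D u (v u c) (v u c) + ?G u (?w u) (v u c) + ?G u (v u c) (?w u) = ?G u (Y u c) (v u c) + ?G u (v u c) (Y u c)"
      by (simp add: bilinear_lsub[OF bilG[OF u]] bilinear_rsub[OF bilG[OF u]])
    also have "\<dots> = 2 * g (q u) (Y u) (v u)"
      unfolding metric_eq_coords[OF c Yu[OF u] v[OF u] img(2)[OF u]]
      using metric_coords_sym[OF c img(1)[OF u], of "v u c" "Y u c"] by simp
    finally show "?D u (v u c) (v u c) + ?G u (?w u) (v u c) + ?G u (v u c) (?w u) = 2 * g (q u) (Y u) (v u)" .
  qed
  have "(\<lambda>u. \<Sum>i\<in>Basis. \<Sum>j\<in>Basis. ?G u i j *\<^sub>R ((Y u c \<bullet> i) * (Y u c \<bullet> j))) absolutely_integrable_on {s..t}"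
    by (intro absolutely_integrable_sum absolutely_integrable_continuous_scaleR contG L2_on_mult_integrable L2_on_component L2) auto
  then show "(\<lambda>u. g (q u) (Y u) (Y u)) absolutely_integrable_on {s..t}"
  proof (rule absolutely_integrable_spike[where S = "{}"])
    fix u assume "u \<in> {s..t} - {}"
    then have u: "u \<in> {s..t}" by simp
    show "g (q u) (Y u) (Y u) = (\<Sum>i\<in>Basis. \<Sum>j\<in>Basis. ?G u i j *\<^sub>R ((Y u c \<bullet> i) * (Y u c \<bullet> j)))"
      unfolding metric_eq_coords[OF c Yu[OF u] Yu[OF u] img(2)[OF u]]
      by (subst bilinear_basis_expansion[OF bilG[OF u]]) (simp add: algebra_simps)
  qed simp
qed

lemma energy:
  "primitive_on 0 T (\<lambda>u. g (q u) (v u) (v u)) (\<lambda>u. 2 * g (q u) (Y u) (v u))" (is ?A)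
  "(\<lambda>u. g (q u) (Y u) (Y u)) absolutely_integrable_on {0..T}" (is ?B)
proof -
  define Q where "Q a b \<longleftrightarrow> primitive_on a b (\<lambda>u. g (q u) (v u) (v u)) (\<lambda>u. 2 * g (q u) (Y u) (v u)) \<and>
    (\<lambda>u. g (q u) (Y u) (Y u)) absolutely_integrable_on {a..b}" for a b
  define P where "P a b \<longleftrightarrow> (0 \<le> a \<longrightarrow> a \<le> b \<longrightarrow> b \<le> T \<longrightarrow> Q a b)" for a b
  have "P 0 T"
  proof (rule Bolzano[where P = P])
    fix a b e assume P: "P a b" "P b e" "a \<le> b" "b \<le> e"
    show "P a e"
      unfolding P_def
    proof (intro impI)
      assume le: "0 \<le> a" "a \<le> e" "e \<le> T"
      have QQ: "Q a b" "Q b e" using P le unfolding P_def by auto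
      then have "(\<lambda>u. g (q u) (Y u) (Y u)) absolutely_integrable_on {a..b} \<union> {b..e}"
        unfolding Q_def by (intro absolutely_integrable_Un) auto
      moreover have "{a..b} \<union> {b..e} = {a..e}" using P by auto
      ultimately show "Q a e"
        using QQ P(3,4) unfolding Q_def by (auto intro: primitive_on_join)
    qed
  next
    fix z assume z: "0 \<le> z" "z \<le> T"
    obtain c where c: "c \<in> \<A>" "q z \<in> chart_dom c" by (rule chart_exists)
    obtain d where d: "d > 0" "\<And>u. u \<in> {0..T} \<Longrightarrow> \<bar>u - z\<bar> < d \<Longrightarrow> q u \<in> chart_dom c"
      using curve_stays_in_chart[OF continuous_on_H2[OF T H2] _ c(2) open_chart_dom[OF c(1)]] z by auto
    have "P a b" if ab: "a \<le> z" "z \<le> b" "b - a < d" for a b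
      unfolding P_def
    proof (intro impI)
      assume le: "0 \<le> a" "a \<le> b" "b \<le> T"
      have dom: "q ` {a..b} \<subseteq> chart_dom c"
        using d(2) ab le by auto
      show "Q a b"
      proof (cases "a < b")
        case True
        then show ?thesis unfolding Q_def using energy_local[OF c(1) le(1) True le(3) dom] by blast
      next
        case False
        then have ab: "a = b" using le by simp
        have null: "f absolutely_integrable_on {a..b}" for f :: "real \<Rightarrow> real"
          by (rule absolutely_integrable_spike[OF absolutely_integrable_continuous_real[OF continuous_on_const[of _ 0]], where S = "{a,b}"])
            (use ab in auto)
        show ?thesis
          unfolding Q_def
        proof (intro conjI primitive_onI null)
          fix s t assume "a \<le> s" "s \<le> t" "t \<le> b"
          then have "s = t" using ab by simp
          then show "((\<lambda>u. 2 * g (q u) (Y u) (v u)) has_integral (g (q t) (v t) (v t) - g (q s) (v s) (v s))) {s..t}"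
            by (simp add: has_integral_refl)
        qed
      qed
    qed
    then show "\<exists>d>0. \<forall>a b. a \<le> z \<and> z \<le> b \<and> b - a < d \<longrightarrow> P a b"
      using d(1) by blast
  qed (use T in simp)
  then show ?A ?B using T by (auto simp: P_def Q_def)
qed

text \<open>Expand \<open>0 \<le> \<parallel>l u - w\<parallel>\<^sup>2\<close>.\<close>

lemma metric_weighted_Cauchy:
  assumes u: "u \<in> tangent_space \<A> r" and w: "w \<in> tangent_space \<A> r" and l: "l > 0"
  shows "2 * g r u w \<le> l * g r u u + g r w w / l"
proof -
  obtain c where c: "c \<in> \<A>" "r \<in> chart_dom c" by (rule chart_exists)
  let ?G = "metric_coords \<A> g c (chart_map c r)"
  have x: "chart_map c r \<in> chart_img c" using c by auto
  have b: "bilinear ?G" by (rule bilinear_metric_coords[OF c(1) x])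
  have "0 \<le> ?G (l *\<^sub>R u c - w c) (l *\<^sub>R u c - w c)" by (rule metric_coords_nonneg[OF c(1) x])
  also have "\<dots> = l * (l * ?G (u c) (u c)) - 2 * l * ?G (u c) (w c) + ?G (w c) (w c)"
    using metric_coords_sym[OF c(1) x, of "w c" "u c"]
    by (simp add: bilinear_lsub[OF b] bilinear_rsub[OF b] bilinear_lmul[OF b] bilinear_rmul[OF b] algebra_simps)
  finally have "l * (2 * ?G (u c) (w c)) \<le> l * (l * ?G (u c) (u c) + ?G (w c) (w c) / l)"
    using l by (simp add: algebra_simps)
  then show ?thesis
    using l unfolding metric_eq_coords[OF c(1) u w c(2)] metric_eq_coords[OF c(1) u u c(2)] metric_eq_coords[OF c(1) w w c(2)]
    by (simp only: mult_le_cancel_left_pos)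
qed

text \<open>Integrate \<open>(\<parallel>q'\<parallel>\<^sup>2)' = 2 \<langle>Y, q'\<rangle> \<le> 2 T
  \<parallel>Y\<parallel>\<^sup>2 + \<parallel>q'\<parallel>\<^sup>2 / (2 T)\<close> up to the time
  \<open>m\<close> of maximal speed. The weight \<open>2 T\<close> is chosen so that the last term contributes
  at most half of the maximum, which is absorbed on the left.\<close>

lemma speed_bound:
  assumes t: "t \<in> {0..T}"
  shows "g (q t) (v t) (v t) \<le> 2 * g (q 0) (v 0) (v 0) + 4 * T * integral {0..T} (\<lambda>u. g (q u) (Y u) (Y u))"
proof -
  let ?N = "\<lambda>u. g (q u) (v u) (v u)" and ?a = "\<lambda>u. g (q u) (Y u) (Y u)"
  define E where "E = integral {0..T} ?a"
  have vt: "v u \<in> tangent_space \<A> (q u)" "Y u \<in> tangent_space \<A> (q u)" if "u \<in> {0..T}" for u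
    using velocity_tangent[OF T H2 that] acceleration_tangent[OF that] by auto
  have a0: "?a u \<ge> 0" if "u \<in> {0..T}" for u by (rule metric_nonneg[OF vt(2)[OF that]])
  have aint: "?a integrable_on {0..T}" using energy(2) by (rule set_lebesgue_integral_eq_integral(1))
  have "continuous_on {0..T} ?N" by (rule primitive_on_continuous[OF energy(1)])
  then obtain m where m: "m \<in> {0..T}" "\<And>u. u \<in> {0..T} \<Longrightarrow> ?N u \<le> ?N m"
    using continuous_attains_sup[of "{0..T}" ?N] T by auto
  have aint': "?a integrable_on {0..m}"
    by (rule integrable_on_subinterval[OF aint]) (use m in auto)
  have "?N m - ?N 0 = integral {0..m} (\<lambda>u. 2 * g (q u) (Y u) (v u))"
    using primitive_onD(4)[OF energy(1), of 0 m] m by simp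
  also have "\<dots> \<le> integral {0..m} (\<lambda>u. 2 * T * ?a u + ?N m / (2 * T))"
  proof (rule integral_le)
    show "(\<lambda>u. 2 * g (q u) (Y u) (v u)) integrable_on {0..m}"
      using primitive_onD(3)[OF energy(1), of 0 m] m by simp
    show "(\<lambda>u. 2 * T * ?a u + ?N m / (2 * T)) integrable_on {0..m}"
      using integrable_add[OF integrable_cmul[OF aint', of "2 * T"] integrable_const_ivl[of "?N m / (2 * T)" 0 m]] by simp
    fix u assume u: "u \<in> {0..m}"
    then have u': "u \<in> {0..T}" using m by auto
    have "2 * g (q u) (Y u) (v u) \<le> 2 * T * ?a u + ?N u / (2 * T)"
      by (rule metric_weighted_Cauchy[OF vt(2,1)[OF u']]) (use T in simp)
    also have "?N u / (2 * T) \<le> ?N m / (2 * T)"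
      using m(2)[OF u'] T by (simp add: divide_right_mono)
    finally show "2 * g (q u) (Y u) (v u) \<le> 2 * T * ?a u + ?N m / (2 * T)" by simp
  qed
  also have "\<dots> = 2 * T * integral {0..m} ?a + m * (?N m / (2 * T))"
    using integral_unique[OF has_integral_add[OF has_integral_mult_right[OF integrable_integral[OF aint'], of "2 * T"] has_integral_const_real[of "?N m / (2 * T)" 0 m]]] m
    by simp
  also have "\<dots> \<le> 2 * T * E + T * (?N m / (2 * T))"
  proof (intro add_mono mult_left_mono mult_right_mono)
    show "integral {0..m} ?a \<le> E"
      unfolding E_def by (rule integral_subset_le[OF _ aint' aint]) (use m a0 in auto)
    show "0 \<le> ?N m / (2 * T)" using metric_nonneg[OF vt(1)[OF m(1)]] T by simp
  qed (use m T in auto)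
  also have "T * (?N m / (2 * T)) = ?N m / 2" using T by simp
  finally have "?N m \<le> 2 * ?N 0 + 4 * T * E" by simp
  then show ?thesis using m(2)[OF t] unfolding E_def by simp
qed

end

lemma curve_Lipschitz:
  assumes T: "0 < T" and H2: "H2_curve \<A> T q" and conn: "connected (UNIV :: 'm set)"
    and E: "integral {0..T} (\<lambda>u. g (q u) (covariant_acceleration \<A> g T q u) (covariant_acceleration \<A> g T q u)) \<le> E"
    and st: "s \<in> {0..T}" "t \<in> {0..T}"
  shows "\<bar>d p (q t) - d p (q s)\<bar> \<le> sqrt (2 * g (q 0) (velocity \<A> T q 0) (velocity \<A> T q 0) + 4 * T * E) * \<bar>t - s\<bar>"
proof -
  interpret Metric_space UNIV d by (rule riemannian_dist_Metric_space[OF conn])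
  let ?M = "sqrt (2 * g (q 0) (velocity \<A> T q 0) (velocity \<A> T q 0) + 4 * T * E)"
  have speed: "speed T q u \<le> ?M" if "u \<in> {0..T}" for u
    unfolding speed_def metric_norm_def
    using speed_bound[OF T H2 covariant_acceleration[OF T H2] that] mult_left_mono[OF E, of "4 * T"] T
    by (intro real_sqrt_le_mono) linarith
  have le: "d (q s) (q t) \<le> ?M * (t - s)" if "0 \<le> s" "s < t" "t \<le> T" for s t
    by (rule riemannian_dist_le_speed_bound[OF H2_imp_C1_off[OF T H2] T that speed])
  have "d (q s) (q t) \<le> ?M * \<bar>t - s\<bar>"
    using le[of s t] le[of t s] st commute[of "q s" "q t"] by (cases s t rule: linorder_cases) auto
  moreover have "d p (q t) \<le> d p (q s) + d (q s) (q t)" "d p (q s) \<le> d p (q t) + d (q s) (q t)"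
    using triangle[of p "q s" "q t"] triangle[of p "q t" "q s"] commute[of "q s" "q t"] by auto
  ultimately show ?thesis by linarith
qed

end

section \<open>Obstacle avoidance\<close>

text \<open>The upper bound makes the potential integrable along curves.\<close>

lemma avoidance_potential_bounds:
  assumes "0 \<le> \<tau>" "0 < R" "0 \<le> d p x"
  shows "0 \<le> avoidance_potential d p R \<tau> k x" "avoidance_potential d p R \<tau> k x \<le> exp 1 * \<tau>"
proof -
  show "0 \<le> avoidance_potential d p R \<tau> k x" using assms by (simp add: avoidance_potential_def)
  have "exp (- (1 / (1 - (d p x / R) ^ (2 * k)))) \<le> 1" if "d p x < R"
  proof -
    have "(d p x / R) ^ (2 * k) \<le> 1" using assms that by (intro power_le_one) auto
    then show ?thesis by simp
  qed
  then show "avoidance_potential d p R \<tau> k x \<le> exp 1 * \<tau>"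
    using assms mult_left_mono[of _ 1 "exp 1 * \<tau>"] by (auto simp: avoidance_potential_def)
qed

text \<open>The potential decreases with the distance, and for a fixed distance below \<open>R\<close> it does not
  decrease with \<open>k\<close>. So its value at distance \<open>\<rho>\<close> for \<open>k = 1\<close> is a
  lower bound on the ball of radius \<open>\<rho>\<close> for all positive \<open>k\<close>.\<close>

lemma avoidance_potential_ge:
  assumes \<tau>: "0 \<le> \<tau>" and R: "0 < R" and \<rho>: "\<rho> < R" and x: "0 \<le> d p x" "d p x \<le> \<rho>" and k: "0 < k"
  shows "exp 1 * \<tau> * exp (- (1 / (1 - (\<rho> / R)\<^sup>2))) \<le> avoidance_potential d p R \<tau> k x"
proof -
  let ?z = "d p x / R"
  have z: "0 \<le> ?z" "?z \<le> \<rho> / R" "\<rho> / R < 1" using x R \<rho> by (auto simp: divide_right_mono)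
  have "?z ^ (2 * k) \<le> ?z ^ 2" using z k by (intro power_decreasing) auto
  also have "\<dots> \<le> (\<rho> / R)\<^sup>2" using z by (intro power_mono) auto
  finally have 1: "?z ^ (2 * k) \<le> (\<rho> / R)\<^sup>2" .
  have 2: "(\<rho> / R)\<^sup>2 < 1" using z by (intro power_less_one_iff[THEN iffD2, of "\<rho> / R" 2] ) auto
  have "1 / (1 - ?z ^ (2 * k)) \<le> 1 / (1 - (\<rho> / R)\<^sup>2)"
    using 1 2 by (intro divide_left_mono mult_pos_pos) auto
  then show ?thesis
    using \<tau> x \<rho> by (auto simp: avoidance_potential_def intro!: mult_left_mono)
qed

theorem corollary1:
  fixes \<A> :: "('m::{t2_space, second_countable_topology}, 'e::euclidean_space) chart set"
    and g :: "('m, 'e) metric"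
    and T h R :: real
    and p q\<^sub>0 q\<^sub>T :: 'm
    and v\<^sub>0 v\<^sub>T :: "('m, 'e) tangent"
  assumes "riemannian_manifold \<A> g"
    and "connected (UNIV :: 'm set)"
    and "riemannian_complete \<A> g"
    and "T > 0"
    and "v\<^sub>0 \<in> tangent_space \<A> q\<^sub>0"
    and "v\<^sub>T \<in> tangent_space \<A> q\<^sub>T"
    and "h > 0"
    and "0 < R" and "R \<le> h"
    and feasible: "\<exists>q\<in>admissible_curves \<A> T q\<^sub>0 v\<^sub>0 q\<^sub>T v\<^sub>T. avoids_obstacle \<A> g T p R q"
  shows "\<forall>r. 0 < r \<and> r < R \<longrightarrow>
    (\<exists>\<tau>' > 0. \<exists>k' :: nat. \<forall>\<tau> > \<tau>'. \<forall>k > k'. \<forall>q.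
      is_minimizer (action \<A> g T (avoidance_potential (riemannian_dist \<A> g) p R \<tau> k))
        (admissible_curves \<A> T q\<^sub>0 v\<^sub>0 q\<^sub>T v\<^sub>T) q \<longrightarrow>
      avoids_obstacle \<A> g T p r q)"
proof (intro allI impI)
  fix r assume r: "0 < r \<and> r < R"
  interpret riemannian \<A> g by standard fact
  interpret Metric_space UNIV d by (rule riemannian_dist_Metric_space) fact
  note T = \<open>T > 0\<close> and R = \<open>0 < R\<close>
  let ?V = "avoidance_potential d p R" and ?\<Omega> = "admissible_curves \<A> T q\<^sub>0 v\<^sub>0 q\<^sub>T v\<^sub>T"
  define a where "a q u = g (q u) (covariant_acceleration \<A> g T q u) (covariant_acceleration \<A> g T q u)" for q u
  have a0: "(metric_norm g (q u) (covariant_acceleration \<A> g T q u))\<^sup>2 = a q u" "a q u \<ge> 0"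
    if "H2_curve \<A> T q" "u \<in> {0..T}" for q u
    using metric_nonneg[OF acceleration_tangent[OF T that(1) covariant_acceleration[OF T that(1)] that(2)]]
    by (auto simp: a_def metric_norm_def)
  have aint: "a q absolutely_integrable_on {0..T}" if "H2_curve \<A> T q" for q
    unfolding a_def by (rule energy(2)[OF T that covariant_acceleration[OF T that]])
  obtain q' where q': "q' \<in> ?\<Omega>" "avoids_obstacle \<A> g T p R q'" using feasible by blast
  have H2q': "H2_curve \<A> T q'" using q' by (simp add: admissible_curves_def)
  define E where "E = integral {0..T} (a q')"
  have E0: "E \<ge> 0"
    unfolding E_def using a0(2)[OF H2q'] aint[OF H2q']
    by (intro integral_nonneg) (auto dest: set_lebesgue_integral_eq_integral(1))
  have Vq': "?V \<tau> k (q' u) = 0" if "u \<in> {0..T}" for \<tau> k u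
    using q'(2) that by (auto simp: avoids_obstacle_def avoidance_potential_def)
  have Jq': "2 * action \<A> g T (?V \<tau> k) q' = E" for \<tau> k
  proof -
    have "(LINT t:{0..T}|lebesgue. (metric_norm g (q' t) (covariant_acceleration \<A> g T q' t))\<^sup>2 + ?V \<tau> k (q' t))
        = (LINT t:{0..T}|lebesgue. a q' t)"
      by (intro set_lebesgue_integral_cong) (auto simp: a0[OF H2q'] Vq')
    then show ?thesis
      by (simp add: action_def E_def set_lebesgue_integral_eq_integral(2)[OF aint[OF H2q']])
  qed
  \<comment> \<open>\<open>M\<close> bounds the speed; adding \<open>1\<close> keeps it positive when the bound vanishes. During a
    time \<open>l\<close> a curve that starts in the ball of radius \<open>r\<close> cannot leave the ball of
    radius \<open>\<rho>\<close>; the bound \<open>T / 2\<close> leaves room for an interval of length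
    \<open>l\<close> on one side of each time. The potential is at least \<open>b \<tau>\<close> in the larger
    ball.\<close>
  define M where "M = sqrt (2 * g q\<^sub>0 v\<^sub>0 v\<^sub>0 + 4 * T * E) + 1"
  define \<rho> where "\<rho> = (r + R) / 2"
  define l where "l = min (T / 2) ((\<rho> - r) / M)"
  define b where "b = exp 1 * exp (- (1 / (1 - (\<rho> / R)\<^sup>2)))"
  have g0: "g q\<^sub>0 v\<^sub>0 v\<^sub>0 \<ge> 0" by (rule metric_nonneg) fact
  then have M: "M > 0" using E0 T by (auto simp: M_def intro!: add_nonneg_pos)
  have \<rho>: "r < \<rho>" "\<rho> < R" using r by (auto simp: \<rho>_def)
  have l: "0 < l" "l \<le> T / 2" "M * l \<le> \<rho> - r"
    using T M \<rho> by (auto simp: l_def min_def field_simps)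
  have b: "b > 0" by (simp add: b_def)
  have key: "avoids_obstacle \<A> g T p r q"
    if \<tau>: "\<tau> > E / (l * b) + 1" and k: "0 < k" and min: "is_minimizer (action \<A> g T (?V \<tau> k)) ?\<Omega> q" for \<tau> k q
  proof (rule ccontr)
    assume "\<not> avoids_obstacle \<A> g T p r q"
    then obtain t0 where t0: "t0 \<in> {0..T}" "d p (q t0) < r"
      by (auto simp: avoids_obstacle_def mball_def)
    have q\<Omega>: "q \<in> ?\<Omega>" using min by (simp add: is_minimizer_def)
    then have H2: "H2_curve \<A> T q" and q0: "q 0 = q\<^sub>0" "velocity \<A> T q 0 = v\<^sub>0"
      by (auto simp: admissible_curves_def)
    have \<tau>0: "\<tau> > 0" using \<tau> E0 l b by (smt (verit) divide_nonneg_pos mult_pos_pos)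
    have ai: "a q integrable_on {0..T}" using aint[OF H2] by (rule set_lebesgue_integral_eq_integral(1))
    have Lip: "\<bar>d p (q t) - d p (q s)\<bar> \<le> sqrt (2 * g q\<^sub>0 v\<^sub>0 v\<^sub>0 + 4 * T * e) * \<bar>t - s\<bar>"
      if "integral {0..T} (a q) \<le> e" "s \<in> {0..T}" "t \<in> {0..T}" for e s t
      using curve_Lipschitz[OF T H2 \<open>connected UNIV\<close> that(1)[unfolded a_def] that(2,3)] by (simp add: q0)
    let ?D = "\<lambda>t. d p (q t)"
    have contD: "continuous_on {0..T} ?D"
    proof (rule lipschitz_on_continuous_on[OF lipschitz_onI])
      show "dist (?D u) (?D w) \<le> sqrt (2 * g q\<^sub>0 v\<^sub>0 v\<^sub>0 + 4 * T * integral {0..T} (a q)) * dist u w"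
        if "u \<in> {0..T}" "w \<in> {0..T}" for u w
        using Lip[OF order_refl that(2,1)] by (simp add: dist_real_def)
      show "0 \<le> sqrt (2 * g q\<^sub>0 v\<^sub>0 v\<^sub>0 + 4 * T * integral {0..T} (a q))"
        using g0 T a0(2)[OF H2] ai by (intro real_sqrt_ge_zero add_nonneg_nonneg mult_nonneg_nonneg integral_nonneg) auto
    qed
    have V_bounds: "0 \<le> ?V \<tau> k (q t)" "?V \<tau> k (q t) \<le> exp 1 * \<tau>" for t
      using avoidance_potential_bounds[of \<tau> R d p "q t" k] \<tau>0 R by auto
    have Vint: "(\<lambda>t. ?V \<tau> k (q t)) absolutely_integrable_on {0..T}"
    proof -
      let ?f = "\<lambda>x. if x < R then exp 1 * \<tau> * exp (- (1 / (1 - (x / R) ^ (2 * k)))) else 0 :: real"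
      have "?f \<in> borel_measurable borel" by measurable
      then have "(\<lambda>t. ?f (?D t)) \<in> borel_measurable (lebesgue_on {0..T})"
        by (rule measurable_compose[rotated]) (intro continuous_imp_measurable_on_sets_lebesgue contD, simp)
      then have meas: "(\<lambda>t. ?V \<tau> k (q t)) \<in> borel_measurable (lebesgue_on {0..T})"
        by (simp add: avoidance_potential_def)
      have "integrable (lebesgue_on {0..T}) (\<lambda>_. exp 1 * \<tau>)"
        using absolutely_integrable_continuous_real[OF continuous_on_const[of "{0..T}" "exp 1 * \<tau>"]]
        by (simp only: absolutely_integrable_on_iff_lebesgue_on)
      then have "integrable (lebesgue_on {0..T}) (\<lambda>t. ?V \<tau> k (q t))"
      proof (rule Bochner_Integration.integrable_bound[OF _ meas])
        show "AE t in lebesgue_on {0..T}. norm (?V \<tau> k (q t)) \<le> norm (exp 1 * \<tau>)"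
          using V_bounds by (intro AE_I2) (metis abs_of_nonneg order_trans real_norm_def)
      qed
      then show ?thesis by (simp only: absolutely_integrable_on_iff_lebesgue_on)
    qed
    have Vi: "(\<lambda>t. ?V \<tau> k (q t)) integrable_on {0..T}" using Vint by (rule set_lebesgue_integral_eq_integral(1))
    have "2 * action \<A> g T (?V \<tau> k) q = (LINT t:{0..T}|lebesgue. a q t + ?V \<tau> k (q t))"
      unfolding action_def by (simp, intro set_lebesgue_integral_cong) (auto simp: a0[OF H2])
    also have "\<dots> = integral {0..T} (a q) + integral {0..T} (\<lambda>t. ?V \<tau> k (q t))"
      using set_integral_add(2)[OF aint[OF H2] Vint] aint[OF H2] Vint by (simp add: set_lebesgue_integral_eq_integral(2))
    finally have "integral {0..T} (a q) + integral {0..T} (\<lambda>t. ?V \<tau> k (q t)) \<le> E"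
      using min q'(1) Jq'[of \<tau> k] by (auto simp: is_minimizer_def)
    moreover have "integral {0..T} (\<lambda>t. ?V \<tau> k (q t)) \<ge> 0" using V_bounds Vi by (intro integral_nonneg) auto
    moreover have "integral {0..T} (a q) \<ge> 0" using a0(2)[OF H2] ai by (intro integral_nonneg) auto
    ultimately have Ea: "integral {0..T} (a q) \<le> E" and EV: "integral {0..T} (\<lambda>t. ?V \<tau> k (q t)) \<le> E" by auto
    \<comment> \<open>An interval of length \<open>l\<close> in \<open>[0,T]\<close> with \<open>t0\<close> as one of its ends.\<close>
    define s t where "s = (if t0 + l \<le> T then t0 else t0 - l)" and "t = (if t0 + l \<le> T then t0 + l else t0)"
    have st: "0 \<le> s" "t \<le> T" "t = s + l" "t0 \<in> {s..t}"
      using t0 l by (auto simp: s_def t_def)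
    have close: "?D u \<le> \<rho>" if u: "u \<in> {s..t}" for u
    proof -
      have "\<bar>?D u - ?D t0\<bar> \<le> sqrt (2 * g q\<^sub>0 v\<^sub>0 v\<^sub>0 + 4 * T * E) * \<bar>u - t0\<bar>"
        using Lip[OF Ea, of t0 u] u st t0 by auto
      also have "\<dots> \<le> M * l"
        using u st g0 E0 T l by (intro mult_mono) (auto simp: M_def)
      finally show ?thesis using t0 l by linarith
    qed
    have "l * (\<tau> * b) = integral {s..t} (\<lambda>_. \<tau> * b)" using st l by simp
    also have "\<dots> \<le> integral {s..t} (\<lambda>u. ?V \<tau> k (q u))"
    proof (rule integral_le)
      show "(\<lambda>u. ?V \<tau> k (q u)) integrable_on {s..t}"
        by (rule integrable_on_subinterval[OF Vi]) (use st in auto)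
      show "\<tau> * b \<le> ?V \<tau> k (q u)" if "u \<in> {s..t}" for u
        using avoidance_potential_ge[of \<tau> R \<rho> d p "q u" k] \<tau>0 R \<rho> close[OF that] k
        by (simp add: b_def mult_ac)
    qed (simp add: integrable_const_ivl)
    also have "\<dots> \<le> integral {0..T} (\<lambda>u. ?V \<tau> k (q u))"
      by (rule integral_subset_le[OF _ _ Vi]) (use st V_bounds in \<open>auto intro: integrable_on_subinterval[OF Vi]\<close>)
    also have "\<dots> \<le> E" by (rule EV)
    finally have "\<tau> * (l * b) \<le> E" by (simp add: mult_ac)
    then have "\<tau> \<le> E / (l * b)" using l b by (simp add: pos_le_divide_eq)
    then show False using \<tau> by simp
  qed
  have "E / (l * b) + 1 > 0" using E0 l b by (smt (verit) divide_nonneg_pos mult_pos_pos)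
  then show "\<exists>\<tau>' > 0. \<exists>k' :: nat. \<forall>\<tau> > \<tau>'. \<forall>k > k'. \<forall>q.
      is_minimizer (action \<A> g T (?V \<tau> k)) ?\<Omega> q \<longrightarrow> avoids_obstacle \<A> g T p r q"
    using key by blast
qed

end
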